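(* Let $K$ be a commutative ring with unit that is both a $\mathbb{Q}$-ring (contains $\mathbb{Q}$ as a subring) and an integral domain, let $\chi=(\chi_d\colon W_d\to U(K))_{d\ge1}$ be an $\omega$-invariant sequence of characters, and let $E$ be a $K$-module with finite basis. The addition and the external composition law $(a,a^* )\mapsto a\lfloor a^*$ ($a\in[\chi](E)$, $a^*\in[\chi](E^* )$) on $[\chi](E)$ define on this set a structure of right unital $[\chi](E^* )$-module.
   Context: $S_\infty$ is the group of permutations of the positive integers fixing all but finitely many elements, $S_d\le S_\infty$ the subgroup fixing all $t>d$, and $\omega\colon S_\infty\to S_\infty$ the injective endomorphism $(\omega(\sigma))(1)=1$, $(\omega(\sigma))(t)=\sigma(t-1)+1$ for $t\ge2$. A sequence of group homomorphisms $\chi=(\chi_d\colon W_d\to U(K))_{d\ge1}$ ($U(K)$ the group of units of $K$) is $\omega$-invariant if $W_d\le S_d$, $W_d\le W_{d+1}$, $\omega(W_d)\le W_{d+1}$, and $\chi_{d+1}|_{W_d}=\chi_d=\chi_{d+1}\circ\omega|_{W_d}$ for all $d\ge1$. We write $\chi(\sigma)=\chi_d(\sigma)$ for $\sigma\in W_d$. It is known that then $\chi_d=\chi_d^{-1}$ for all $d$. $S_d$ acts on $T^d(E)$ by $\sigma(x_1\otimes\cdots\otimes x_d)=x_{\sigma^{-1}(1)}\otimes\cdots\otimes x_{\sigma^{-1}(d)}$. $[\chi]^d(E)$ is the quotient of $T^d(E)$ by the submodule generated by all $\chi_d(\sigma)^{-1}z-\sigma z$, $\sigma\in W_d$, $z\in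 T^d(E)$; $[\chi]^0(E)=K$; the image of $x_1\otimes\cdots\otimes x_d$ is $x_1\chi\ldots\chi x_d$. $[\chi](E)=\coprod_{d\ge0}[\chi]^d(E)$ is an associative graded $K$-algebra with unit, with product (also denoted by $\chi$) $(x_1\chi\ldots\chi x_d)\chi(y_1\chi\ldots\chi y_e)=x_1\chi\ldots\chi x_d\chi y_1\chi\ldots\chi y_e$; likewise for $[\chi](E^* )$. $\langle\ ,\ \rangle\colon[\chi](E)\times[\chi](E^* )\to K$ is the bilinear form for which components of different degrees are orthogonal, $\langle x_1\chi\ldots\chi x_d,x_1^*\chi\ldots\chi x_d^*\rangle=\sum_{\sigma\in W_d}\chi(\sigma)\prod_{t=1}^d x_t^*(x_{\sigma^{-1}(t)})$ for $d\ge1$, and $\langle k,k^*\rangle=kk^*$ in degree $0$; it is non-singular in each degree (the $K$-modules $[\chi]^d(E)$, $[\chi]^d(E^* )$ being free of finite rank), so each of $[\chi](E)$, $[\chi](E^* )$ is identified with the graded dual of the other. Right inner product: for $a\in[\chi](E)$ and $a^*\in[\chi](E^* )$, $a\lfloor a^*\in[\chi](E)$ is the image of $a$ under the transpose of the left multiplication $x^*\mapsto a^*\chi x^*$ of $[\chi](E^* )$; i.e. it is the unique element with $\langle a\lfloor a^*,x^*\rangle=\langle a,a^*\chi x^*\rangle$ for all $x^*\in[\chi](E^* )$. *)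

theory Defs
  imports
    "HOL-Algebra.Module"
    "HOL-Algebra.AbelCoset"
    "HOL-Algebra.Sym_Groups"
    "HOL-Algebra.Algebraic_Closure_Type"
begin

section \<open>Modules over a commutative ring\<close>

text \<open>The record \<^typ>\<open>('k, 'm) module\<close> extends \<^typ>\<open>'m ring\<close>. For plain modules the fields
  \<^const>\<open>monoid.mult\<close> and \<^const>\<open>monoid.one\<close> carry no information and are left \<^const>\<open>undefined\<close>.\<close>

definition contains_rationals :: "('k, 'r) ring_scheme \<Rightarrow> bool" where
  "contains_rationals K \<longleftrightarrow>
     (\<exists>h \<in> ring_hom (ring_of_type_algebra :: rat ring) K. inj h)"

definition finite_basis ::
    "('k, 'r) ring_scheme \<Rightarrow> ('k, 'e, 's) module_scheme \<Rightarrow> 'e set \<Rightarrow> bool" where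
  "finite_basis K E B \<longleftrightarrow> finite B \<and> B \<subseteq> carrier E \<and>
     (\<forall>x \<in> carrier E. \<exists>!c. c \<in> B \<rightarrow>\<^sub>E carrier K \<and> x = (\<Oplus>\<^bsub>E\<^esub>b \<in> B. c b \<odot>\<^bsub>E\<^esub> b))"

definition self_module :: "('k, 'r) ring_scheme \<Rightarrow> ('k, 'k) module" where
  "self_module K = \<lparr>carrier = carrier K, monoid.mult = undefined, monoid.one = undefined,
     ring.zero = \<zero>\<^bsub>K\<^esub>, ring.add = ring.add K, module.smult = monoid.mult K\<rparr>"

text \<open>The dual module; functionals are extensional (\<^const>\<open>undefined\<close> outside the carrier), so
  that equality of functionals is equality of functions.\<close>

definition dual_module ::
    "('k, 'r) ring_scheme \<Rightarrow> ('k, 'e, 's) module_scheme \<Rightarrow> ('k, 'e \<Rightarrow> 'k) module" where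
  "dual_module K E = \<lparr>
     carrier = {f \<in> carrier E \<rightarrow>\<^sub>E carrier K.
       (\<forall>x \<in> carrier E. \<forall>y \<in> carrier E. f (x \<oplus>\<^bsub>E\<^esub> y) = f x \<oplus>\<^bsub>K\<^esub> f y) \<and>
       (\<forall>k \<in> carrier K. \<forall>x \<in> carrier E. f (k \<odot>\<^bsub>E\<^esub> x) = k \<otimes>\<^bsub>K\<^esub> f x)},
     monoid.mult = undefined, monoid.one = undefined,
     ring.zero = (\<lambda>x \<in> carrier E. \<zero>\<^bsub>K\<^esub>),
     ring.add = (\<lambda>f g. \<lambda>x \<in> carrier E. f x \<oplus>\<^bsub>K\<^esub> g x),
     module.smult = (\<lambda>k f. \<lambda>x \<in> carrier E. k \<otimes>\<^bsub>K\<^esub> f x)\<rparr>"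

definition generated_submodule ::
    "('k, 'r) ring_scheme \<Rightarrow> ('k, 'm, 's) module_scheme \<Rightarrow> 'm set \<Rightarrow> 'm set" where
  "generated_submodule K M S = (\<lambda>N. submodule N K M) hull S"

definition quotient_module ::
    "('k, 'm, 's) module_scheme \<Rightarrow> 'm set \<Rightarrow> ('k, 'm set) module" where
  "quotient_module M N = \<lparr>carrier = a_rcosets\<^bsub>M\<^esub> N, monoid.mult = undefined, monoid.one = undefined,
     ring.zero = N, ring.add = set_add M,
     module.smult = (\<lambda>k C. \<Union>x \<in> C. N +>\<^bsub>M\<^esub> (k \<odot>\<^bsub>M\<^esub> x))\<rparr>"

definition free_module :: "('k, 'r) ring_scheme \<Rightarrow> 'i set \<Rightarrow> ('k, 'i \<Rightarrow> 'k) module" where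
  "free_module K I = \<lparr>
     carrier = {f. (\<forall>i. f i \<in> carrier K) \<and> (\<forall>i. i \<notin> I \<longrightarrow> f i = \<zero>\<^bsub>K\<^esub>) \<and>
       finite {i. f i \<noteq> \<zero>\<^bsub>K\<^esub>}},
     monoid.mult = undefined, monoid.one = undefined,
     ring.zero = (\<lambda>i. \<zero>\<^bsub>K\<^esub>),
     ring.add = (\<lambda>f g i. f i \<oplus>\<^bsub>K\<^esub> g i),
     module.smult = (\<lambda>k f i. k \<otimes>\<^bsub>K\<^esub> f i)\<rparr>"

definition free_gen :: "('k, 'r) ring_scheme \<Rightarrow> 'i \<Rightarrow> 'i \<Rightarrow> 'k" where
  "free_gen K i = (\<lambda>j. if j = i then \<one>\<^bsub>K\<^esub> else \<zero>\<^bsub>K\<^esub>)"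

text \<open>The linear extension to a free module of a map on its generators.\<close>

definition free_lift ::
    "('k, 'r) ring_scheme \<Rightarrow> ('k, 'm, 's) module_scheme \<Rightarrow> ('i \<Rightarrow> 'm) \<Rightarrow> ('i \<Rightarrow> 'k) \<Rightarrow> 'm" where
  "free_lift K M \<phi> f = (\<Oplus>\<^bsub>M\<^esub>i \<in> {i. f i \<noteq> \<zero>\<^bsub>K\<^esub>}. f i \<odot>\<^bsub>M\<^esub> \<phi> i)"

section \<open>Tensor powers\<close>

definition words :: "('k, 'e, 's) module_scheme \<Rightarrow> nat \<Rightarrow> 'e list set" where
  "words E d = {xs. length xs = d \<and> set xs \<subseteq> carrier E}"

definition multilinear_relations ::
    "('k, 'r) ring_scheme \<Rightarrow> ('k, 'e, 's) module_scheme \<Rightarrow> nat \<Rightarrow> ('e list \<Rightarrow> 'k) set" where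
  "multilinear_relations K E d = (let F = free_module K (words E d); g = free_gen K in
     {g (us @ (x \<oplus>\<^bsub>E\<^esub> y) # vs) \<ominus>\<^bsub>F\<^esub> (g (us @ x # vs) \<oplus>\<^bsub>F\<^esub> g (us @ y # vs)) | us vs x y.
        us @ x # vs \<in> words E d \<and> y \<in> carrier E} \<union>
     {g (us @ (k \<odot>\<^bsub>E\<^esub> x) # vs) \<ominus>\<^bsub>F\<^esub> (k \<odot>\<^bsub>F\<^esub> g (us @ x # vs)) | us vs k x.
        us @ x # vs \<in> words E d \<and> k \<in> carrier K})"

text \<open>\<open>T\<^sup>d(E)\<close>. For \<open>d = 0\<close> there are no relations and the only word is \<open>[]\<close>, so the
  result is \<open>K\<close>, with \<open>1\<close> the empty tensor.\<close>

definition tensor_power ::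
    "('k, 'r) ring_scheme \<Rightarrow> ('k, 'e, 's) module_scheme \<Rightarrow> nat \<Rightarrow>
      ('k, ('e list \<Rightarrow> 'k) set) module" where
  "tensor_power K E d = (let F = free_module K (words E d) in
     quotient_module F (generated_submodule K F (multilinear_relations K E d)))"

definition tensor ::
    "('k, 'r) ring_scheme \<Rightarrow> ('k, 'e, 's) module_scheme \<Rightarrow> 'e list \<Rightarrow> ('e list \<Rightarrow> 'k) set" where
  "tensor K E xs = (let F = free_module K (words E (length xs)) in
     generated_submodule K F (multilinear_relations K E (length xs)) +>\<^bsub>F\<^esub> free_gen K xs)"

text \<open>The linear map on a tensor power with prescribed values on the tensors
  \<open>x\<^sub>1 \<otimes> \<dots> \<otimes> x\<^sub>d\<close>. It is meaningful only if these values depend multilinearly on the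
  \<open>x\<^sub>t\<close>: then the image of a coset under \<^const>\<open>free_lift\<close> is a singleton.\<close>

definition tensor_lift ::
    "('k, 'r) ring_scheme \<Rightarrow> ('k, 'm, 's) module_scheme \<Rightarrow> ('e list \<Rightarrow> 'm) \<Rightarrow>
      ('e list \<Rightarrow> 'k) set \<Rightarrow> 'm" where
  "tensor_lift K M \<phi> z = the_elem (free_lift K M \<phi> ` z)"

section \<open>Sequences of characters\<close>

text \<open>Elements of \<open>S\<^sub>\<infinity>\<close> are finitary permutations of \<^typ>\<open>nat\<close> that fix \<open>0\<close>, and
  \<open>S\<^sub>d\<close> is \<^term>\<open>sym_group d\<close>.\<close>

definition \<omega> :: "(nat \<Rightarrow> nat) \<Rightarrow> nat \<Rightarrow> nat" where
  "\<omega> \<sigma> t = (if t \<ge> 2 then \<sigma> (t - 1) + 1 else t)"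

text \<open>The values of \<open>W\<close> and \<open>\<chi>\<close> at index \<open>0\<close> are irrelevant here and below.\<close>

definition omega_invariant ::
    "('k, 'r) ring_scheme \<Rightarrow> (nat \<Rightarrow> (nat \<Rightarrow> nat) set) \<Rightarrow> (nat \<Rightarrow> (nat \<Rightarrow> nat) \<Rightarrow> 'k) \<Rightarrow> bool" where
  "omega_invariant K W \<chi> \<longleftrightarrow> (\<forall>d \<ge> 1.
     subgroup (W d) (sym_group d) \<and>
     \<chi> d \<in> hom (sym_group d \<lparr>carrier := W d\<rparr>) (units_of K) \<and>
     W d \<subseteq> W (d + 1) \<and> \<omega> ` W d \<subseteq> W (d + 1) \<and>
     (\<forall>\<sigma> \<in> W d. \<chi> (d + 1) \<sigma> = \<chi> d \<sigma> \<and> \<chi> (d + 1) (\<omega> \<sigma>) = \<chi> d \<sigma>))"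

text \<open>\<open>(x\<^sub>1, \<dots>, x\<^sub>d) \<mapsto> (x\<^bsub>\<sigma>\<inverse>(1)\<^esub>, \<dots>, x\<^bsub>\<sigma>\<inverse>(d)\<^esub>)\<close>; lists are indexed from \<open>0\<close>.\<close>

definition permute_word :: "(nat \<Rightarrow> nat) \<Rightarrow> 'e list \<Rightarrow> 'e list" where
  "permute_word \<sigma> xs = map (\<lambda>t. xs ! (Hilbert_Choice.inv \<sigma> t - 1)) [1..<length xs + 1]"

definition tensor_action ::
    "('k, 'r) ring_scheme \<Rightarrow> ('k, 'e, 's) module_scheme \<Rightarrow> nat \<Rightarrow> (nat \<Rightarrow> nat) \<Rightarrow>
      ('e list \<Rightarrow> 'k) set \<Rightarrow> ('e list \<Rightarrow> 'k) set" where
  "tensor_action K E d \<sigma> =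
     tensor_lift K (tensor_power K E d) (\<lambda>xs. tensor K E (permute_word \<sigma> xs))"

section \<open>The algebra \<open>[\<chi>](E)\<close>\<close>

definition chi_submodule ::
    "('k, 'r) ring_scheme \<Rightarrow> (nat \<Rightarrow> (nat \<Rightarrow> nat) set) \<Rightarrow> (nat \<Rightarrow> (nat \<Rightarrow> nat) \<Rightarrow> 'k) \<Rightarrow>
      ('k, 'e, 's) module_scheme \<Rightarrow> nat \<Rightarrow> ('e list \<Rightarrow> 'k) set set" where
  "chi_submodule K W \<chi> E d = (let T = tensor_power K E d in
     generated_submodule K T
       {((inv\<^bsub>K\<^esub> (\<chi> d \<sigma>)) \<odot>\<^bsub>T\<^esub> z) \<ominus>\<^bsub>T\<^esub> tensor_action K E d \<sigma> z | \<sigma> z.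
          d \<ge> 1 \<and> \<sigma> \<in> W d \<and> z \<in> carrier T})"

text \<open>\<open>[\<chi>]\<^sup>d(E)\<close>. For \<open>d = 0\<close> this is \<open>T\<^sup>0(E) = K\<close> modulo its zero submodule.\<close>

definition chi_power ::
    "('k, 'r) ring_scheme \<Rightarrow> (nat \<Rightarrow> (nat \<Rightarrow> nat) set) \<Rightarrow> (nat \<Rightarrow> (nat \<Rightarrow> nat) \<Rightarrow> 'k) \<Rightarrow>
      ('k, 'e, 's) module_scheme \<Rightarrow> nat \<Rightarrow> ('k, ('e list \<Rightarrow> 'k) set set) module" where
  "chi_power K W \<chi> E d = quotient_module (tensor_power K E d) (chi_submodule K W \<chi> E d)"

text \<open>\<open>x\<^sub>1 \<chi> \<dots> \<chi> x\<^sub>d\<close>\<close>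

definition chi_word ::
    "('k, 'r) ring_scheme \<Rightarrow> (nat \<Rightarrow> (nat \<Rightarrow> nat) set) \<Rightarrow> (nat \<Rightarrow> (nat \<Rightarrow> nat) \<Rightarrow> 'k) \<Rightarrow>
      ('k, 'e, 's) module_scheme \<Rightarrow> 'e list \<Rightarrow> ('e list \<Rightarrow> 'k) set set" where
  "chi_word K W \<chi> E xs =
     chi_submodule K W \<chi> E (length xs) +>\<^bsub>tensor_power K E (length xs)\<^esub> tensor K E xs"

text \<open>The linear map on \<open>[\<chi>]\<^sup>d(E)\<close> with prescribed values on the
  \<open>x\<^sub>1 \<chi> \<dots> \<chi> x\<^sub>d\<close>, with the same proviso as for \<^const>\<open>tensor_lift\<close>.\<close>

definition chi_lift ::
    "('k, 'r) ring_scheme \<Rightarrow> ('k, 'm, 's) module_scheme \<Rightarrow> ('e list \<Rightarrow> 'm) \<Rightarrow>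
      ('e list \<Rightarrow> 'k) set set \<Rightarrow> 'm" where
  "chi_lift K M \<phi> u = the_elem (tensor_lift K M \<phi> ` u)"

text \<open>The component \<open>[\<chi>]\<^sup>d(E) \<times> [\<chi>]\<^sup>e(E) \<rightarrow> [\<chi>]\<^bsup>d+e\<^esup>(E)\<close> of the product:
  \<open>(x\<^sub>1 \<chi> \<dots> \<chi> x\<^sub>d, y\<^sub>1 \<chi> \<dots> \<chi> y\<^sub>e) \<mapsto> x\<^sub>1 \<chi> \<dots> \<chi> x\<^sub>d \<chi> y\<^sub>1 \<chi> \<dots> \<chi> y\<^sub>e\<close>.\<close>

definition chi_mult ::
    "('k, 'r) ring_scheme \<Rightarrow> (nat \<Rightarrow> (nat \<Rightarrow> nat) set) \<Rightarrow> (nat \<Rightarrow> (nat \<Rightarrow> nat) \<Rightarrow> 'k) \<Rightarrow>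
      ('k, 'e, 's) module_scheme \<Rightarrow> nat \<Rightarrow> nat \<Rightarrow>
      ('e list \<Rightarrow> 'k) set set \<Rightarrow> ('e list \<Rightarrow> 'k) set set \<Rightarrow> ('e list \<Rightarrow> 'k) set set" where
  "chi_mult K W \<chi> E d e u v = (let P = chi_power K W \<chi> E (d + e) in
     chi_lift K P (\<lambda>xs. chi_lift K P (\<lambda>ys. chi_word K W \<chi> E (xs @ ys)) v) u)"

text \<open>Elements of the coproduct \<open>[\<chi>](E)\<close> are families of homogeneous components, almost all
  zero.\<close>

definition chi_algebra ::
    "('k, 'r) ring_scheme \<Rightarrow> (nat \<Rightarrow> (nat \<Rightarrow> nat) set) \<Rightarrow> (nat \<Rightarrow> (nat \<Rightarrow> nat) \<Rightarrow> 'k) \<Rightarrow>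
      ('k, 'e, 's) module_scheme \<Rightarrow> ('k, nat \<Rightarrow> ('e list \<Rightarrow> 'k) set set) module" where
  "chi_algebra K W \<chi> E = (let P = chi_power K W \<chi> E in \<lparr>
     carrier = {a. (\<forall>d. a d \<in> carrier (P d)) \<and> finite {d. a d \<noteq> \<zero>\<^bsub>P d\<^esub>}},
     monoid.mult = (\<lambda>a b n. \<Oplus>\<^bsub>P n\<^esub>d \<in> {0..n}. chi_mult K W \<chi> E d (n - d) (a d) (b (n - d))),
     monoid.one = (\<lambda>d. if d = 0 then chi_word K W \<chi> E [] else \<zero>\<^bsub>P d\<^esub>),
     ring.zero = (\<lambda>d. \<zero>\<^bsub>P d\<^esub>),
     ring.add = (\<lambda>a b d. a d \<oplus>\<^bsub>P d\<^esub> b d),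
     module.smult = (\<lambda>k a d. k \<odot>\<^bsub>P d\<^esub> a d)\<rparr>)"

section \<open>The bilinear form and the right inner product\<close>

text \<open>\<open>\<langle>x\<^sub>1 \<chi> \<dots> \<chi> x\<^sub>d, f\<^sub>1 \<chi> \<dots> \<chi> f\<^sub>d\<rangle>\<close>\<close>

definition word_pairing ::
    "('k, 'r) ring_scheme \<Rightarrow> (nat \<Rightarrow> (nat \<Rightarrow> nat) set) \<Rightarrow> (nat \<Rightarrow> (nat \<Rightarrow> nat) \<Rightarrow> 'k) \<Rightarrow>
      nat \<Rightarrow> 'e list \<Rightarrow> ('e \<Rightarrow> 'k) list \<Rightarrow> 'k" where
  "word_pairing K W \<chi> d xs fs = (if d = 0 then \<one>\<^bsub>K\<^esub> else
     (\<Oplus>\<^bsub>K\<^esub>\<sigma> \<in> W d. \<chi> d \<sigma> \<otimes>\<^bsub>K\<^esub>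
       (\<Otimes>\<^bsub>K\<^esub>t \<in> {1..d}. (fs ! (t - 1)) (xs ! (Hilbert_Choice.inv \<sigma> t - 1)))))"

definition chi_pairing ::
    "('k, 'r) ring_scheme \<Rightarrow> (nat \<Rightarrow> (nat \<Rightarrow> nat) set) \<Rightarrow> (nat \<Rightarrow> (nat \<Rightarrow> nat) \<Rightarrow> 'k) \<Rightarrow>
      ('k, 'e, 's) module_scheme \<Rightarrow>
      (nat \<Rightarrow> ('e list \<Rightarrow> 'k) set set) \<Rightarrow> (nat \<Rightarrow> (('e \<Rightarrow> 'k) list \<Rightarrow> 'k) set set) \<Rightarrow> 'k" where
  "chi_pairing K W \<chi> E a a' =
     (\<Oplus>\<^bsub>K\<^esub>d \<in> {d. a d \<noteq> \<zero>\<^bsub>chi_power K W \<chi> E d\<^esub>}.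
        chi_lift K (self_module K)
          (\<lambda>xs. chi_lift K (self_module K) (word_pairing K W \<chi> d xs) (a' d)) (a d))"

definition right_inner ::
    "('k, 'r) ring_scheme \<Rightarrow> (nat \<Rightarrow> (nat \<Rightarrow> nat) set) \<Rightarrow> (nat \<Rightarrow> (nat \<Rightarrow> nat) \<Rightarrow> 'k) \<Rightarrow>
      ('k, 'e, 's) module_scheme \<Rightarrow>
      (nat \<Rightarrow> ('e list \<Rightarrow> 'k) set set) \<Rightarrow> (nat \<Rightarrow> (('e \<Rightarrow> 'k) list \<Rightarrow> 'k) set set) \<Rightarrow>
      (nat \<Rightarrow> ('e list \<Rightarrow> 'k) set set)" where
  "right_inner K W \<chi> E a a' = (let A' = chi_algebra K W \<chi> (dual_module K E) in
     THE b. b \<in> carrier (chi_algebra K W \<chi> E) \<and>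
       (\<forall>x' \<in> carrier A'.
          chi_pairing K W \<chi> E b x' = chi_pairing K W \<chi> E a (a' \<otimes>\<^bsub>A'\<^esub> x')))"

section \<open>Right modules over noncommutative rings\<close>

locale right_unital_module = R: ring R + M: abelian_group M
  for R :: "('r, 's) ring_scheme" and M :: "('m, 't) ring_scheme"
    and act :: "'m \<Rightarrow> 'r \<Rightarrow> 'm" (infixl \<open>\<lhd>\<^sub>r\<close> 70) +
  assumes act_closed: "\<lbrakk>x \<in> carrier M; r \<in> carrier R\<rbrakk> \<Longrightarrow> x \<lhd>\<^sub>r r \<in> carrier M"
    and act_add_left: "\<lbrakk>x \<in> carrier M; y \<in> carrier M; r \<in> carrier R\<rbrakk> \<Longrightarrow>
      (x \<oplus>\<^bsub>M\<^esub> y) \<lhd>\<^sub>r r = (x \<lhd>\<^sub>r r) \<oplus>\<^bsub>M\<^esub> (y \<lhd>\<^sub>r r)"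
    and act_add_right: "\<lbrakk>x \<in> carrier M; r \<in> carrier R; s \<in> carrier R\<rbrakk> \<Longrightarrow>
      x \<lhd>\<^sub>r (r \<oplus>\<^bsub>R\<^esub> s) = (x \<lhd>\<^sub>r r) \<oplus>\<^bsub>M\<^esub> (x \<lhd>\<^sub>r s)"
    and act_mult: "\<lbrakk>x \<in> carrier M; r \<in> carrier R; s \<in> carrier R\<rbrakk> \<Longrightarrow>
      x \<lhd>\<^sub>r (r \<otimes>\<^bsub>R\<^esub> s) = (x \<lhd>\<^sub>r r) \<lhd>\<^sub>r s"
    and act_one: "x \<in> carrier M \<Longrightarrow> x \<lhd>\<^sub>r \<one>\<^bsub>R\<^esub> = x"

end

theory Submission
  imports Defs
begin

text \<open>The form identifies \<open>[\<chi>]\<^sup>d(E)\<close> with the dual of \<open>[\<chi>]\<^sup>d(E\<^sup>*)\<close> by an averaging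
  argument that avoids bases of \<open>[\<chi>]\<^sup>d(E)\<close>: for dual bases \<open>(e\<^sub>i)\<close>, \<open>(e\<^sub>i\<^sup>*)\<close> of \<open>E\<close>, \<open>E\<^sup>*\<close>
  and all \<open>u\<close>, the sum over all index words \<open>w\<close> of \<open>\<langle>u, e\<^sub>w\<^sup>*\<rangle> e\<^sub>w\<close> is \<open>|W\<^sub>d| u\<close>, and
  symmetrically on the dual side; \<open>|W\<^sub>d|\<close> is invertible because \<open>K\<close> contains the rationals.
  Every functional is therefore represented by a unique element, so \<open>a\<lfloor>a\<^sup>*\<close> exists, and the
  module axioms follow from uniqueness and the ring axioms of \<open>[\<chi>](E\<^sup>*)\<close>.

  The form is well defined on \<open>[\<chi>](E\<^sup>*)\<close> only because \<open>\<chi>\<^sup>2 = 1\<close>. To see this, form the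
  commutator of \<open>\<sigma>\<close> with a shift of \<open>\<sigma>\<close> overlapping it in one point: it is a 3-cycle. The shifts
  of this 3-cycle generate so many 3-cycles, all of them commutators, that the square of a far shift
  of \<open>\<sigma>\<close>, on which \<open>\<chi>\<close> takes the value \<open>\<chi>(\<sigma>)\<^sup>2\<close>, is a product of them.\<close>

section \<open>Linear maps and quotient modules\<close>

text \<open>The definitions are literal: a map out of \<open>[\<chi>]\<^sup>d(E)\<close> is the
  single value that a lift takes on a coset of cosets. Nothing can be computed before the universal
  property is available; after that, every identity of linear or bilinear maps is checked on words.

  Why the dual side is delicate: moving \<open>q\<close> across the pairing of words replaces it by
  its inverse. So the sum over \<open>W d\<close> is multiplied by the inverse of
  \<open>\<chi> d q\<close> when \<open>q\<close> acts on the word in E, but by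
  \<open>\<chi> d q\<close> itself when \<open>q\<close> acts on the word of functionals. The
  relations of the dual algebra ask for the inverse there too, and the two demands agree when \<chi>
  has order two.

  Why squares and far shifts: a permutation may be odd, so only its square can be expected to be a
  product of 3-cycles. Writing a 3-cycle as a commutator takes two further points in its class.
  Shifts move points upwards only, so large classes are guaranteed only above the point where
  \<open>p\<close> overlaps its first shift, and the support has to be lifted there.\<close>

definition linear_map ::
    "('k, 'r) ring_scheme \<Rightarrow> ('k, 'm, 's) module_scheme \<Rightarrow> ('k, 'n, 't) module_scheme \<Rightarrow>
      ('m \<Rightarrow> 'n) \<Rightarrow> bool" where
  "linear_map K M N f \<longleftrightarrow> f \<in> carrier M \<rightarrow> carrier N \<and>
     (\<forall>x \<in> carrier M. \<forall>y \<in> carrier M. f (x \<oplus>\<^bsub>M\<^esub> y) = f x \<oplus>\<^bsub>N\<^esub> f y) \<and>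
     (\<forall>k \<in> carrier K. \<forall>x \<in> carrier M. f (k \<odot>\<^bsub>M\<^esub> x) = k \<odot>\<^bsub>N\<^esub> f x)"

lemma linear_mapI:
  assumes "\<And>x. x \<in> carrier M \<Longrightarrow> f x \<in> carrier N"
    and "\<And>x y. x \<in> carrier M \<Longrightarrow> y \<in> carrier M \<Longrightarrow> f (x \<oplus>\<^bsub>M\<^esub> y) = f x \<oplus>\<^bsub>N\<^esub> f y"
    and "\<And>k x. k \<in> carrier K \<Longrightarrow> x \<in> carrier M \<Longrightarrow> f (k \<odot>\<^bsub>M\<^esub> x) = k \<odot>\<^bsub>N\<^esub> f x"
  shows "linear_map K M N f"
  using assms unfolding linear_map_def by blast

lemma linear_mapD:
  assumes "linear_map K M N f"
  shows "x \<in> carrier M \<Longrightarrow> f x \<in> carrier N"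
    and "x \<in> carrier M \<Longrightarrow> y \<in> carrier M \<Longrightarrow> f (x \<oplus>\<^bsub>M\<^esub> y) = f x \<oplus>\<^bsub>N\<^esub> f y"
    and "k \<in> carrier K \<Longrightarrow> x \<in> carrier M \<Longrightarrow> f (k \<odot>\<^bsub>M\<^esub> x) = k \<odot>\<^bsub>N\<^esub> f x"
  using assms unfolding linear_map_def by blast+

lemma linear_map_compose:
  "linear_map K M N f \<Longrightarrow> linear_map K N L g \<Longrightarrow> linear_map K M L (\<lambda>x. g (f x))"
  unfolding linear_map_def by (auto simp: Pi_iff)

lemma linear_map_zero:
  assumes "module K M" "module K N" "linear_map K M N f"
  shows "f \<zero>\<^bsub>M\<^esub> = \<zero>\<^bsub>N\<^esub>"
proof -
  interpret M: module K M by fact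
  interpret N: module K N by fact
  have "f (\<zero>\<^bsub>K\<^esub> \<odot>\<^bsub>M\<^esub> \<zero>\<^bsub>M\<^esub>) = \<zero>\<^bsub>K\<^esub> \<odot>\<^bsub>N\<^esub> f \<zero>\<^bsub>M\<^esub>"
    by (rule linear_mapD(3)[OF assms(3)]) auto
  then show ?thesis
    using linear_mapD(1)[OF assms(3)] by simp
qed

lemma linear_map_a_inv:
  assumes "module K M" "module K N" "linear_map K M N f" "x \<in> carrier M"
  shows "f (\<ominus>\<^bsub>M\<^esub> x) = \<ominus>\<^bsub>N\<^esub> f x"
proof -
  interpret M: module K M by fact
  interpret N: module K N by fact
  have "f (\<ominus>\<^bsub>M\<^esub> x) \<oplus>\<^bsub>N\<^esub> f x = f (\<ominus>\<^bsub>M\<^esub> x \<oplus>\<^bsub>M\<^esub> x)"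
    using linear_mapD(2)[OF assms(3), of "\<ominus>\<^bsub>M\<^esub> x" x] assms(4) by simp
  also have "\<dots> = \<zero>\<^bsub>N\<^esub>"
    using linear_map_zero[OF assms(1-3)] assms(4) by (simp add: M.M.l_neg)
  finally show ?thesis
    using linear_mapD(1)[OF assms(3)] assms(4) by (simp add: N.M.minus_equality)
qed

lemma linear_map_minus:
  assumes "module K M" "module K N" "linear_map K M N f" "x \<in> carrier M" "y \<in> carrier M"
  shows "f (x \<ominus>\<^bsub>M\<^esub> y) = f x \<ominus>\<^bsub>N\<^esub> f y"
proof -
  interpret M: module K M by fact
  show ?thesis
    unfolding a_minus_def using assms(4,5)
    by (simp add: linear_mapD(2)[OF assms(3)] linear_map_a_inv[OF assms(1-3)])
qed

lemma linear_map_finsum: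
  assumes "module K M" "module K N" "linear_map K M N f" "g \<in> A \<rightarrow> carrier M"
  shows "f (\<Oplus>\<^bsub>M\<^esub>i \<in> A. g i) = (\<Oplus>\<^bsub>N\<^esub>i \<in> A. f (g i))"
proof -
  interpret M: module K M by fact
  interpret N: module K N by fact
  show ?thesis
    using assms(4)
  proof (induction A rule: infinite_finite_induct)
    case (insert i A)
    then have "f (g i) \<in> carrier N" "(\<lambda>i. f (g i)) \<in> A \<rightarrow> carrier N"
      using linear_mapD(1)[OF assms(3)] by (auto simp: Pi_iff)
    then show ?case
      using insert linear_mapD(2)[OF assms(3)] by (simp add: M.finsum_insert N.finsum_insert)
  qed (simp_all add: linear_map_zero[OF assms(1-3)] M.finsum_infinite N.finsum_infinite)
qed

lemma linear_map_const_zero: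
  assumes "module K N"
  shows "linear_map K M N (\<lambda>x. \<zero>\<^bsub>N\<^esub>)"
proof -
  interpret N: module K N by fact
  show ?thesis by (rule linear_mapI) simp_all
qed

text \<open>\<open>linear_map\<close> leaves values outside the carrier free, so maps built from
  lifts and sums can only be compared on the carrier.\<close>

lemma linear_map_cong:
  assumes "module K M" "linear_map K M N f" "\<And>x. x \<in> carrier M \<Longrightarrow> g x = f x"
  shows "linear_map K M N g"
proof -
  interpret M: module K M by fact
  show ?thesis
    by (rule linear_mapI) (simp_all add: assms(3) linear_mapD[OF assms(2)])
qed

lemma linear_map_add:
  assumes "module K N" "linear_map K M N f" "linear_map K M N g"
  shows "linear_map K M N (\<lambda>x. f x \<oplus>\<^bsub>N\<^esub> g x)"
proof -
  interpret N: module K N by fact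
  note f = linear_mapD[OF assms(2)] and g = linear_mapD[OF assms(3)]
  show ?thesis
    by (rule linear_mapI) (simp_all add: f g N.M.a_ac N.smult_r_distr)
qed

lemma linear_map_smult:
  assumes "module K N" "linear_map K M N f" "k \<in> carrier K"
  shows "linear_map K M N (\<lambda>x. k \<odot>\<^bsub>N\<^esub> f x)"
proof -
  interpret N: module K N by fact
  note f = linear_mapD[OF assms(2)]
  show ?thesis
    using assms(3)
    by (intro linear_mapI) (simp_all add: f N.smult_r_distr N.smult_assoc1[symmetric] N.R.m_comm)
qed

lemma linear_map_sum:
  assumes "module K M" "module K N" "\<And>i. i \<in> A \<Longrightarrow> linear_map K M N (f i)"
  shows "linear_map K M N (\<lambda>x. \<Oplus>\<^bsub>N\<^esub>i \<in> A. f i x)"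
proof -
  interpret N: module K N by fact
  show ?thesis
    using assms(3)
  proof (induction A rule: infinite_finite_induct)
    case (insert i A)
    have "linear_map K M N (\<lambda>x. f i x \<oplus>\<^bsub>N\<^esub> (\<Oplus>\<^bsub>N\<^esub>i \<in> A. f i x))"
      using insert by (intro linear_map_add[OF assms(2)]) auto
    moreover have "(\<Oplus>\<^bsub>N\<^esub>i \<in> insert i A. f i x) = f i x \<oplus>\<^bsub>N\<^esub> (\<Oplus>\<^bsub>N\<^esub>i \<in> A. f i x)"
      if "x \<in> carrier M" for x
    proof -
      have "f j x \<in> carrier N" if "j \<in> insert i A" for j
        using insert.prems[OF that] \<open>x \<in> carrier M\<close> by (rule linear_mapD(1))
      then show ?thesis
        using insert.hyps by (intro N.finsum_insert) auto
    qed
    ultimately show ?case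
      by (rule linear_map_cong[OF assms(1)])
  \<comment> \<open>Over an infinite \<open>A\<close> the sum is zero by convention, and the zero
    map is linear.\<close>
  qed (simp_all add: N.finsum_infinite N.finsum_empty linear_map_const_zero[OF assms(2)])
qed

lemma submodule_kernel:
  assumes "module K M" "module K N" "linear_map K M N f"
  shows "submodule {x \<in> carrier M. f x = \<zero>\<^bsub>N\<^esub>} K M"
proof -
  interpret M: module K M by fact
  interpret N: module K N by fact
  show ?thesis
    by (rule M.submoduleI)
      (auto simp: linear_map_zero[OF assms] linear_map_a_inv[OF assms] linear_mapD[OF assms(3)])
qed

text \<open>The hull is the intersection of all submodules containing \<open>S\<close>. As
  \<open>S\<close> lies in the carrier, the carrier is one of them and the intersection stays inside
  \<open>M\<close>.\<close>

lemma submodule_generated: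
  assumes "module K M" "S \<subseteq> carrier M"
  shows "submodule (generated_submodule K M S) K M"
proof -
  interpret M: module K M by fact
  have *: "generated_submodule K M S \<subseteq> carrier M"
    unfolding generated_submodule_def using M.carrier_is_submodule assms(2) by (rule hull_minimal[rotated])
  show ?thesis
    using * unfolding generated_submodule_def hull_def
    by (intro M.submoduleI) (auto dest: M.submoduleE subgroup.one_closed[OF submodule.axioms(1)])
qed

lemma generated_submodule_superset: "S \<subseteq> generated_submodule K M S"
  unfolding generated_submodule_def by (rule hull_subset)

text \<open>The kernel is itself a submodule, so it contains the hull as soon as it contains the
  generators. Both kinds of relations, the multilinear and the \<chi>-equivariant ones, are passed
  to quotients in this way.\<close>

lemma linear_map_vanish_generated:
  assumes "module K M" "module K N" "linear_map K M N f"
    and "S \<subseteq> carrier M" "\<And>x. x \<in> S \<Longrightarrow> f x = \<zero>\<^bsub>N\<^esub>" "x \<in> generated_submodule K M S"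
  shows "f x = \<zero>\<^bsub>N\<^esub>"
proof -
  have "generated_submodule K M S \<subseteq> {x \<in> carrier M. f x = \<zero>\<^bsub>N\<^esub>}"
    unfolding generated_submodule_def
    using assms submodule_kernel[OF assms(1-3)] by (intro hull_minimal) auto
  with assms(6) show ?thesis by auto
qed

section \<open>Quotient modules and the maps induced on them\<close>

locale quotient = module K M for K (structure) and M :: "('k, 'm, 's) module_scheme" (structure) +
  fixes N :: "'m set"
  assumes sub: "submodule N K M"
begin

abbreviation "Q \<equiv> quotient_module M N"

sublocale abelian_subgroup N M
  by (rule abelian_subgroupI3)
    (use sub in \<open>auto simp: additive_subgroup_def submodule_def intro: abelian_group_axioms\<close>)

lemma carrier_eq: "carrier Q = (\<lambda>x. N +>\<^bsub>M\<^esub> x) ` carrier M"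
  by (auto simp: quotient_module_def A_RCOSETS_def')

lemma carrierE:
  assumes "C \<in> carrier Q"
  obtains x where "x \<in> carrier M" "C = N +>\<^bsub>M\<^esub> x"
  using assms by (auto simp: carrier_eq)

lemma coset_in_carrier [simp]: "x \<in> carrier M \<Longrightarrow> N +>\<^bsub>M\<^esub> x \<in> carrier Q"
  by (auto simp: carrier_eq)

lemma zero_eq: "\<zero>\<^bsub>Q\<^esub> = N +>\<^bsub>M\<^esub> \<zero>\<^bsub>M\<^esub>"
  using a_subset by (simp add: quotient_module_def)

lemma add_eq:
  "x \<in> carrier M \<Longrightarrow> y \<in> carrier M \<Longrightarrow>
    (N +>\<^bsub>M\<^esub> x) \<oplus>\<^bsub>Q\<^esub> (N +>\<^bsub>M\<^esub> y) = N +>\<^bsub>M\<^esub> (x \<oplus>\<^bsub>M\<^esub> y)"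
  by (simp add: quotient_module_def a_rcos_sum)

lemma coset_eqI:
  assumes "x \<in> carrier M" "y \<in> carrier M" "x \<ominus>\<^bsub>M\<^esub> y \<in> N"
  shows "N +>\<^bsub>M\<^esub> x = N +>\<^bsub>M\<^esub> y"
proof -
  have "x \<in> N +>\<^bsub>M\<^esub> y"
    using assms by (auto intro: a_rcos_module_rev simp: a_minus_def)
  then show ?thesis
    using assms(2) by (metis a_repr_independence')
qed

lemma coset_elem:
  assumes "x \<in> carrier M" "y \<in> N +>\<^bsub>M\<^esub> x"
  shows "\<exists>n \<in> N. y = n \<oplus>\<^bsub>M\<^esub> x"
  using assms by (auto simp: a_r_coset_def')

text \<open>Scalar multiplication of a coset is a union over all its representatives; stability of
  \<open>N\<close> under scalars makes the cosets in this union equal.\<close>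

lemma smult_eq:
  assumes "k \<in> carrier K" "x \<in> carrier M"
  shows "k \<odot>\<^bsub>Q\<^esub> (N +>\<^bsub>M\<^esub> x) = N +>\<^bsub>M\<^esub> (k \<odot>\<^bsub>M\<^esub> x)"
proof -
  have "N +>\<^bsub>M\<^esub> (k \<odot>\<^bsub>M\<^esub> y) = N +>\<^bsub>M\<^esub> (k \<odot>\<^bsub>M\<^esub> x)" if y: "y \<in> N +>\<^bsub>M\<^esub> x" for y
  proof -
    obtain n where n: "n \<in> N" "y = n \<oplus>\<^bsub>M\<^esub> x"
      using coset_elem[OF assms(2) y] by auto
    then have nM: "n \<in> carrier M" and kn: "k \<odot>\<^bsub>M\<^esub> n \<in> N"
      using a_subset assms(1) sub by (auto simp: submodule_def submodule_axioms_def)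
    have "k \<odot>\<^bsub>M\<^esub> y = k \<odot>\<^bsub>M\<^esub> n \<oplus>\<^bsub>M\<^esub> k \<odot>\<^bsub>M\<^esub> x"
      using n nM assms by (simp add: smult_r_distr)
    then have "k \<odot>\<^bsub>M\<^esub> y \<ominus>\<^bsub>M\<^esub> k \<odot>\<^bsub>M\<^esub> x = k \<odot>\<^bsub>M\<^esub> n"
      using nM assms by (simp add: a_minus_def M.a_assoc M.r_neg)
    then show ?thesis
      using kn assms nM n by (intro coset_eqI) auto
  qed
  then show ?thesis
    using a_rcos_self[OF assms(2)] unfolding quotient_module_def module.simps by (intro equalityI UN_least) blast+
qed

lemma module_Q: "module K Q"
proof (rule moduleI)
  show "abelian_group Q"
  proof (rule abelian_groupI)
    fix C assume "C \<in> carrier Q"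
    then obtain x where x: "x \<in> carrier M" "C = N +>\<^bsub>M\<^esub> x" by (auto simp: carrier_eq)
    show "\<exists>D\<in>carrier Q. D \<oplus>\<^bsub>Q\<^esub> C = \<zero>\<^bsub>Q\<^esub>"
      by (rule bexI[of _ "N +>\<^bsub>M\<^esub> (\<ominus>\<^bsub>M\<^esub> x)"]) (use x in \<open>auto simp: add_eq zero_eq M.l_neg\<close>)
  qed (auto simp: carrier_eq add_eq zero_eq M.a_ac)
qed (rule is_cring, (elim carrierE;
    simp add: add_eq smult_eq smult_l_distr smult_r_distr smult_assoc1)+)

lemma linear_map_coset: "linear_map K M Q (\<lambda>x. N +>\<^bsub>M\<^esub> x)"
  by (rule linear_mapI) (simp_all add: add_eq smult_eq)

text \<open>A linear map that kills \<open>N\<close> is constant on cosets, so the image of a coset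
  is a singleton. This gives \<open>the_elem\<close> in \<open>tensor_lift\<close> and
  \<open>chi_lift\<close> its meaning.\<close>

lemma the_elem_coset:
  assumes "module K L" "linear_map K M L f" "\<And>x. x \<in> N \<Longrightarrow> f x = \<zero>\<^bsub>L\<^esub>" "x \<in> carrier M"
  shows "the_elem (f ` (N +>\<^bsub>M\<^esub> x)) = f x"
proof -
  interpret L: module K L by fact
  have "f y = f x" if y: "y \<in> N +>\<^bsub>M\<^esub> x" for y
  proof -
    obtain n where n: "n \<in> N" "y = n \<oplus>\<^bsub>M\<^esub> x"
      using coset_elem[OF assms(4) y] by auto
    moreover have "n \<in> carrier M" using n a_subset by auto
    ultimately show ?thesis
      using assms(3,4) linear_mapD[OF assms(2)] by simp
  qed
  then have "f ` (N +>\<^bsub>M\<^esub> x) = {f x}"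
    using a_rcos_self[OF assms(4)] by blast
  then show ?thesis by simp
qed

lemma linear_map_the_elem:
  assumes "module K L" "linear_map K M L f" "\<And>x. x \<in> N \<Longrightarrow> f x = \<zero>\<^bsub>L\<^esub>"
  shows "linear_map K Q L (\<lambda>C. the_elem (f ` C))"
  using linear_mapD[OF assms(2)]
  by (intro linear_mapI) (auto simp: carrier_eq add_eq smult_eq the_elem_coset[OF assms])

end

section \<open>Free modules and tensor powers\<close>

context cring
begin

lemma carrier_free_module:
  "f \<in> carrier (free_module R I) \<longleftrightarrow> (\<forall>i. f i \<in> carrier R) \<and> (\<forall>i. i \<notin> I \<longrightarrow> f i = \<zero>) \<and>
     finite {i. f i \<noteq> \<zero>}"
  by (simp add: free_module_def)

lemma module_free: "module R (free_module R I)"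
proof (rule moduleI)
  have fin: "finite {i. f i \<oplus> g i \<noteq> \<zero>}" if "finite {i. f i \<noteq> \<zero>}" "finite {i. g i \<noteq> \<zero>}"
    for f g :: "'c \<Rightarrow> 'a"
    by (rule finite_subset[OF _ finite_UnI[OF that]]) auto
  show "abelian_group (free_module R I)"
  proof (rule abelian_groupI)
    fix f assume f: "f \<in> carrier (free_module R I)"
    have "{i. \<ominus> f i \<noteq> \<zero>} \<subseteq> {i. f i \<noteq> \<zero>}" by auto
    then have "finite {i. \<ominus> f i \<noteq> \<zero>}"
      using f by (auto simp: carrier_free_module intro: finite_subset)
    then show "\<exists>g\<in>carrier (free_module R I).
        g \<oplus>\<^bsub>free_module R I\<^esub> f = \<zero>\<^bsub>free_module R I\<^esub>"
      using f by (intro bexI[of _ "\<lambda>i. \<ominus> f i"]) (auto simp: free_module_def l_neg)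
  qed (auto simp: free_module_def fin a_ac)
  fix k f assume "k \<in> carrier R" "f \<in> carrier (free_module R I)"
  moreover from this have "{i. k \<otimes> f i \<noteq> \<zero>} \<subseteq> {i. f i \<noteq> \<zero>}" by auto
  ultimately show "k \<odot>\<^bsub>free_module R I\<^esub> f \<in> carrier (free_module R I)"
    by (auto simp: free_module_def intro: finite_subset)
qed (auto simp: free_module_def fun_eq_iff l_distr r_distr m_assoc is_cring)

lemma free_gen_closed: "i \<in> I \<Longrightarrow> free_gen R i \<in> carrier (free_module R I)"
  by (auto simp: carrier_free_module free_gen_def)

lemma finsum_free_module:
  assumes "finite A" "g \<in> A \<rightarrow> carrier (free_module R I)"
  shows "(\<Oplus>\<^bsub>free_module R I\<^esub>i \<in> A. g i) = (\<lambda>j. \<Oplus>i \<in> A. g i j)"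
proof -
  interpret F: module R "free_module R I" by (rule module_free)
  show ?thesis using assms
  proof (induction A)
    case empty
    then show ?case by (simp add: F.finsum_empty) (simp add: free_module_def)
  next
    case (insert i A)
    then have "(\<lambda>i. g i j) \<in> A \<rightarrow> carrier R" "g i j \<in> carrier R" for j
      by (auto simp: carrier_free_module Pi_iff)
    with insert show ?case
      by (subst F.finsum_insert) (auto, simp add: free_module_def)
  qed
qed

text \<open>The sum in \<open>free_lift\<close> runs over the support of \<open>f\<close>, which
  changes with \<open>f\<close>. Additivity needs one index set that serves both summands and their
  sum.\<close>

lemma free_lift_eq:
  assumes "module R M" "f \<in> carrier (free_module R I)" "\<phi> \<in> I \<rightarrow> carrier M"
    and "finite A" "{i. f i \<noteq> \<zero>} \<subseteq> A" "A \<subseteq> I"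
  shows "free_lift R M \<phi> f = (\<Oplus>\<^bsub>M\<^esub>i \<in> A. f i \<odot>\<^bsub>M\<^esub> \<phi> i)"
proof -
  interpret M: module R M by fact
  show ?thesis
    unfolding free_lift_def
  proof (rule M.add.finprod_mono_neutral_cong_left)
    fix i assume "i \<in> A - {i. f i \<noteq> \<zero>}"
    then have "f i = \<zero>" "\<phi> i \<in> carrier M" using assms by auto
    then show "f i \<odot>\<^bsub>M\<^esub> \<phi> i = \<zero>\<^bsub>M\<^esub>" by simp
  next
    show "(\<lambda>i. f i \<odot>\<^bsub>M\<^esub> \<phi> i) \<in> A \<rightarrow> carrier M"
      using assms(2,3,6) by (auto simp: carrier_free_module intro!: M.smult_closed)
  qed (use assms in auto)
qed

lemma linear_map_free_lift:
  assumes "module R M" "\<phi> \<in> I \<rightarrow> carrier M"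
  shows "linear_map R (free_module R I) M (free_lift R M \<phi>)"
proof (rule linear_mapI)
  interpret M: module R M by fact
  interpret F: module R "free_module R I" by (rule module_free)
  fix f assume f: "f \<in> carrier (free_module R I)"
  let ?F = "{i. f i \<noteq> \<zero>}"
  have F: "finite ?F" "?F \<subseteq> I"
    using f by (auto simp: carrier_free_module)
  note lf = free_lift_eq[OF assms(1) f assms(2) F(1) subset_refl F(2)]
  have fm: "f i \<in> carrier R" for i
    using f by (auto simp: carrier_free_module)
  have \<phi>: "i \<in> I \<Longrightarrow> \<phi> i \<in> carrier M" for i
    using assms(2) by auto
  show "free_lift R M \<phi> f \<in> carrier M"
    unfolding lf using F(2) by (auto intro!: M.finsum_closed fm \<phi>)
  {
    fix k assume k: "k \<in> carrier R"
    have "free_lift R M \<phi> (k \<odot>\<^bsub>free_module R I\<^esub> f)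
      = (\<Oplus>\<^bsub>M\<^esub>i \<in> ?F. (k \<odot>\<^bsub>free_module R I\<^esub> f) i \<odot>\<^bsub>M\<^esub> \<phi> i)"
      by (rule free_lift_eq[OF assms(1) F.smult_closed[OF k f] assms(2) F(1) _ F(2)])
        (use k in \<open>auto simp: free_module_def\<close>)
    also have "\<dots> = (\<Oplus>\<^bsub>M\<^esub>i \<in> ?F. k \<odot>\<^bsub>M\<^esub> (f i \<odot>\<^bsub>M\<^esub> \<phi> i))"
      using F fm \<phi> k by (intro M.finsum_cong') (auto simp: free_module_def M.smult_assoc1)
    also have "\<dots> = k \<odot>\<^bsub>M\<^esub> free_lift R M \<phi> f"
      unfolding lf using F fm \<phi> k by (intro M.finsum_smult_ldistr[symmetric]) auto
    finally show "free_lift R M \<phi> (k \<odot>\<^bsub>free_module R I\<^esub> f) = k \<odot>\<^bsub>M\<^esub> free_lift R M \<phi> f" .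
  }
  fix g assume g: "g \<in> carrier (free_module R I)"
  let ?G = "{i. g i \<noteq> \<zero>}"
  have G: "finite (?F \<union> ?G)" "?F \<union> ?G \<subseteq> I"
    using f g by (auto simp: carrier_free_module)
  have gm: "g i \<in> carrier R" for i
    using g by (auto simp: carrier_free_module)
  have "free_lift R M \<phi> (f \<oplus>\<^bsub>free_module R I\<^esub> g)
      = (\<Oplus>\<^bsub>M\<^esub>i \<in> ?F \<union> ?G. (f \<oplus>\<^bsub>free_module R I\<^esub> g) i \<odot>\<^bsub>M\<^esub> \<phi> i)"
    by (rule free_lift_eq[OF assms(1) F.a_closed[OF f g] assms(2) G(1) _ G(2)])
      (auto simp: free_module_def)
  also have "\<dots> = (\<Oplus>\<^bsub>M\<^esub>i \<in> ?F \<union> ?G. f i \<odot>\<^bsub>M\<^esub> \<phi> i \<oplus>\<^bsub>M\<^esub> g i \<odot>\<^bsub>M\<^esub> \<phi> i)"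
    using G fm gm \<phi> by (intro M.finsum_cong') (auto simp: free_module_def M.smult_l_distr)
  also have "\<dots> = (\<Oplus>\<^bsub>M\<^esub>i \<in> ?F \<union> ?G. f i \<odot>\<^bsub>M\<^esub> \<phi> i) \<oplus>\<^bsub>M\<^esub> (\<Oplus>\<^bsub>M\<^esub>i \<in> ?F \<union> ?G. g i \<odot>\<^bsub>M\<^esub> \<phi> i)"
    using G fm gm \<phi> by (intro M.finsum_addf) auto
  also have "\<dots> = free_lift R M \<phi> f \<oplus>\<^bsub>M\<^esub> free_lift R M \<phi> g"
    by (intro arg_cong2[where f = "add M"] free_lift_eq[symmetric, OF assms(1) _ assms(2)] f g G) auto
  finally show "free_lift R M \<phi> (f \<oplus>\<^bsub>free_module R I\<^esub> g) =
    free_lift R M \<phi> f \<oplus>\<^bsub>M\<^esub> free_lift R M \<phi> g" .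
qed

lemma free_lift_gen:
  assumes "module R M" "\<phi> \<in> I \<rightarrow> carrier M" "i \<in> I"
  shows "free_lift R M \<phi> (free_gen R i) = \<phi> i"
proof -
  interpret M: module R M by fact
  have "\<phi> i \<in> carrier M" using assms by auto
  moreover have "free_lift R M \<phi> (free_gen R i) = (\<Oplus>\<^bsub>M\<^esub>j \<in> {i}. free_gen R i j \<odot>\<^bsub>M\<^esub> \<phi> j)"
    using assms by (intro free_lift_eq free_gen_closed) (auto simp: free_gen_def)
  ultimately show ?thesis
    by (simp add: free_gen_def M.finsum_insert M.finsum_empty)
qed

text \<open>An element is the finite sum of its values times the generators, so closure under the
  module operations is enough.\<close>

lemma free_module_induct [consumes 1, case_names zero add smult gen]:
  assumes "f \<in> carrier (free_module R I)"
    and "P \<zero>\<^bsub>free_module R I\<^esub>"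
    and "\<And>f g. f \<in> carrier (free_module R I) \<Longrightarrow> g \<in> carrier (free_module R I) \<Longrightarrow> P f \<Longrightarrow> P g \<Longrightarrow>
      P (f \<oplus>\<^bsub>free_module R I\<^esub> g)"
    and "\<And>k f. k \<in> carrier R \<Longrightarrow> f \<in> carrier (free_module R I) \<Longrightarrow> P f \<Longrightarrow>
      P (k \<odot>\<^bsub>free_module R I\<^esub> f)"
    and "\<And>i. i \<in> I \<Longrightarrow> P (free_gen R i)"
  shows "P f"
proof -
  interpret F: module R "free_module R I" by (rule module_free)
  have f: "f i \<in> carrier R" for i
    using assms(1) by (auto simp: carrier_free_module)
  let ?s = "\<lambda>A. \<Oplus>\<^bsub>free_module R I\<^esub>i \<in> A. f i \<odot>\<^bsub>free_module R I\<^esub> free_gen R i"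
  have P: "P (?s A)" if "finite A" "A \<subseteq> I" for A
    using that
  proof (induction A)
    case empty
    then show ?case using assms(2) by (simp add: F.finsum_empty)
  next
    case (insert i A)
    then have "?s A \<in> carrier (free_module R I)"
      by (auto intro!: F.finsum_closed free_gen_closed f)
    with insert show ?case
      by (subst F.finsum_insert) (auto intro!: assms(3,4,5) free_gen_closed f)
  qed
  let ?F = "{i. f i \<noteq> \<zero>}"
  have F: "finite ?F" "?F \<subseteq> I"
    using assms(1) by (auto simp: carrier_free_module)
  have "?s ?F = (\<lambda>j. \<Oplus>i \<in> ?F. (f i \<odot>\<^bsub>free_module R I\<^esub> free_gen R i) j)"
    using F by (intro finsum_free_module) (auto intro!: free_gen_closed f)
  also have "\<dots> = f"
  proof
    fix j
    have "(\<Oplus>i \<in> ?F. (f i \<odot>\<^bsub>free_module R I\<^esub> free_gen R i) j) = (\<Oplus>i \<in> ?F. if j = i then f i else \<zero>)"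
      using f by (intro finsum_cong') (auto simp: free_module_def free_gen_def)
    also have "\<dots> = f j"
    proof (cases "j \<in> ?F")
      case True
      then show ?thesis using F f by (intro add.finprod_singleton) auto
    next
      case False
      then have "(\<Oplus>i \<in> ?F. if j = i then f i else \<zero>) = (\<Oplus>i \<in> ?F. \<zero>)"
        by (intro finsum_cong') auto
      with False show ?thesis by (simp add: finsum_zero)
    qed
    finally show "(\<Oplus>i \<in> ?F. (f i \<odot>\<^bsub>free_module R I\<^esub> free_gen R i) j) = f j" .
  qed
  finally show ?thesis using P[OF F] by simp
qed

end

section \<open>Multilinear maps and the universal property of tensor powers\<close>

definition multilinear ::
    "('k, 'r) ring_scheme \<Rightarrow> ('k, 'e, 's) module_scheme \<Rightarrow> nat \<Rightarrow> ('k, 'm, 't) module_scheme \<Rightarrow>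
      ('e list \<Rightarrow> 'm) \<Rightarrow> bool" where
  "multilinear K E d M \<phi> \<longleftrightarrow> \<phi> \<in> words E d \<rightarrow> carrier M \<and>
     (\<forall>xs \<in> words E d. \<forall>i < d. linear_map K E M (\<lambda>x. \<phi> (xs[i := x])))"

lemma words_update: "xs \<in> words E d \<Longrightarrow> x \<in> carrier E \<Longrightarrow> xs[i := x] \<in> words E d"
  using set_update_subset_insert[of xs i x] by (auto simp: words_def)

lemma words_nth: "xs \<in> words E d \<Longrightarrow> i < d \<Longrightarrow> xs ! i \<in> carrier E"
  by (auto simp: words_def)

lemma words_append [simp]: "xs \<in> words E d \<Longrightarrow> ys \<in> words E e \<Longrightarrow> xs @ ys \<in> words E (d + e)"
  by (auto simp: words_def)

lemma words_length: "xs \<in> words E d \<Longrightarrow> length xs = d"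
  by (simp add: words_def)

locale tensor_space = module K E for K (structure) and E :: "('k, 'e, 's) module_scheme" and d :: nat
begin

abbreviation "F \<equiv> free_module K (words E d)"
abbreviation "rel \<equiv> multilinear_relations K E d"
abbreviation "T \<equiv> tensor_power K E d"

sublocale F: module K F by (rule R.module_free)

text \<open>The side condition of a relation mentions one word only. Membership in
  \<open>words E d\<close> is decided letter by letter, so every carrier element may stand in the
  distinguished slot.\<close>

lemma relation_cases:
  assumes "r \<in> rel"
  obtains (add) us vs x y where "length us < d" "\<And>z. z \<in> carrier E \<Longrightarrow> us @ z # vs \<in> words E d"
      "x \<in> carrier E" "y \<in> carrier E"
      "r = free_gen K (us @ (x \<oplus>\<^bsub>E\<^esub> y) # vs) \<ominus>\<^bsub>F\<^esub>
        (free_gen K (us @ x # vs) \<oplus>\<^bsub>F\<^esub> free_gen K (us @ y # vs))"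
    | (smult) us vs k x where "length us < d" "\<And>z. z \<in> carrier E \<Longrightarrow> us @ z # vs \<in> words E d"
      "x \<in> carrier E" "k \<in> carrier K"
      "r = free_gen K (us @ (k \<odot>\<^bsub>E\<^esub> x) # vs) \<ominus>\<^bsub>F\<^esub> (k \<odot>\<^bsub>F\<^esub> free_gen K (us @ x # vs))"
proof -
  have w: "length us < d" "x \<in> carrier E" "\<And>z. z \<in> carrier E \<Longrightarrow> us @ z # vs \<in> words E d"
    if "us @ x # vs \<in> words E d" for us vs x
    using that by (auto simp: words_def)
  from assms consider us vs x y where "us @ x # vs \<in> words E d" "y \<in> carrier E"
      "r = free_gen K (us @ (x \<oplus>\<^bsub>E\<^esub> y) # vs) \<ominus>\<^bsub>F\<^esub>
        (free_gen K (us @ x # vs) \<oplus>\<^bsub>F\<^esub> free_gen K (us @ y # vs))"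
    | us vs k x where "us @ x # vs \<in> words E d" "k \<in> carrier K"
      "r = free_gen K (us @ (k \<odot>\<^bsub>E\<^esub> x) # vs) \<ominus>\<^bsub>F\<^esub> (k \<odot>\<^bsub>F\<^esub> free_gen K (us @ x # vs))"
    unfolding multilinear_relations_def Let_def by blast
  then show thesis
  proof cases
    case 1
    show thesis by (rule add[OF w(1,3,2)[OF 1(1)] 1(2,3)])
  next
    case 2
    show thesis by (rule smult[OF w(1,3,2)[OF 2(1)] 2(2,3)])
  qed
qed

lemma relations_closed: "rel \<subseteq> carrier F"
proof
  fix r assume "r \<in> rel"
  then show "r \<in> carrier F"
    by (cases rule: relation_cases)
      (simp_all add: R.free_gen_closed)
qed

sublocale quotient K F "generated_submodule K F rel"
  rewrites "quotient_module F (generated_submodule K F rel) = T"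
proof -
  show "quotient K F (generated_submodule K F rel)"
    by (intro quotient.intro quotient_axioms.intro R.module_free submodule_generated relations_closed)
qed (simp add: tensor_power_def Let_def)

lemma tensor_eq:
  "xs \<in> words E d \<Longrightarrow> tensor K E xs = generated_submodule K F rel +>\<^bsub>F\<^esub> free_gen K xs"
  by (simp add: tensor_def Let_def words_length)

lemma tensor_closed: "xs \<in> words E d \<Longrightarrow> tensor K E xs \<in> carrier T"
  by (simp add: tensor_eq R.free_gen_closed)

lemma multilinear_tensor: "multilinear K E d T (tensor K E)"
  unfolding multilinear_def
proof (intro conjI ballI allI impI linear_mapI)
  show "tensor K E \<in> words E d \<rightarrow> carrier T"
    by (simp add: tensor_closed)
  fix xs i assume xs: "xs \<in> words E d" and i: "i < d"
  define us vs where "us = take i xs" and "vs = drop (Suc i) xs"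
  have upd: "xs[i := z] = us @ z # vs" for z
    using xs i by (simp add: us_def vs_def upd_conv_take_nth_drop words_length)
  have w: "us @ z # vs \<in> words E d" if "z \<in> carrier E" for z
    using words_update[OF xs that] upd by metis
  fix x assume x: "x \<in> carrier E"
  show "tensor K E (xs[i := x]) \<in> carrier T"
    using w x upd tensor_closed by metis
  {
    fix y assume y: "y \<in> carrier E"
    have "free_gen K (us @ (x \<oplus>\<^bsub>E\<^esub> y) # vs) \<ominus>\<^bsub>F\<^esub>
      (free_gen K (us @ x # vs) \<oplus>\<^bsub>F\<^esub> free_gen K (us @ y # vs)) \<in> rel"
      unfolding multilinear_relations_def Let_def using w[OF x] y by blast
    then show "tensor K E (xs[i := x \<oplus>\<^bsub>E\<^esub> y]) = tensor K E (xs[i := x]) \<oplus>\<^bsub>T\<^esub> tensor K E (xs[i := y])"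
      using x y unfolding upd
      by (simp add: tensor_eq w R.free_gen_closed add_eq)
        (intro coset_eqI; simp add: R.free_gen_closed w subsetD[OF generated_submodule_superset])
  next
    fix k assume k: "k \<in> carrier K"
    have "free_gen K (us @ (k \<odot>\<^bsub>E\<^esub> x) # vs) \<ominus>\<^bsub>F\<^esub> (k \<odot>\<^bsub>F\<^esub> free_gen K (us @ x # vs)) \<in> rel"
      unfolding multilinear_relations_def Let_def using w[OF x] k by blast
    then show "tensor K E (xs[i := k \<odot>\<^bsub>E\<^esub> x]) = k \<odot>\<^bsub>T\<^esub> tensor K E (xs[i := x])"
      using x k unfolding upd
      by (simp add: tensor_eq w R.free_gen_closed smult_eq)
        (intro coset_eqI; simp add: R.free_gen_closed w subsetD[OF generated_submodule_superset])
  }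
qed

text \<open>On a relation the lift measures how far \<open>\<phi>\<close> fails to be linear in one
  slot, so it kills the generators and with them the submodule.\<close>

lemma free_lift_relation:
  assumes "module K M" "multilinear K E d M \<phi>" "f \<in> generated_submodule K F rel"
  shows "free_lift K M \<phi> f = \<zero>\<^bsub>M\<^esub>"
proof (rule linear_map_vanish_generated[OF F.module_axioms assms(1) _ relations_closed _ assms(3)])
  interpret M: module K M by fact
  have \<phi>: "\<phi> \<in> words E d \<rightarrow> carrier M"
    using assms(2) by (simp add: multilinear_def)
  show lin: "linear_map K F M (free_lift K M \<phi>)"
    by (rule R.linear_map_free_lift) fact+
  note lift = linear_map_minus[OF F.module_axioms assms(1) lin] linear_mapD[OF lin]
    R.free_lift_gen[OF assms(1) \<phi>] R.free_gen_closed
  have \<phi>c: "\<phi> xs \<in> carrier M" if "xs \<in> words E d" for xs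
    using \<phi> that by auto
  fix r assume "r \<in> rel"
  then show "free_lift K M \<phi> r = \<zero>\<^bsub>M\<^esub>"
  proof (cases rule: relation_cases)
    case (add us vs x y)
    have "linear_map K E M (\<lambda>z. \<phi> ((us @ x # vs)[length us := z]))"
      using assms(2) add(1) add(2)[OF add(3)] unfolding multilinear_def by blast
    from linear_mapD(2)[OF this add(3,4)] show ?thesis
      using add(3,4) \<phi>c[OF add(2)] by (simp add: add(5) add(2) lift) (simp add: a_minus_def M.M.r_neg)
  next
    case (smult us vs k x)
    have "linear_map K E M (\<lambda>z. \<phi> ((us @ x # vs)[length us := z]))"
      using assms(2) smult(1) smult(2)[OF smult(3)] unfolding multilinear_def by blast
    from linear_mapD(3)[OF this smult(4,3)] show ?thesis
      using smult(3,4) \<phi>c[OF smult(2)] by (simp add: smult(5) smult(2) lift) (simp add: a_minus_def M.M.r_neg)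
  qed
qed

lemma linear_map_tensor_lift:
  assumes "module K M" "multilinear K E d M \<phi>"
  shows "linear_map K T M (tensor_lift K M \<phi>)"
  unfolding tensor_lift_def using assms
  by (intro linear_map_the_elem R.linear_map_free_lift free_lift_relation) (auto simp: multilinear_def)

lemma tensor_lift_tensor:
  assumes "module K M" "multilinear K E d M \<phi>" "xs \<in> words E d"
  shows "tensor_lift K M \<phi> (tensor K E xs) = \<phi> xs"
proof -
  have \<phi>: "\<phi> \<in> words E d \<rightarrow> carrier M"
    using assms(2) by (simp add: multilinear_def)
  show ?thesis
    unfolding tensor_lift_def tensor_eq[OF assms(3)]
    using the_elem_coset[OF assms(1) R.linear_map_free_lift[OF assms(1) \<phi>]
        free_lift_relation[OF assms(1,2)] R.free_gen_closed[OF assms(3)]]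
      R.free_lift_gen[OF assms(1) \<phi> assms(3)]
    by simp
qed

lemma tensor_induct [consumes 1, case_names zero add smult tensor]:
  assumes "z \<in> carrier T"
    and "P \<zero>\<^bsub>T\<^esub>"
    and "\<And>u v. u \<in> carrier T \<Longrightarrow> v \<in> carrier T \<Longrightarrow> P u \<Longrightarrow> P v \<Longrightarrow> P (u \<oplus>\<^bsub>T\<^esub> v)"
    and "\<And>k u. k \<in> carrier K \<Longrightarrow> u \<in> carrier T \<Longrightarrow> P u \<Longrightarrow> P (k \<odot>\<^bsub>T\<^esub> u)"
    and "\<And>xs. xs \<in> words E d \<Longrightarrow> P (tensor K E xs)"
  shows "P z"
proof -
  let ?c = "\<lambda>f. generated_submodule K F rel +>\<^bsub>F\<^esub> f"
  obtain f where f: "f \<in> carrier F" "z = ?c f"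
    using assms(1) by (rule carrierE)
  have "P (?c f)"
    using f(1)
  proof (induction rule: R.free_module_induct)
    case zero
    then show ?case using assms(2) by (simp add: zero_eq)
  next
    case (add f g)
    then show ?case using assms(3)[of "?c f" "?c g"] by (simp add: add_eq)
  next
    case (smult k f)
    then show ?case using assms(4)[of k "?c f"] by (simp add: smult_eq)
  next
    case (gen xs)
    then show ?case using assms(5)[of xs] by (simp add: tensor_eq)
  qed
  with f show ?thesis by simp
qed

lemma linear_map_eq_on_tensors:
  assumes "module K M" "linear_map K T M f" "linear_map K T M g"
    and "\<And>xs. xs \<in> words E d \<Longrightarrow> f (tensor K E xs) = g (tensor K E xs)" "z \<in> carrier T"
  shows "f z = g z"
  using assms(5)
proof (induction rule: tensor_induct)
  case zero
  then show ?case
    using linear_map_zero[OF module_Q assms(1,2)] linear_map_zero[OF module_Q assms(1,3)] by simp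
qed (simp_all add: linear_mapD[OF assms(2)] linear_mapD[OF assms(3)] assms(4))

end

section \<open>The universal property of \<open>[\<chi>]\<^sup>d(E)\<close>\<close>

lemma permutes_inv_in_range:
  assumes "p permutes {1..d}" "1 \<le> t" "t \<le> d"
  shows "1 \<le> Hilbert_Choice.inv p t \<and> Hilbert_Choice.inv p t \<le> d"
  using permutes_in_image[OF permutes_inv[OF assms(1)], of t] assms(2,3) by simp

lemma length_permute_word [simp]: "length (permute_word p xs) = length xs"
  by (simp add: permute_word_def del: upt_Suc)

lemma nth_permute_word:
  "i < length xs \<Longrightarrow> permute_word p xs ! i = xs ! (Hilbert_Choice.inv p (Suc i) - 1)"
  by (simp add: permute_word_def del: upt_Suc)

lemma permute_word_id [simp]: "permute_word id xs = xs"
  by (rule nth_equalityI) (simp_all add: nth_permute_word)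

lemma permute_word_words:
  assumes "p permutes {1..d}" "xs \<in> words E d"
  shows "permute_word p xs \<in> words E d"
proof -
  have "permute_word p xs ! i \<in> carrier E" if "i < d" for i
    using permutes_inv_in_range[OF assms(1), of "Suc i"] that words_length[OF assms(2)]
    by (auto simp: nth_permute_word intro!: words_nth[OF assms(2)])
  then show ?thesis
    using words_length[OF assms(2)] by (auto simp: words_def in_set_conv_nth)
qed

text \<open>List index \<open>i\<close> is position \<open>Suc i\<close>, and the inverse in
  \<open>permute_word\<close> makes a letter travel to the image of its position under
  \<open>p\<close>. A single variable slot thus stays a single variable slot, and multilinearity
  survives the permutation.\<close>

lemma permute_word_update:
  assumes "p permutes {1..d}" "length xs = d" "i < d"
  shows "permute_word p (xs[i := x]) = (permute_word p xs)[p (Suc i) - 1 := x]"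
proof (rule nth_equalityI)
  fix j assume "j < length (permute_word p (xs[i := x]))"
  then have j: "j < d" using assms by simp
  note r = permutes_inv_in_range[OF assms(1), of "Suc j"]
  have "1 \<le> p (Suc i)"
    using permutes_in_image[OF assms(1), of "Suc i"] assms(3) by simp
  moreover have "Hilbert_Choice.inv p (Suc j) = Suc i \<longleftrightarrow> Suc j = p (Suc i)"
    using permutes_inv_eq[OF assms(1)] by metis
  ultimately have "Hilbert_Choice.inv p (Suc j) - 1 = i \<longleftrightarrow> j = p (Suc i) - 1"
    using r j by auto
  then show "permute_word p (xs[i := x]) ! j = (permute_word p xs)[p (Suc i) - 1 := x] ! j"
    using j assms r by (auto simp: nth_permute_word nth_list_update)
qed simp

text \<open>The inverse in \<open>permute_word\<close> is what makes this a left action.\<close>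

lemma permute_word_comp:
  assumes "p permutes {1..d}" "q permutes {1..d}" "length xs = d"
  shows "permute_word p (permute_word q xs) = permute_word (p \<circ> q) xs"
proof (rule nth_equalityI)
  fix j assume "j < length (permute_word p (permute_word q xs))"
  then have j: "j < d" using assms by simp
  show "permute_word p (permute_word q xs) ! j = permute_word (p \<circ> q) xs ! j"
    using permutes_inv_in_range[OF assms(1), of "Suc j"] j assms(3)
    by (auto simp: nth_permute_word o_inv_distrib permutes_bij[OF assms(1)] permutes_bij[OF assms(2)]
        Suc_diff_le)
qed simp

lemma multilinear_permute_word:
  assumes "multilinear K E d M \<phi>" "p permutes {1..d}"
  shows "multilinear K E d M (\<lambda>xs. \<phi> (permute_word p xs))"
  unfolding multilinear_def
proof (intro conjI ballI allI impI)
  show "(\<lambda>xs. \<phi> (permute_word p xs)) \<in> words E d \<rightarrow> carrier M"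
    using assms permute_word_words by (fastforce simp: multilinear_def)
  fix xs i assume xs: "xs \<in> words E d" and i: "i < d"
  have "p (Suc i) - 1 < d"
    using permutes_in_image[OF assms(2), of "Suc i"] i by auto
  then show "linear_map K E M (\<lambda>x. \<phi> (permute_word p (xs[i := x])))"
    using assms(1) permute_word_words[OF assms(2) xs] words_length[OF xs] i
    by (simp add: permute_word_update[OF assms(2)] multilinear_def)
qed

text \<open>A permutation of the first \<open>d\<close> positions does not see the suffix: the
  inclusion of \<open>W d\<close> in \<open>W (d + e)\<close>, read on words.\<close>

lemma permute_word_append:
  assumes "p permutes {1..d}" "length xs = d"
  shows "permute_word p (xs @ ys) = permute_word p xs @ ys"
proof (rule nth_equalityI)
  fix j assume j: "j < length (permute_word p (xs @ ys))"
  show "permute_word p (xs @ ys) ! j = (permute_word p xs @ ys) ! j"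
  proof (cases "j < d")
    case True
    then show ?thesis
      using permutes_inv_in_range[OF assms(1), of "Suc j"] assms(2)
      by (auto simp: nth_permute_word nth_append)
  next
    case False
    then have "Hilbert_Choice.inv p (Suc j) = Suc j"
      by (intro permutes_not_in[OF permutes_inv[OF assms(1)]]) auto
    then show ?thesis
      using False j assms(2) by (auto simp: nth_permute_word nth_append)
  qed
qed simp

lemma omega_comp: "\<omega> (p \<circ> q) = \<omega> p \<circ> \<omega> q" if "q permutes {1..d}"
proof
  fix t
  \<comment> \<open>\<open>\<omega> p\<close> translates only from 2 on, so
    \<open>q (t - 1) + 1\<close> must not drop to 1; it does not, because \<open>q\<close> maps no
    positive number to 0.\<close>
  have "2 \<le> t \<Longrightarrow> 1 \<le> q (t - 1)"
    using permutes_in_image[OF that, of "t - 1"] permutes_not_in[OF that, of "t - 1"]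
    by (cases "t - 1 \<in> {1..d}") auto
  then show "\<omega> (p \<circ> q) t = (\<omega> p \<circ> \<omega> q) t"
    by (auto simp: \<omega>_def)
qed

lemma omega_id: "\<omega> id = id"
  by (auto simp: \<omega>_def)

lemma inv_omega:
  assumes "p permutes {1..d}"
  shows "Hilbert_Choice.inv (\<omega> p) = \<omega> (Hilbert_Choice.inv p)"
  by (rule inv_unique_comp)
    (simp_all add: omega_comp[OF permutes_inv[OF assms], symmetric] omega_comp[OF assms, symmetric]
      permutes_inv_o[OF assms] omega_id)

text \<open>\<open>\<omega> p\<close> fixes position 1 and acts like \<open>p\<close> behind it;
  iteration lets \<open>p\<close> act behind a whole prefix.\<close>

lemma permute_word_omega:
  assumes "p permutes {1..d}" "length xs = d"
  shows "permute_word (\<omega> p) (x # xs) = x # permute_word p xs"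
proof (rule nth_equalityI)
  fix j assume j: "j < length (permute_word (\<omega> p) (x # xs))"
  show "permute_word (\<omega> p) (x # xs) ! j = (x # permute_word p xs) ! j"
  proof (cases j)
    case 0
    then show ?thesis by (simp add: nth_permute_word inv_omega[OF assms(1)] \<omega>_def)
  next
    case (Suc i)
    then show ?thesis
      using j permutes_inv_in_range[OF assms(1), of "Suc i"] assms(2)
      by (auto simp: nth_permute_word inv_omega[OF assms(1)] \<omega>_def nth_Cons')
  qed
qed simp

section \<open>The groups \<open>W d\<close> and their characters\<close>

locale character_sequence = cring K for K :: "('k, 'r) ring_scheme" (structure) +
  fixes W :: "nat \<Rightarrow> (nat \<Rightarrow> nat) set" and \<chi> :: "nat \<Rightarrow> (nat \<Rightarrow> nat) \<Rightarrow> 'k"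
  assumes invariant: "omega_invariant K W \<chi>"
begin

lemma W_subgroup: "1 \<le> d \<Longrightarrow> subgroup (W d) (sym_group d)"
  using invariant by (simp add: omega_invariant_def)

lemma W_permutes: "1 \<le> d \<Longrightarrow> p \<in> W d \<Longrightarrow> p permutes {1..d}"
  using subgroup.subset[OF W_subgroup] by (auto simp: sym_group_def)

lemma W_id: "1 \<le> d \<Longrightarrow> id \<in> W d"
  using subgroup.one_closed[OF W_subgroup] by (simp add: sym_group_def)

lemma W_comp: "1 \<le> d \<Longrightarrow> p \<in> W d \<Longrightarrow> q \<in> W d \<Longrightarrow> p \<circ> q \<in> W d"
  using subgroup.m_closed[OF W_subgroup] by (simp add: sym_group_def)

lemma W_inv: "1 \<le> d \<Longrightarrow> p \<in> W d \<Longrightarrow> Hilbert_Choice.inv p \<in> W d"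
  using subgroup.m_inv_closed[OF W_subgroup, of d p] W_permutes
  by (simp add: sym_group_inv_equality sym_group_carrier)

lemma finite_W: "1 \<le> d \<Longrightarrow> finite (W d)"
  by (rule finite_subset[OF _ finite_permutations[of "{1..d}"]]) (use W_permutes in blast)+

lemma \<chi>_hom: "1 \<le> d \<Longrightarrow> \<chi> d \<in> hom (sym_group d\<lparr>carrier := W d\<rparr>) (units_of K)"
  using invariant by (simp add: omega_invariant_def)

lemma \<chi>_Units: "1 \<le> d \<Longrightarrow> p \<in> W d \<Longrightarrow> \<chi> d p \<in> Units K"
  using \<chi>_hom[of d] by (auto simp: hom_def units_of_def)

lemma \<chi>_closed [simp]: "1 \<le> d \<Longrightarrow> p \<in> W d \<Longrightarrow> \<chi> d p \<in> carrier K"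
  using \<chi>_Units by (rule Units_closed)

lemma \<chi>_comp: "1 \<le> d \<Longrightarrow> p \<in> W d \<Longrightarrow> q \<in> W d \<Longrightarrow> \<chi> d (p \<circ> q) = \<chi> d p \<otimes> \<chi> d q"
  using \<chi>_hom[of d] by (auto simp: hom_def units_of_def sym_group_def)

lemma \<chi>_id: "1 \<le> d \<Longrightarrow> \<chi> d id = \<one>"
  using \<chi>_comp[of d id id] \<chi>_Units[of d id] W_id[of d]
  by (metis Units_closed Units_l_cancel comp_id one_closed r_one)

lemma \<chi>_inv: "1 \<le> d \<Longrightarrow> p \<in> W d \<Longrightarrow> \<chi> d (Hilbert_Choice.inv p) = inv (\<chi> d p)"
  using \<chi>_comp[of d p "Hilbert_Choice.inv p"] W_inv[of d p] \<chi>_id[of d]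
    permutes_inv_o(1)[OF W_permutes, of d p]
  by (auto intro!: comm_inv_char[symmetric])

lemma W_mono: "1 \<le> d \<Longrightarrow> p \<in> W d \<Longrightarrow> p \<in> W (d + k) \<and> \<chi> (d + k) p = \<chi> d p"
proof (induction k)
  case (Suc k)
  then have "p \<in> W (d + k)" "\<chi> (d + k) p = \<chi> d p" "1 \<le> d + k" by auto
  then show ?case
    using invariant by (auto simp: omega_invariant_def)
qed simp

lemma W_shift:
  "1 \<le> d \<Longrightarrow> p \<in> W d \<Longrightarrow> (\<omega> ^^ k) p \<in> W (d + k) \<and> \<chi> (d + k) ((\<omega> ^^ k) p) = \<chi> d p"
proof (induction k)
  case (Suc k)
  then have "(\<omega> ^^ k) p \<in> W (d + k)" "\<chi> (d + k) ((\<omega> ^^ k) p) = \<chi> d p" "1 \<le> d + k" by auto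
  then show ?case
    using invariant by (auto simp: omega_invariant_def)
qed simp

lemma permute_word_shift:
  assumes "1 \<le> d" "p \<in> W d" "length ys = d"
  shows "permute_word ((\<omega> ^^ length xs) p) (xs @ ys) = xs @ permute_word p ys"
proof (induction xs)
  case (Cons x xs)
  have "(\<omega> ^^ length xs) p permutes {1..d + length xs}"
    using W_shift[OF assms(1,2), of "length xs"] assms(1) by (intro W_permutes) auto
  from permute_word_omega[OF this, of "xs @ ys" x] show ?case
    using Cons assms(3) by simp
qed simp

end

text \<open>The data of a linear map out of \<open>[\<chi>]\<^sup>d(E)\<close>. The factor is the
  one in the defining relations, and the guard keeps out the arbitrary \<open>W 0\<close> and
  \<open>\<chi> 0\<close>.\<close>

definition chi_multilinear ::
    "('k, 'r) ring_scheme \<Rightarrow> (nat \<Rightarrow> (nat \<Rightarrow> nat) set) \<Rightarrow> (nat \<Rightarrow> (nat \<Rightarrow> nat) \<Rightarrow> 'k) \<Rightarrow>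
      ('k, 'e, 's) module_scheme \<Rightarrow> nat \<Rightarrow> ('k, 'm, 't) module_scheme \<Rightarrow> ('e list \<Rightarrow> 'm) \<Rightarrow> bool" where
  "chi_multilinear K W \<chi> E d M \<phi> \<longleftrightarrow> multilinear K E d M \<phi> \<and>
     (d \<ge> 1 \<longrightarrow> (\<forall>p \<in> W d. \<forall>xs \<in> words E d.
       \<phi> (permute_word p xs) = inv\<^bsub>K\<^esub> (\<chi> d p) \<odot>\<^bsub>M\<^esub> \<phi> xs))"

locale chi_space = character_sequence K W \<chi> + tensor_space K E d
  for K :: "('k, 'r) ring_scheme" (structure) and W and \<chi> and E :: "('k, 'e, 's) module_scheme" and d
begin

abbreviation "word \<equiv> chi_word K W \<chi> E"

definition chi_relations where
  "chi_relations = {((inv (\<chi> d p)) \<odot>\<^bsub>T\<^esub> z) \<ominus>\<^bsub>T\<^esub> tensor_action K E d p z | p z.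
     d \<ge> 1 \<and> p \<in> W d \<and> z \<in> carrier T}"

sublocale T: module K T by (rule module_Q)

lemma inv_\<chi>_closed: "1 \<le> d \<Longrightarrow> p \<in> W d \<Longrightarrow> inv (\<chi> d p) \<in> carrier K"
  by (simp add: \<chi>_Units)

lemma linear_map_tensor_action:
  assumes "1 \<le> d" "p \<in> W d"
  shows "linear_map K T T (tensor_action K E d p)"
  unfolding tensor_action_def using assms
  by (intro linear_map_tensor_lift T.module_axioms multilinear_permute_word multilinear_tensor W_permutes)

lemma tensor_action_tensor:
  assumes "1 \<le> d" "p \<in> W d" "xs \<in> words E d"
  shows "tensor_action K E d p (tensor K E xs) = tensor K E (permute_word p xs)"
  unfolding tensor_action_def using assms
  by (intro tensor_lift_tensor T.module_axioms multilinear_permute_word multilinear_tensor W_permutes)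

lemma chi_relations_closed: "chi_relations \<subseteq> carrier T"
  unfolding chi_relations_def
  by (auto intro!: T.M.minus_closed T.smult_closed inv_\<chi>_closed linear_mapD(1)[OF linear_map_tensor_action])

lemma chi_submodule_eq: "chi_submodule K W \<chi> E d = generated_submodule K T chi_relations"
  by (simp add: chi_submodule_def chi_relations_def Let_def)

abbreviation "C \<equiv> chi_power K W \<chi> E d"

sublocale C: quotient K T "chi_submodule K W \<chi> E d"
  rewrites "quotient_module T (chi_submodule K W \<chi> E d) = C"
proof -
  show "quotient K T (chi_submodule K W \<chi> E d)"
    unfolding chi_submodule_eq
    by (intro quotient.intro quotient_axioms.intro T.module_axioms submodule_generated
        chi_relations_closed)
qed (simp add: chi_power_def)

sublocale C: module K C by (rule C.module_Q)

lemma word_eq: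
  "xs \<in> words E d \<Longrightarrow> word xs = chi_submodule K W \<chi> E d +>\<^bsub>T\<^esub> tensor K E xs"
  by (simp add: chi_word_def words_length)

lemma word_closed: "xs \<in> words E d \<Longrightarrow> word xs \<in> carrier C"
  by (simp add: word_eq tensor_closed)

lemma tensor_lift_relation:
  assumes "module K M" "chi_multilinear K W \<chi> E d M \<phi>" "z \<in> chi_submodule K W \<chi> E d"
  shows "tensor_lift K M \<phi> z = \<zero>\<^bsub>M\<^esub>"
proof -
  interpret M: module K M by fact
  have ml: "multilinear K E d M \<phi>"
    using assms(2) by (simp add: chi_multilinear_def)
  note lin = linear_map_tensor_lift[OF assms(1) ml]
  show ?thesis
  proof (rule linear_map_vanish_generated[OF T.module_axioms assms(1) lin chi_relations_closed])
    fix r assume "r \<in> chi_relations"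
    then obtain p z where r: "r = ((inv (\<chi> d p)) \<odot>\<^bsub>T\<^esub> z) \<ominus>\<^bsub>T\<^esub> tensor_action K E d p z"
      and p: "1 \<le> d" "p \<in> W d" and z: "z \<in> carrier T"
      unfolding chi_relations_def by blast
    note act = linear_map_tensor_action[OF p]
    \<comment> \<open>Equivariance is known on words only; both sides are linear in
      \<open>z\<close>, so it extends to all tensors.\<close>
    have "tensor_lift K M \<phi> (tensor_action K E d p z) = inv (\<chi> d p) \<odot>\<^bsub>M\<^esub> tensor_lift K M \<phi> z"
    proof (rule linear_map_eq_on_tensors[OF assms(1) _ _ _ z])
      fix xs assume xs: "xs \<in> words E d"
      show "tensor_lift K M \<phi> (tensor_action K E d p (tensor K E xs)) =
          inv (\<chi> d p) \<odot>\<^bsub>M\<^esub> tensor_lift K M \<phi> (tensor K E xs)"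
        using assms(2) xs p permute_word_words[OF W_permutes[OF p] xs]
        by (simp add: tensor_action_tensor tensor_lift_tensor[OF assms(1) ml] chi_multilinear_def)
    qed (use inv_\<chi>_closed[OF p] in \<open>auto intro: linear_map_compose[OF act lin] linear_map_smult[OF assms(1) lin]\<close>)
    then show "tensor_lift K M \<phi> r = \<zero>\<^bsub>M\<^esub>"
      using z inv_\<chi>_closed[OF p] linear_mapD[OF act] linear_mapD[OF lin]
      by (simp add: r linear_map_minus[OF T.module_axioms assms(1) lin])
        (simp add: a_minus_def M.M.r_neg)
  qed (use assms(3) in \<open>simp add: chi_submodule_eq\<close>)
qed

lemma linear_map_chi_lift:
  assumes "module K M" "chi_multilinear K W \<chi> E d M \<phi>"
  shows "linear_map K C M (chi_lift K M \<phi>)"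
  unfolding chi_lift_def using assms
  by (intro C.linear_map_the_elem linear_map_tensor_lift tensor_lift_relation)
    (auto simp: chi_multilinear_def)

lemma chi_lift_word:
  assumes "module K M" "chi_multilinear K W \<chi> E d M \<phi>" "xs \<in> words E d"
  shows "chi_lift K M \<phi> (word xs) = \<phi> xs"
proof -
  have ml: "multilinear K E d M \<phi>"
    using assms(2) by (simp add: chi_multilinear_def)
  show ?thesis
    unfolding chi_lift_def word_eq[OF assms(3)]
    using C.the_elem_coset[OF assms(1) linear_map_tensor_lift[OF assms(1) ml]
        tensor_lift_relation[OF assms(1,2)] tensor_closed[OF assms(3)]]
      tensor_lift_tensor[OF assms(1) ml assms(3)]
    by simp
qed

lemma chi_multilinear_word: "chi_multilinear K W \<chi> E d C word"
  unfolding chi_multilinear_def multilinear_def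
proof (intro conjI ballI allI impI)
  show "word \<in> words E d \<rightarrow> carrier C" by (simp add: word_closed)
  fix xs assume xs: "xs \<in> words E d"
  {
    fix i assume "i < d"
    then have "linear_map K E T (\<lambda>x. tensor K E (xs[i := x]))"
      using multilinear_tensor xs by (auto simp: multilinear_def)
    from linear_map_compose[OF this C.linear_map_coset]
    show "linear_map K E C (\<lambda>x. word (xs[i := x]))"
      by (rule linear_map_cong[rotated]) (use words_update[OF xs] in \<open>auto simp: word_eq module_axioms\<close>)
  next
    fix p assume p: "1 \<le> d" "p \<in> W d"
    let ?r = "inv (\<chi> d p) \<odot>\<^bsub>T\<^esub> tensor K E xs \<ominus>\<^bsub>T\<^esub> tensor_action K E d p (tensor K E xs)"
    have "?r \<in> chi_relations"
      unfolding chi_relations_def using p tensor_closed[OF xs] by blast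
    then have "?r \<in> chi_submodule K W \<chi> E d"
      unfolding chi_submodule_eq by (rule subsetD[OF generated_submodule_superset])
    then show "word (permute_word p xs) = inv (\<chi> d p) \<odot>\<^bsub>C\<^esub> word xs"
      using permute_word_words[OF W_permutes[OF p] xs] xs inv_\<chi>_closed[OF p]
      by (simp add: word_eq tensor_closed C.smult_eq tensor_action_tensor[OF p xs])
        (intro C.coset_eqI[symmetric]; simp add: tensor_closed)
  }
qed

lemma chi_induct [consumes 1, case_names zero add smult word]:
  assumes "u \<in> carrier C"
    and "P \<zero>\<^bsub>C\<^esub>"
    and "\<And>u v. u \<in> carrier C \<Longrightarrow> v \<in> carrier C \<Longrightarrow> P u \<Longrightarrow> P v \<Longrightarrow> P (u \<oplus>\<^bsub>C\<^esub> v)"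
    and "\<And>k u. k \<in> carrier K \<Longrightarrow> u \<in> carrier C \<Longrightarrow> P u \<Longrightarrow> P (k \<odot>\<^bsub>C\<^esub> u)"
    and "\<And>xs. xs \<in> words E d \<Longrightarrow> P (word xs)"
  shows "P u"
proof -
  let ?c = "\<lambda>z. chi_submodule K W \<chi> E d +>\<^bsub>T\<^esub> z"
  obtain z where z: "z \<in> carrier T" "u = ?c z"
    using assms(1) by (rule C.carrierE)
  have "P (?c z)"
    using z(1)
  proof (induction rule: tensor_induct)
    case zero
    then show ?case using assms(2) by (simp add: C.zero_eq)
  next
    case (add f g)
    then show ?case using assms(3)[of "?c f" "?c g"] by (simp add: C.add_eq)
  next
    case (smult k f)
    then show ?case using assms(4)[of k "?c f"] by (simp add: C.smult_eq)
  next
    case (tensor xs)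
    then show ?case using assms(5)[of xs] by (simp add: word_eq)
  qed
  with z show ?thesis by simp
qed

lemma linear_map_eq_on_words:
  assumes "module K M" "linear_map K C M f" "linear_map K C M g"
    and "\<And>xs. xs \<in> words E d \<Longrightarrow> f (word xs) = g (word xs)" "u \<in> carrier C"
  shows "f u = g u"
  using assms(5)
proof (induction rule: chi_induct)
  case zero
  then show ?case
    using linear_map_zero[OF C.module_axioms assms(1,2)] linear_map_zero[OF C.module_axioms assms(1,3)]
    by simp
qed (simp_all add: linear_mapD[OF assms(2)] linear_mapD[OF assms(3)] assms(4))

end

section \<open>Characters of order two\<close>

text \<open>Written as two transpositions, so that conjugation and inversion hold for all arguments
  and neighbouring transpositions cancel in products of cycles.\<close>

definition three_cycle :: "nat \<Rightarrow> nat \<Rightarrow> nat \<Rightarrow> nat \<Rightarrow> nat" where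
  "three_cycle x y z = transpose x y \<circ> transpose y z"

lemma three_cycle_apply:
  assumes "distinct [x, y, z]"
  shows "three_cycle x y z t = (if t = x then y else if t = y then z else if t = z then x else t)"
  using assms by (auto simp: three_cycle_def transpose_def)

lemma three_cycle_rotate: "distinct [x, y, z] \<Longrightarrow> three_cycle y z x = three_cycle x y z"
  by (rule ext) (auto simp: three_cycle_apply)

lemma transpose_conjugate:
  "bij p \<Longrightarrow> p \<circ> transpose x y = transpose (p x) (p y) \<circ> p"
  by (rule ext) (auto simp: transpose_def dest: bij_is_inj injD)

lemma three_cycle_conjugate:
  assumes "bij p"
  shows "p \<circ> three_cycle x y z \<circ> Hilbert_Choice.inv p = three_cycle (p x) (p y) (p z)"
proof -
  have "p \<circ> three_cycle x y z = three_cycle (p x) (p y) (p z) \<circ> p"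
    by (metis three_cycle_def comp_assoc transpose_conjugate[OF assms])
  then show ?thesis
    using bij_is_surj[OF assms] by (simp add: comp_assoc surj_iff)
qed

lemma inv_three_cycle: "Hilbert_Choice.inv (three_cycle x y z) = three_cycle z y x"
  by (rule inv_unique_comp)
    (simp_all add: three_cycle_def fun_eq_iff transpose_commute[of z y] transpose_commute[of y x])

text \<open>\<open>p\<close> moves only numbers up to \<open>M\<close>, \<open>q\<close> only
  numbers from \<open>M\<close> on. So the two products differ only at \<open>M\<close> and at its
  preimages under \<open>p\<close> and under \<open>q\<close>, and there they differ by one
  3-cycle.\<close>

lemma commutator_three_cycle:
  assumes p: "bij p" and q: "bij q"
    and fix_p: "\<And>z. z > M \<Longrightarrow> p z = z" and fix_q: "\<And>z. z < M \<Longrightarrow> q z = z"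
    and moves: "p M \<noteq> M" "q M \<noteq> (M :: nat)"
  shows "p \<circ> q \<circ> Hilbert_Choice.inv p \<circ> Hilbert_Choice.inv q = three_cycle M (p M) (q M)"
proof -
  have injp: "p s = p t \<longleftrightarrow> s = t" and injq: "q s = q t \<longleftrightarrow> s = t" for s t
    using bij_is_inj[OF p] bij_is_inj[OF q] by (auto dest: injD)
  have pM: "p M < M"
    using fix_p[of "p M"] moves(1) injp[of "p M" M] by (cases "p M" M rule: linorder_cases) auto
  have qM: "q M > M"
    using fix_q[of "q M"] moves(2) injq[of "q M" M] by (cases "q M" M rule: linorder_cases) auto
  have q_above: "q t \<ge> M" if "t \<ge> M" for t
    using fix_q[of "q t"] injq[of "q t" t] that by (metis not_le)
  have p_below: "p t \<le> M" if "t \<le> M" for t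
    using fix_p[of "p t"] injp[of "p t" t] that by (metis not_le)
  \<comment> \<open>Comparing the two products directly keeps inverses out of the case
    analysis.\<close>
  have key: "p (q s) = three_cycle M (p M) (q M) (q (p s))" for s
  proof -
    have d: "distinct [M, p M, q M]" using pM qM by auto
    consider "s = M" | "s < M" "p s = M" | "s < M" "p s \<noteq> M" | "s > M" "q s = M" | "s > M" "q s \<noteq> M"
      by linarith
    then show ?thesis
    proof cases
      case 1
      then show ?thesis using pM qM fix_p[of "q M"] fix_q[of "p M"] by (simp add: three_cycle_apply[OF d])
    next
      case 2
      then show ?thesis using pM qM fix_q[of s] by (simp add: three_cycle_apply[OF d])
    next
      case 3
      then have "p s < M" "p s \<noteq> p M" using p_below[of s] injp by auto
      then show ?thesis using 3 pM qM fix_q[of s] fix_q[of "p s"] by (simp add: three_cycle_apply[OF d])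
    next
      case 4
      then show ?thesis using pM qM fix_p[of s] by (simp add: three_cycle_apply[OF d])
    next
      case 5
      then have "q s > M" "q s \<noteq> q M" using q_above[of s] injq by auto
      then show ?thesis using 5 pM qM fix_p[of s] fix_p[of "q s"] by (simp add: three_cycle_apply[OF d])
    qed
  qed
  show ?thesis
  proof
    fix t
    define s where "s = Hilbert_Choice.inv p (Hilbert_Choice.inv q t)"
    have "t = q (p s)"
      using bij_is_surj[OF p] bij_is_surj[OF q] by (simp add: s_def surj_f_inv_f)
    then show "(p \<circ> q \<circ> Hilbert_Choice.inv p \<circ> Hilbert_Choice.inv q) t = three_cycle M (p M) (q M) t"
      using key[of s] by (simp add: s_def)
  qed
qed

lemma omega_three_cycle:
  assumes "1 \<le> x" "1 \<le> y" "1 \<le> z" "distinct [x, y, z]"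
  shows "\<omega> (three_cycle x y z) = three_cycle (x + 1) (y + 1) (z + 1)"
proof -
  have "distinct [x + 1, y + 1, z + 1]" using assms(4) by simp
  then show ?thesis
    using assms by (intro ext) (auto simp: \<omega>_def three_cycle_apply)
qed

text \<open>Later \<open>V\<close> is the union of the groups \<open>W\<^sub>d\<close> and \<open>N\<close> the kernel of \<open>\<chi>\<close> on it.\<close>

locale shift_group =
  fixes V N :: "(nat \<Rightarrow> nat) set"
  assumes finitary: "p \<in> V \<Longrightarrow> \<exists>d. p permutes {1..d}"
    and V_comp: "p \<in> V \<Longrightarrow> q \<in> V \<Longrightarrow> p \<circ> q \<in> V"
    and V_inv: "p \<in> V \<Longrightarrow> Hilbert_Choice.inv p \<in> V"
    and V_shift: "p \<in> V \<Longrightarrow> \<omega> p \<in> V"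
    and N_id: "id \<in> N"
    and N_comp: "p \<in> N \<Longrightarrow> q \<in> N \<Longrightarrow> p \<circ> q \<in> N"
    and N_commutator: "p \<in> V \<Longrightarrow> q \<in> V \<Longrightarrow>
      p \<circ> q \<circ> Hilbert_Choice.inv p \<circ> Hilbert_Choice.inv q \<in> N"
begin

lemma V_bij: "p \<in> V \<Longrightarrow> bij p"
  using finitary permutes_bij by blast

text \<open>An equivalence relation on whose classes \<open>V\<close> contains every 3-cycle, see
  \<open>three_cycle_in_V\<close>. The disjunct \<open>x = y\<close> makes it reflexive also at
  points that no 3-cycle of \<open>V\<close> moves.\<close>

definition linked :: "nat \<Rightarrow> nat \<Rightarrow> bool" where
  "linked x y \<longleftrightarrow> x = y \<or> (\<exists>z. distinct [x, y, z] \<and> three_cycle x y z \<in> V)"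

lemma three_cycle_reverse: "three_cycle x y z \<in> V \<Longrightarrow> three_cycle z y x \<in> V"
  using V_inv[of "three_cycle x y z"] by (simp add: inv_three_cycle)

lemma linked_refl [simp]: "linked x x"
  by (simp add: linked_def)

lemma linked_sym: "linked x y \<Longrightarrow> linked y x"
  unfolding linked_def using three_cycle_reverse three_cycle_rotate by (metis distinct_length_2_or_more distinct_singleton)

text \<open>Conjugation by \<open>p\<close> carries a 3-cycle witnessing the link to one witnessing
  the image link.\<close>

lemma linked_apply:
  assumes "p \<in> V" "linked x y"
  shows "linked (p x) (p y)"
proof (cases "x = y")
  case False
  then obtain z where z: "distinct [x, y, z]" "three_cycle x y z \<in> V"
    using assms(2) by (auto simp: linked_def)
  have "three_cycle (p x) (p y) (p z) \<in> V"
    using three_cycle_conjugate[OF V_bij[OF assms(1)], of x y z] V_comp V_inv assms(1) z(2) by metis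
  moreover have "distinct [p x, p y, p z]"
    using z(1) bij_is_inj[OF V_bij[OF assms(1)]] by (auto dest: injD)
  ultimately show ?thesis unfolding linked_def by blast
qed simp

text \<open>There are two 3-cycles through \<open>y\<close>, one through \<open>x\<close> and one
  through \<open>w\<close>. Conjugating one by the other brings \<open>x\<close>, \<open>y\<close>
  and \<open>w\<close> into a single cycle, whatever their third points \<open>u\<close> and
  \<open>v\<close> are.\<close>

lemma three_cycle_in_V:
  assumes "distinct [x, y, w]" "linked x y" "linked y w"
  shows "three_cycle x y w \<in> V"
proof -
  obtain u where u: "distinct [x, y, u]" "three_cycle x y u \<in> V"
    using assms by (auto simp: linked_def)
  obtain v where v: "distinct [y, w, v]" "three_cycle y w v \<in> V"
    using assms by (auto simp: linked_def)
  have conj: "three_cycle (p a) (p b) (p c) \<in> V" if "p \<in> V" "three_cycle a b c \<in> V" for p a b c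
    using three_cycle_conjugate[OF V_bij[OF that(1)], of a b c] V_comp V_inv that by metis
  show ?thesis
  proof (cases "u = w \<or> v = x")
    case True
    then show ?thesis using u v assms(1) three_cycle_rotate[of x y w] by auto
  next
    case False
    \<comment> \<open>Conjugation by \<open>three_cycle y w v\<close> fixes \<open>x\<close>, sends
      \<open>y\<close> to \<open>w\<close>, and keeps \<open>u\<close> unless \<open>u = v\<close>,
      when it becomes \<open>y\<close>.\<close>
    have 1: "three_cycle x w (if u = v then y else u) \<in> V"
      using conj[OF v(2) u(2)] u v assms(1) False by (auto simp: three_cycle_apply split: if_splits)
    show ?thesis
    proof (cases "u = v")
      case True
      then have "three_cycle y w x \<in> V" using 1 three_cycle_reverse by simp
      then show ?thesis
        using 1 True assms(1) three_cycle_reverse[of y w x] three_cycle_reverse[of x w y]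
          conj[OF v(2)] three_cycle_rotate[of y x w] three_cycle_rotate[of x w y]
          three_cycle_rotate[of x y w] three_cycle_rotate[of w x y] by auto
    next
      case False
      \<comment> \<open>Conjugation by \<open>three_cycle x y u\<close> sends \<open>x\<close>,
        \<open>w\<close>, \<open>u\<close> to \<open>y\<close>, \<open>w\<close>,
        \<open>x\<close>.\<close>
      then have "three_cycle y w x \<in> V"
        using conj[OF u(2) 1] u v assms(1) \<open>\<not> (u = w \<or> v = x)\<close>
        by (auto simp: three_cycle_apply split: if_splits)
      then show ?thesis
        using assms(1) three_cycle_rotate[of x y w] by auto
    qed
  qed
qed

lemma linked_trans:
  assumes "linked x y" "linked y w"
  shows "linked x w"
proof (cases "distinct [x, y, w]")
  case True
  then have "three_cycle w y x \<in> V"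
    using three_cycle_in_V assms three_cycle_reverse by blast
  then have "three_cycle x w y \<in> V"
    using True three_cycle_rotate[of x w y] three_cycle_rotate[of w y x] by auto
  then show ?thesis using True by (auto simp: linked_def)
qed (use assms in auto)

lemma linked_Suc:
  assumes "linked x y"
  shows "linked (x + 1) (y + 1)"
proof (cases "x = y")
  case False
  then obtain z where z: "distinct [x, y, z]" "three_cycle x y z \<in> V"
    using assms by (auto simp: linked_def)
  obtain d where d: "three_cycle x y z permutes {1..d}"
    using finitary[OF z(2)] by blast
  \<comment> \<open>Members of \<open>V\<close> fix 0, so the three points are positive and
    \<open>\<omega>\<close> really translates each of them.\<close>
  have "t \<in> {1..d}" if "t \<in> {x, y, z}" for t
  proof (rule ccontr)
    assume "t \<notin> {1..d}"
    then have "three_cycle x y z t = t" by (rule permutes_not_in[OF d])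
    then show False using that z(1) by (auto simp: three_cycle_apply split: if_splits)
  qed
  then have "1 \<le> x" "1 \<le> y" "1 \<le> z" by auto
  then have "three_cycle (x + 1) (y + 1) (z + 1) \<in> V"
    using V_shift[OF z(2)] omega_three_cycle z(1) by metis
  then show ?thesis using z(1) unfolding linked_def by fastforce
qed simp

lemma linked_add: "linked x y \<Longrightarrow> linked (x + k) (y + k)"
  by (induction k) (use linked_Suc in fastforce)+

text \<open>Translating the one link at \<open>M\<close> upwards gives the gap \<open>s\<close> at
  every number from \<open>M\<close> on, and transitivity runs along the progression. For positive
  \<open>s\<close> every number from \<open>M\<close> on thus lies in an infinite class.\<close>

lemma linked_progression:
  assumes "linked M (M + s)" "M \<le> x"
  shows "linked x (x + j * s)"
proof (induction j)
  case (Suc j)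
  have "linked (M + (x + j * s - M)) (M + s + (x + j * s - M))"
    by (rule linked_add[OF assms(1)])
  then have "linked (x + j * s) (x + Suc j * s)"
    using assms(2) by (simp add: ac_simps)
  with Suc show ?case by (rule linked_trans)
qed simp

text \<open>The classical identity behind the perfectness of alternating groups on at least five
  points: the cycle is the commutator of \<open>three_cycle x y u\<close> and
  \<open>three_cycle x z v\<close>.\<close>

lemma three_cycle_in_N:
  assumes d: "distinct [x, y, z, u, v]" and l: "linked x y" "linked x z" "linked x u" "linked x v"
  shows "three_cycle x y z \<in> N"
proof -
  let ?p = "three_cycle x y u" and ?q = "three_cycle x z v"
  have V: "?p \<in> V" "?q \<in> V"
    using d three_cycle_in_V[of x y u, OF _ l(1) linked_trans[OF linked_sym[OF l(1)] l(3)]]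
      three_cycle_in_V[of x z v, OF _ l(2) linked_trans[OF linked_sym[OF l(2)] l(4)]]
    by simp_all
  have "?q \<circ> Hilbert_Choice.inv ?p \<circ> Hilbert_Choice.inv ?q = three_cycle (?q u) (?q y) (?q x)"
    unfolding inv_three_cycle[of x y u] by (rule three_cycle_conjugate[OF V_bij[OF V(2)]])
  also have "\<dots> = three_cycle u y z"
    using d by (auto simp: three_cycle_apply)
  finally have "?p \<circ> ?q \<circ> Hilbert_Choice.inv ?p \<circ> Hilbert_Choice.inv ?q = ?p \<circ> three_cycle u y z"
    by (simp add: comp_assoc)
  also have "\<dots> = three_cycle x y z"
    by (simp add: three_cycle_def fun_eq_iff transpose_commute[of u y])
  finally show ?thesis using N_commutator[OF V] by simp
qed

text \<open>If \<open>p = (x y) q\<close> with \<open>y = p x\<close>, then \<open>q\<close> moves fewer points than \<open>p\<close>, and \<open>p\<^sup>2\<close> is the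
  product of the 3-cycle (or identity) \<open>(x y) (x q(y))\<close> and \<open>q\<^sup>2\<close>.\<close>

lemma square_in_N:
  assumes "linked M (M + s)" "0 < s"
    and "bij p" "finite {x. p x \<noteq> x}" "\<And>x. p x \<noteq> x \<Longrightarrow> M \<le> x" "\<And>x. linked x (p x)"
  shows "p \<circ> p \<in> N"
  using assms(3-)
proof (induction "card {x. p x \<noteq> x}" arbitrary: p rule: less_induct)
  case less
  note bij = less.prems(1) and fin = less.prems(2) and low = less.prems(3) and lnk = less.prems(4)
  have inj: "p a = p c \<longleftrightarrow> a = c" for a c
    using bij_is_inj[OF bij] by (auto dest: injD)
  show ?case
  proof (cases "p = id")
    case True
    then show ?thesis using N_id by simp
  next
    case False
    then obtain x where x: "p x \<noteq> x" by (auto simp: fun_eq_iff)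
    define y where "y = p x"
    define q where "q = transpose x y \<circ> p"
    have yx: "y \<noteq> x" "p y \<noteq> y" using x inj[of y x] by (auto simp: y_def)
    have bq: "bij q" using bij by (simp add: q_def bij_comp)
    then have injq: "q a = q c \<longleftrightarrow> a = c" for a c
      using bij_is_inj[of q] by (auto dest: injD)
    have qx: "q x = x" by (simp add: q_def y_def)
    have q_fix: "q z = z" if "p z = z" for z
      using that x yx by (auto simp: q_def transpose_def)
    have "{z. q z \<noteq> z} \<subset> {z. p z \<noteq> z}"
      using q_fix qx x by blast
    then have card: "card {z. q z \<noteq> z} < card {z. p z \<noteq> z}" and finq: "finite {z. q z \<noteq> z}"
      using fin psubset_card_mono[OF fin] by (auto intro: finite_subset)
    have xy: "linked x y" using lnk[of x] by (simp add: y_def)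
    have lq: "linked z (q z)" for z
    proof -
      have "linked (p z) (q z)"
        using xy linked_sym[OF xy] by (auto simp: q_def transpose_def)
      with lnk[of z] show ?thesis by (rule linked_trans)
    qed
    have qq: "q \<circ> q \<in> N"
      by (rule less.hyps[OF card bq finq _ lq]) (use q_fix low in blast)
    define w where "w = q y"
    have p: "p = transpose x y \<circ> q"
      by (simp add: q_def fun_eq_iff)
    \<comment> \<open>Moving \<open>q\<close> past \<open>transpose x y\<close> turns it into
      \<open>transpose x w\<close>, because \<open>q\<close> fixes \<open>x\<close>.\<close>
    have "p \<circ> p = transpose x y \<circ> (q \<circ> transpose x y) \<circ> q"
      by (simp add: p comp_assoc)
    also have "\<dots> = transpose x y \<circ> transpose x w \<circ> (q \<circ> q)"
      unfolding transpose_conjugate[OF bq] by (simp add: qx w_def comp_assoc)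
    finally have pp: "p \<circ> p = transpose x y \<circ> transpose x w \<circ> (q \<circ> q)" .
    show ?thesis
    proof (cases "w = y")
      case True
      then show ?thesis using pp qq by (simp add: fun_eq_iff comp_def)
    next
      case False
      have wx: "w \<noteq> x" using yx(1) injq[of y x] qx by (auto simp: w_def)
      \<comment> \<open>The auxiliary points for \<open>three_cycle_in_N\<close>, taken from the
        progression through \<open>y\<close>. As \<open>s\<close> is positive, the multiples push
        them beyond \<open>x\<close>, \<open>y\<close> and \<open>w\<close>.\<close>
      define u v where "u = y + (x + y + w + 1) * s" and "v = y + (x + y + w + 2) * s"
      have yM: "M \<le> y" using low yx(2) by blast
      have big: "(x + y + w + 1) * 1 \<le> (x + y + w + 1) * s"
        using assms(2) by (intro mult_le_mono2) simp
      have uv: "u > x + y + w" "v = u + s" using big by (auto simp: u_def v_def algebra_simps)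
      have "three_cycle y x w \<in> N"
      proof (rule three_cycle_in_N)
        show "distinct [y, x, w, u, v]" using yx wx False uv assms(2) by auto
        show "linked y x" by (rule linked_sym[OF xy])
        show "linked y w" using lq[of y] by (simp add: w_def)
        show "linked y u" "linked y v"
          unfolding u_def v_def by (rule linked_progression[OF assms(1) yM])+
      qed
      then have "transpose x y \<circ> transpose x w \<in> N"
        by (simp add: three_cycle_def transpose_commute[of y x])
      then show ?thesis unfolding pp using qq by (rule N_comp)
    qed
  qed
qed

lemma V_shift_power: "p \<in> V \<Longrightarrow> (\<omega> ^^ k) p \<in> V"
  by (induction k) (auto intro: V_shift)

lemma omega_power_apply: "(\<omega> ^^ k) p t = (if t > k then p (t - k) + k else t)" if "p 0 = 0"
proof (induction k arbitrary: t)
  case (Suc k)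
  have "(\<omega> ^^ Suc k) p t = (if 2 \<le> t then (\<omega> ^^ k) p (t - 1) + 1 else t)"
    by (simp add: \<omega>_def[of "(\<omega> ^^ k) p"])
  then show ?case unfolding Suc by auto
qed (use that in auto)

text \<open>The commutator of \<open>p\<close> with a shift of \<open>p\<close> that overlaps it in a single point is a
  3-cycle. Its shifts link every large number to infinitely many others, one of which lies
  outside the support of a far shift of \<open>p\<close>; hence that shift preserves the classes of
  \<^const>\<open>linked\<close>.\<close>

lemma ex_shift_square_in_N:
  assumes "p \<in> V"
  shows "\<exists>k. (\<omega> ^^ k) p \<circ> (\<omega> ^^ k) p \<in> N"
proof (cases "p = id")
  case True
  then show ?thesis using N_id by (intro exI[of _ 0]) simp
next
  case False
  obtain d where d: "p permutes {1..d}" using finitary[OF assms] by blast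
  have p0: "p 0 = 0" by (rule permutes_not_in[OF d]) simp
  let ?S = "{x. p x \<noteq> x}"
  have "?S \<subseteq> {1..d}" using permutes_not_in[OF d] by blast
  then have finS: "finite ?S" by (rule finite_subset) simp
  have neS: "?S \<noteq> {}" using False by (auto simp: fun_eq_iff)
  define m M where "m = Min ?S" and "M = Max ?S"
  have m: "p m \<noteq> m" "\<And>x. p x \<noteq> x \<Longrightarrow> m \<le> x"
    using Min_in[OF finS neS] Min_le[OF finS] by (auto simp: m_def)
  have M: "p M \<noteq> M" "\<And>x. p x \<noteq> x \<Longrightarrow> x \<le> M"
    using Max_in[OF finS neS] Max_ge[OF finS] by (auto simp: M_def)
  have mM: "1 \<le> m" "m \<le> M" using m M p0 by (auto simp: Suc_le_eq) (metis gr0I)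
  \<comment> \<open>This shift puts the smallest moved point \<open>m\<close> onto the largest one
    \<open>M\<close>, so the supports of \<open>p\<close> and \<open>q\<close> meet exactly
    there.\<close>
  define q where "q = (\<omega> ^^ (M - m)) p"
  have qV: "q \<in> V" unfolding q_def by (rule V_shift_power[OF assms])
  have q_apply: "q t = (if t > M - m then p (t - (M - m)) + (M - m) else t)" for t
    unfolding q_def by (rule omega_power_apply) (rule p0)
  have "M - (M - m) = m" using mM by simp
  then have qM: "q M \<noteq> M" using m(1) mM by (auto simp: q_apply)
  have q_fix: "q z = z" if "z < M" for z
  proof (cases "z > M - m")
    case True
    then have "z - (M - m) < m" using that mM by linarith
    then have "p (z - (M - m)) = z - (M - m)" using m(2) by (meson not_le)
    with True show ?thesis by (simp add: q_apply)
  qed (simp add: q_apply)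
  have p_fix: "p z = z" if "z > M" for z
    using M(2)[of z] that by (meson not_le)
  have qM_gt: "q M > M"
    using q_fix[of "q M"] qM bij_is_inj[OF V_bij[OF qV]]
    by (metis injD linorder_neqE_nat)
  have pM_lt: "p M < M"
    using p_fix[of "p M"] M(1) bij_is_inj[OF V_bij[OF assms]]
    by (metis injD linorder_neqE_nat)
  have "three_cycle M (p M) (q M) \<in> V"
    using commutator_three_cycle[OF V_bij[OF assms] V_bij[OF qV] p_fix q_fix M(1) qM]
      V_comp[OF V_comp[OF V_comp[OF assms qV] V_inv[OF assms]] V_inv[OF qV]] by simp
  moreover have dist: "distinct [M, p M, q M]" using pM_lt qM_gt by auto
  ultimately have "three_cycle M (q M) (p M) \<in> V"
    using three_cycle_reverse[of M "p M" "q M"] three_cycle_rotate[of M "q M" "p M"]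
      three_cycle_rotate[of "q M" "p M" M] by auto
  then have "linked M (q M)"
    using dist unfolding linked_def by (intro disjI2 exI[of _ "p M"]) auto
  define s where "s = q M - M"
  have s: "linked M (M + s)" "0 < s" using \<open>linked M (q M)\<close> qM_gt by (auto simp: s_def)
  \<comment> \<open>Shifting by \<open>M\<close> lifts the support above \<open>M\<close>, where
    every number lies in an infinite class.\<close>
  define r where "r = (\<omega> ^^ M) p"
  have rV: "r \<in> V" unfolding r_def by (rule V_shift_power[OF assms])
  have r_apply: "r t = (if t > M then p (t - M) + M else t)" for t
    unfolding r_def by (rule omega_power_apply) (rule p0)
  have r_high: "r t = t" if "t > 2 * M" for t
    using that p_fix[of "t - M"] by (auto simp: r_apply)
  have r_low: "M \<le> t" if "r t \<noteq> t" for t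
    using that by (auto simp: r_apply split: if_splits)
  have "r \<circ> r \<in> N"
  proof (rule square_in_N[OF s V_bij[OF rV] _ r_low])
    show "finite {x. r x \<noteq> x}"
      by (rule finite_subset[of _ "{..2 * M}"]) (use r_high in \<open>auto simp: not_less[symmetric]\<close>)
    show "linked x (r x)" for x
    proof (cases "r x = x")
      case False
      \<comment> \<open>A member of the class of \<open>x\<close> beyond \<open>2 * M\<close>, hence
        fixed by \<open>r\<close>. As \<open>r\<close> respects links, \<open>r x\<close> is linked
        to \<open>u\<close> as well, and so to \<open>x\<close>.\<close>
      define u where "u = x + (2 * M + 1) * s"
      have "(2 * M + 1) * 1 \<le> (2 * M + 1) * s" using s(2) by (intro mult_le_mono2) simp
      then have "u > 2 * M" by (simp add: u_def)
      then have "r u = u" by (rule r_high)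
      have xu: "linked x u"
        unfolding u_def by (rule linked_progression[OF s(1) r_low[OF False]])
      from linked_apply[OF rV this] have "linked (r x) u" by (simp add: \<open>r u = u\<close>)
      with xu show ?thesis using linked_sym linked_trans by blast
    qed simp
  qed
  then show ?thesis unfolding r_def by blast
qed

end

context character_sequence
begin

lemma \<chi>_eq_of_mem:
  assumes "1 \<le> d" "1 \<le> e" "p \<in> W d" "p \<in> W e"
  shows "\<chi> d p = \<chi> e p"
  using W_mono[OF assms(1,3), of e] W_mono[OF assms(2,4), of d] by (simp add: add.commute)

text \<open>Shifting changes the degree, so the groups \<open>W d\<close> are pooled into one
  shift-closed group before the permutation argument is applied.\<close>

lemma \<chi>_square:
  assumes "1 \<le> d" "p \<in> W d"
  shows "\<chi> d p \<otimes> \<chi> d p = \<one>"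
proof -
  define V where "V = (\<Union>d \<in> {1..}. W d)"
  \<comment> \<open>One degree is enough for membership: by \<open>\<chi>_eq_of_mem\<close> the
    value does not depend on the degree in which it is taken.\<close>
  define N where "N = {p. \<exists>d \<ge> 1. p \<in> W d \<and> \<chi> d p = \<one>}"
  have two: "\<exists>d \<ge> 1. p \<in> W d \<and> q \<in> W d" if "p \<in> V" "q \<in> V" for p q
  proof -
    obtain a c where "1 \<le> a" "p \<in> W a" "1 \<le> c" "q \<in> W c" using \<open>p \<in> V\<close> \<open>q \<in> V\<close> by (auto simp: V_def)
    then show ?thesis
      using W_mono[of a p c] W_mono[of c q a] by (intro exI[of _ "a + c"]) (simp add: add.commute)
  qed
  interpret shift_group V N
  proof
    show "\<exists>d. p permutes {1..d}" if "p \<in> V" for p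
      using that W_permutes by (auto simp: V_def)
    show "p \<circ> q \<in> V" if "p \<in> V" "q \<in> V" for p q
      using two[OF that] W_comp by (auto simp: V_def)
    show "Hilbert_Choice.inv p \<in> V" if "p \<in> V" for p
      using that W_inv by (auto simp: V_def)
    show "\<omega> p \<in> V" if p: "p \<in> V" for p
    proof -
      obtain a where "1 \<le> a" "p \<in> W a" using p by (auto simp: V_def)
      then have "\<omega> p \<in> W (a + 1)" using W_shift[of a p 1] by simp
      then show ?thesis unfolding V_def by (rule UN_I[rotated]) simp
    qed
    show "id \<in> N"
      using W_id[of 1] \<chi>_id[of 1] by (auto simp: N_def)
    show "p \<circ> q \<in> N" if pq: "p \<in> N" "q \<in> N" for p q
    proof -
      obtain a c where ac: "1 \<le> a" "p \<in> W a" "\<chi> a p = \<one>" "1 \<le> c" "q \<in> W c" "\<chi> c q = \<one>"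
        using pq by (auto simp: N_def)
      then have "p \<in> W (a + c)" "\<chi> (a + c) p = \<one>" "q \<in> W (a + c)" "\<chi> (a + c) q = \<one>"
        using W_mono[of a p c] W_mono[of c q a] by (simp_all add: add.commute)
      then show ?thesis
        using ac W_comp[of "a + c" p q] \<chi>_comp[of "a + c" p q]
        unfolding N_def by (intro CollectI exI[of _ "a + c"]) simp
    qed
    show "p \<circ> q \<circ> Hilbert_Choice.inv p \<circ> Hilbert_Choice.inv q \<in> N" if pq: "p \<in> V" "q \<in> V" for p q
    proof -
      obtain a where a: "1 \<le> a" "p \<in> W a" "q \<in> W a" using two[OF pq] by blast
      note u = \<chi>_Units[OF a(1,2)] \<chi>_Units[OF a(1,3)]
      have "\<chi> a (p \<circ> q \<circ> Hilbert_Choice.inv p \<circ> Hilbert_Choice.inv q) =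
          \<chi> a p \<otimes> \<chi> a q \<otimes> inv (\<chi> a p) \<otimes> inv (\<chi> a q)"
        using a by (simp only: \<chi>_comp W_comp W_inv \<chi>_inv)
      also have "\<dots> = (\<chi> a p \<otimes> inv (\<chi> a p)) \<otimes> (\<chi> a q \<otimes> inv (\<chi> a q))"
        using u by (simp add: Units_closed m_ac del: Units_r_inv Units_l_inv)
      also have "\<dots> = \<one>" using u by simp
      finally show ?thesis
        using a unfolding N_def by (intro CollectI exI[of _ a]) (simp add: W_comp W_inv)
    qed
  qed
  have "p \<in> V" using assms by (auto simp: V_def)
  then obtain k where "(\<omega> ^^ k) p \<circ> (\<omega> ^^ k) p \<in> N"
    using ex_shift_square_in_N by blast
  then obtain c where c: "1 \<le> c" "(\<omega> ^^ k) p \<circ> (\<omega> ^^ k) p \<in> W c" "\<chi> c ((\<omega> ^^ k) p \<circ> (\<omega> ^^ k) p) = \<one>"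
    by (auto simp: N_def)
  have s: "(\<omega> ^^ k) p \<in> W (d + k)" "\<chi> (d + k) ((\<omega> ^^ k) p) = \<chi> d p" "1 \<le> d + k"
    using W_shift[OF assms, of k] assms(1) by auto
  have "\<chi> d p \<otimes> \<chi> d p = \<chi> (d + k) ((\<omega> ^^ k) p \<circ> (\<omega> ^^ k) p)"
    using \<chi>_comp[OF s(3,1,1)] s(2) by simp
  also have "\<dots> = \<one>"
    using \<chi>_eq_of_mem[OF s(3) c(1) W_comp[OF s(3,1,1)] c(2)] c(3) by simp
  finally show ?thesis .
qed

end

section \<open>The ring \<open>[\<chi>](E)\<close>\<close>

text \<open>One construction serves twice: for the product, with \<open>M = P (d + e)\<close>, and
  for the form, with values in \<open>K\<close>. The nested lifts of \<open>bilift\<close> are those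
  of \<open>chi_mult\<close> and \<open>chi_pairing\<close>, so both are instances of it.\<close>

locale chi_bilinear =
  left: chi_space K W \<chi> E d + right: chi_space K W \<chi> E' e + M: module K M
  for K :: "('k, 'r) ring_scheme" (structure) and W and \<chi>
    and E :: "('k, 'e, 's) module_scheme" and d
    and E' :: "('k, 'f, 't) module_scheme" and e
    and M :: "('k, 'm, 'u) module_scheme" +
  fixes \<psi> :: "'e list \<Rightarrow> 'f list \<Rightarrow> 'm"
  assumes left_multilinear: "ys \<in> words E' e \<Longrightarrow> chi_multilinear K W \<chi> E d M (\<lambda>xs. \<psi> xs ys)"
    and right_multilinear: "xs \<in> words E d \<Longrightarrow> chi_multilinear K W \<chi> E' e M (\<psi> xs)"
begin

definition bilift where
  "bilift u v = chi_lift K M (\<lambda>xs. chi_lift K M (\<psi> xs) v) u"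

text \<open>The outer lift asks for multilinearity in \<open>xs\<close> with \<open>v\<close> a
  general element. The inner lift is linear in \<open>v\<close>, so linearity in a slot is carried
  from words to \<open>v\<close> by induction, and equivariance by comparing two linear maps on
  words.\<close>

lemma chi_multilinear_inner:
  assumes v: "v \<in> carrier right.C"
  shows "chi_multilinear K W \<chi> E d M (\<lambda>xs. chi_lift K M (\<psi> xs) v)"
  unfolding chi_multilinear_def multilinear_def
proof (intro conjI ballI allI impI)
  note lin = right.linear_map_chi_lift[OF M.module_axioms right_multilinear]
  note val = right.chi_lift_word[OF M.module_axioms right_multilinear]
  show "(\<lambda>xs. chi_lift K M (\<psi> xs) v) \<in> words E d \<rightarrow> carrier M"
    using linear_mapD(1)[OF lin] v by auto
  fix xs assume xs: "xs \<in> words E d"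
  {
    fix i assume i: "i < d"
    note upd = words_update[OF xs]
    show "linear_map K E M (\<lambda>x. chi_lift K M (\<psi> (xs[i := x])) v)"
      using v
    proof (induction rule: right.chi_induct)
      case zero
      show ?case
        by (rule linear_map_cong[OF left.module_axioms linear_map_const_zero[OF M.module_axioms]])
          (rule linear_map_zero[OF right.C.module_axioms M.module_axioms lin[OF upd]])
    next
      case (add u v)
      show ?case
        by (rule linear_map_cong[OF left.module_axioms linear_map_add[OF M.module_axioms add(3,4)]])
          (rule linear_mapD(2)[OF lin[OF upd] add(1,2)])
    next
      case (smult k u)
      show ?case
        by (rule linear_map_cong[OF left.module_axioms
              linear_map_smult[OF M.module_axioms smult(3,1)]])
          (rule linear_mapD(3)[OF lin[OF upd] smult(1,2)])
    next
      case (word ys)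
      have "linear_map K E M (\<lambda>x. \<psi> (xs[i := x]) ys)"
        using left_multilinear[OF word] xs i by (auto simp: chi_multilinear_def multilinear_def)
      then show ?case
        by (rule linear_map_cong[OF left.module_axioms]) (rule val[OF upd word])
    qed
  next
    fix p assume p: "1 \<le> d" "p \<in> W d"
    note pw = permute_word_words[OF left.W_permutes[OF p] xs]
    show "chi_lift K M (\<psi> (permute_word p xs)) v = inv (\<chi> d p) \<odot>\<^bsub>M\<^esub> chi_lift K M (\<psi> xs) v"
    proof (rule right.linear_map_eq_on_words[OF M.module_axioms lin[OF pw]
          linear_map_smult[OF M.module_axioms lin[OF xs] left.inv_\<chi>_closed[OF p]] _ v])
      fix ys assume "ys \<in> words E' e"
      then show "chi_lift K M (\<psi> (permute_word p xs)) (right.word ys) =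
          inv (\<chi> d p) \<odot>\<^bsub>M\<^esub> chi_lift K M (\<psi> xs) (right.word ys)"
        using left_multilinear[of ys] p xs by (simp add: val pw chi_multilinear_def)
    qed
  }
qed

lemma linear_map_bilift_left:
  "v \<in> carrier right.C \<Longrightarrow> linear_map K left.C M (\<lambda>u. bilift u v)"
  unfolding bilift_def
  by (intro left.linear_map_chi_lift M.module_axioms chi_multilinear_inner)

lemma bilift_word_left:
  "xs \<in> words E d \<Longrightarrow> v \<in> carrier right.C \<Longrightarrow> bilift (left.word xs) v = chi_lift K M (\<psi> xs) v"
  unfolding bilift_def
  by (intro left.chi_lift_word M.module_axioms chi_multilinear_inner)

lemma bilift_word:
  "xs \<in> words E d \<Longrightarrow> ys \<in> words E' e \<Longrightarrow> bilift (left.word xs) (right.word ys) = \<psi> xs ys"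
  by (simp add: bilift_word_left right.word_closed right.chi_lift_word M.module_axioms
      right_multilinear)

text \<open>The lift over \<open>u\<close> is the outer one, so linearity in \<open>v\<close> is not
  immediate. It is visible when \<open>u\<close> is a word and is then propagated through
  \<open>u\<close>.\<close>

lemma linear_map_bilift_right:
  assumes u: "u \<in> carrier left.C"
  shows "linear_map K right.C M (bilift u)"
  using u
proof (induction rule: left.chi_induct)
  case zero
  show ?case
    by (rule linear_map_cong[OF right.C.module_axioms linear_map_const_zero[OF M.module_axioms]])
      (rule linear_map_zero[OF left.C.module_axioms M.module_axioms linear_map_bilift_left])
next
  case (add u v)
  show ?case
    by (rule linear_map_cong[OF right.C.module_axioms linear_map_add[OF M.module_axioms add(3,4)]])
      (rule linear_mapD(2)[OF linear_map_bilift_left add(1,2)])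
next
  case (smult k u)
  show ?case
    by (rule linear_map_cong[OF right.C.module_axioms
          linear_map_smult[OF M.module_axioms smult(3,1)]])
      (rule linear_mapD(3)[OF linear_map_bilift_left smult(1,2)])
next
  case (word xs)
  show ?case
    by (rule linear_map_cong[OF right.C.module_axioms
          right.linear_map_chi_lift[OF M.module_axioms right_multilinear[OF word]]])
      (rule bilift_word_left[OF word])
qed

end

text \<open>Both sides run over \<open>i + j \<le> n\<close>, by diagonals and by rows; passing to
  \<open>Suc n\<close> adds the same diagonal to each. Associativity of the graded product rests on
  this rearrangement.\<close>

lemma (in abelian_monoid) finsum_triangle:
  fixes n :: nat
  assumes "\<And>i j. i + j \<le> n \<Longrightarrow> g i j \<in> carrier G"
  shows "(\<Oplus>d \<in> {0..n}. \<Oplus>i \<in> {0..d}. g i (d - i)) = (\<Oplus>i \<in> {0..n}. \<Oplus>j \<in> {0..n - i}. g i j)"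
  using assms
proof (induction n)
  case (Suc n)
  let ?t = "\<lambda>n i. \<Oplus>j \<in> {0..n - i}. g i j"
  have diag: "(\<lambda>i. g i (Suc n - i)) \<in> {0..Suc n} \<rightarrow> carrier G"
    using Suc.prems by auto
  have t: "?t n i \<in> carrier G" if "i \<le> n" for i
    using Suc.prems that by (intro finsum_closed) auto
  have ts: "?t (Suc n) i = ?t n i \<oplus> g i (Suc n - i)" if "i \<le> n" for i
  proof -
    have "?t (Suc n) i = (\<Oplus>j \<in> insert (Suc n - i) {0..n - i}. g i j)"
      using that by (intro arg_cong[where f = "finsum G (g i)"]) auto
    also have "\<dots> = g i (Suc n - i) \<oplus> ?t n i"
      using Suc.prems that by (intro finsum_insert) auto
    finally show ?thesis
      using t[OF that] Suc.prems that by (simp add: a_comm)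
  qed
  have "(\<Oplus>i \<in> {0..Suc n}. ?t (Suc n) i) = (\<Oplus>i \<in> insert (Suc n) {0..n}. ?t (Suc n) i)"
    by (simp add: atLeast0_atMost_Suc)
  also have "\<dots> = ?t (Suc n) (Suc n) \<oplus> (\<Oplus>i \<in> {0..n}. ?t (Suc n) i)"
    using t ts Suc.prems by (intro finsum_insert) auto
  also have "?t (Suc n) (Suc n) = g (Suc n) 0"
    using Suc.prems by (simp add: finsum_insert finsum_empty)
  also have "(\<Oplus>i \<in> {0..n}. ?t (Suc n) i) = (\<Oplus>i \<in> {0..n}. ?t n i \<oplus> g i (Suc n - i))"
    using t ts Suc.prems by (intro finsum_cong') auto
  also have "\<dots> = (\<Oplus>i \<in> {0..n}. ?t n i) \<oplus> (\<Oplus>i \<in> {0..n}. g i (Suc n - i))"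
    using t Suc.prems by (intro finsum_addf) auto
  finally have "(\<Oplus>i \<in> {0..Suc n}. ?t (Suc n) i) =
      (g (Suc n) 0 \<oplus> (\<Oplus>i \<in> {0..n}. g i (Suc n - i))) \<oplus> (\<Oplus>i \<in> {0..n}. ?t n i)"
    using t Suc.prems by (simp add: a_ac finsum_closed Pi_iff)
  also have "g (Suc n) 0 \<oplus> (\<Oplus>i \<in> {0..n}. g i (Suc n - i)) = (\<Oplus>i \<in> insert (Suc n) {0..n}. g i (Suc n - i))"
    using Suc.prems by (subst finsum_insert) auto
  also have "insert (Suc n) {0..n} = {0..Suc n}"
    by auto
  also have "(\<Oplus>i \<in> {0..n}. ?t n i) = (\<Oplus>d \<in> {0..n}. \<Oplus>i \<in> {0..d}. g i (d - i))"
    using Suc by simp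
  also have "(\<Oplus>i \<in> {0..Suc n}. g i (Suc n - i)) \<oplus> \<dots> =
      (\<Oplus>d \<in> insert (Suc n) {0..n}. \<Oplus>i \<in> {0..d}. g i (d - i))"
    using Suc.prems by (subst finsum_insert) (auto intro!: finsum_closed)
  also have "insert (Suc n) {0..n} = {0..Suc n}"
    by auto
  finally show ?case by simp
qed (simp add: finsum_insert finsum_empty)

section \<open>The product of words and the ring axioms\<close>

locale chi_module = character_sequence K W \<chi> + module K E
  for K :: "('k, 'r) ring_scheme" (structure) and W and \<chi> and E :: "('k, 'e, 's) module_scheme"
begin

sublocale S: chi_space K W \<chi> E d for d
  by (intro chi_space.intro tensor_space.intro character_sequence_axioms module_axioms)

abbreviation "P \<equiv> chi_power K W \<chi> E"
abbreviation "word \<equiv> chi_word K W \<chi> E"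
abbreviation "cmul \<equiv> chi_mult K W \<chi> E"
abbreviation "alg \<equiv> chi_algebra K W \<chi> E"

lemma word_permute:
  "1 \<le> d \<Longrightarrow> p \<in> W d \<Longrightarrow> xs \<in> words E d \<Longrightarrow>
    word (permute_word p xs) = inv (\<chi> d p) \<odot>\<^bsub>P d\<^esub> word xs"
  using S.chi_multilinear_word[of d] unfolding chi_multilinear_def by blast

text \<open>Equivariance in the left factor is compatibility of \<chi> with the inclusion of
  \<open>W d\<close> in \<open>W (d + e)\<close>.\<close>

lemma chi_multilinear_append_left:
  assumes ys: "ys \<in> words E e"
  shows "chi_multilinear K W \<chi> E d (P (d + e)) (\<lambda>xs. word (xs @ ys))"
  unfolding chi_multilinear_def multilinear_def
proof (intro conjI ballI allI impI)
  show "(\<lambda>xs. word (xs @ ys)) \<in> words E d \<rightarrow> carrier (P (d + e))"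
    using ys by (auto intro: S.word_closed)
  fix xs assume xs: "xs \<in> words E d"
  have w: "xs @ ys \<in> words E (d + e)" using xs ys by simp
  {
    fix i assume i: "i < d"
    then have "linear_map K E (P (d + e)) (\<lambda>x. word ((xs @ ys)[i := x]))"
      using S.chi_multilinear_word[of "d + e"] w by (auto simp: chi_multilinear_def multilinear_def)
    then show "linear_map K E (P (d + e)) (\<lambda>x. word (xs[i := x] @ ys))"
      using i words_length[OF xs] by (simp add: list_update_append1)
  next
    fix p assume p: "1 \<le> d" "p \<in> W d"
    show "word (permute_word p xs @ ys) = inv (\<chi> d p) \<odot>\<^bsub>P (d + e)\<^esub> word (xs @ ys)"
      using word_permute[of "d + e" p, OF _ _ w] p W_mono[OF p, of e]
      by (simp add: permute_word_append[OF W_permutes[OF p] words_length[OF xs]])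
  }
qed

text \<open>In the right factor \<open>p\<close> acts on the positions after the first
  \<open>d\<close>, that is, as its \<open>d\<close>-fold shift; this is where compatibility of
  \<chi> with \<open>\<omega>\<close> enters the product.\<close>

lemma chi_multilinear_append_right:
  assumes xs: "xs \<in> words E d"
  shows "chi_multilinear K W \<chi> E e (P (d + e)) (\<lambda>ys. word (xs @ ys))"
  unfolding chi_multilinear_def multilinear_def
proof (intro conjI ballI allI impI)
  show "(\<lambda>ys. word (xs @ ys)) \<in> words E e \<rightarrow> carrier (P (d + e))"
    using xs by (auto intro: S.word_closed)
  fix ys assume ys: "ys \<in> words E e"
  have w: "xs @ ys \<in> words E (d + e)" using xs ys by simp
  {
    fix i assume i: "i < e"
    then have "linear_map K E (P (d + e)) (\<lambda>x. word ((xs @ ys)[d + i := x]))"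
      using S.chi_multilinear_word[of "d + e"] w by (auto simp: chi_multilinear_def multilinear_def)
    then show "linear_map K E (P (d + e)) (\<lambda>x. word (xs @ ys[i := x]))"
      using i words_length[OF xs] by (simp add: list_update_append)
  next
    fix p assume p: "1 \<le> e" "p \<in> W e"
    show "word (xs @ permute_word p ys) = inv (\<chi> e p) \<odot>\<^bsub>P (d + e)\<^esub> word (xs @ ys)"
      using word_permute[of "d + e" "(\<omega> ^^ d) p", OF _ _ w] p W_shift[OF p, of d]
        permute_word_shift[OF p words_length[OF ys], of xs] words_length[OF xs]
      by (simp add: add.commute)
  }
qed

sublocale B: chi_bilinear K W \<chi> E d E e "P (d + e)" "\<lambda>xs ys. word (xs @ ys)"
  rewrites "chi_bilinear.bilift K (P (d + e)) (\<lambda>xs ys. word (xs @ ys)) = cmul d e" for d e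
proof -
  show bil: "chi_bilinear K W \<chi> E d E e (P (d + e)) (\<lambda>xs ys. word (xs @ ys))"
    by (intro chi_bilinear.intro chi_bilinear_axioms.intro S.chi_space_axioms S.C.module_axioms
        chi_multilinear_append_left chi_multilinear_append_right)
  show "chi_bilinear.bilift K (P (d + e)) (\<lambda>xs ys. word (xs @ ys)) = cmul d e"
    by (intro ext) (simp add: chi_bilinear.bilift_def[OF bil] chi_mult_def Let_def)
qed

lemma cmul_closed [simp]: "u \<in> carrier (P d) \<Longrightarrow> v \<in> carrier (P e) \<Longrightarrow> cmul d e u v \<in> carrier (P (d + e))"
  by (rule linear_mapD(1)[OF B.linear_map_bilift_right])

text \<open>On words this is associativity of \<open>@\<close>; linearity extends it one argument at
  a time. Unfolding \<open>add.assoc\<close> reconciles the targets \<open>P (d + e + f)\<close> and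
  \<open>P (d + (e + f))\<close>.\<close>

lemma cmul_assoc:
  assumes u: "u \<in> carrier (P d)" and v: "v \<in> carrier (P e)" and w: "w \<in> carrier (P f)"
  shows "cmul (d + e) f (cmul d e u v) w = cmul d (e + f) u (cmul e f v w)"
proof (rule S.linear_map_eq_on_words[where f = "\<lambda>u. cmul (d + e) f (cmul d e u v) w"
      and g = "\<lambda>u. cmul d (e + f) u (cmul e f v w)", OF S.C.module_axioms _ _ _ u])
  show "linear_map K (P d) (P (d + e + f)) (\<lambda>u. cmul (d + e) f (cmul d e u v) w)"
    by (rule linear_map_compose[OF B.linear_map_bilift_left B.linear_map_bilift_left]) fact+
  show "linear_map K (P d) (P (d + e + f)) (\<lambda>u. cmul d (e + f) u (cmul e f v w))"
    unfolding add.assoc by (rule B.linear_map_bilift_left) (simp add: v w)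
  fix xs assume xs: "xs \<in> words E d"
  note wx = S.word_closed[OF xs]
  show "cmul (d + e) f (cmul d e (word xs) v) w = cmul d (e + f) (word xs) (cmul e f v w)"
  proof (rule S.linear_map_eq_on_words[where f = "\<lambda>v. cmul (d + e) f (cmul d e (word xs) v) w"
      and g = "\<lambda>v. cmul d (e + f) (word xs) (cmul e f v w)", OF S.C.module_axioms _ _ _ v])
    show "linear_map K (P e) (P (d + e + f)) (\<lambda>v. cmul (d + e) f (cmul d e (word xs) v) w)"
      by (rule linear_map_compose[OF B.linear_map_bilift_right B.linear_map_bilift_left]) fact+
    show "linear_map K (P e) (P (d + e + f)) (\<lambda>v. cmul d (e + f) (word xs) (cmul e f v w))"
      unfolding add.assoc
      by (rule linear_map_compose[OF B.linear_map_bilift_left B.linear_map_bilift_right]) fact+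
    fix ys assume ys: "ys \<in> words E e"
    note wy = S.word_closed[OF ys]
    show "cmul (d + e) f (cmul d e (word xs) (word ys)) w =
        cmul d (e + f) (word xs) (cmul e f (word ys) w)"
    proof (rule S.linear_map_eq_on_words[where f = "\<lambda>w. cmul (d + e) f (cmul d e (word xs) (word ys)) w"
      and g = "\<lambda>w. cmul d (e + f) (word xs) (cmul e f (word ys) w)", OF S.C.module_axioms _ _ _ w])
      show "linear_map K (P f) (P (d + e + f)) (\<lambda>w. cmul (d + e) f (cmul d e (word xs) (word ys)) w)"
        by (rule B.linear_map_bilift_right) (simp add: wx wy)
      show "linear_map K (P f) (P (d + e + f)) (\<lambda>w. cmul d (e + f) (word xs) (cmul e f (word ys) w))"
        unfolding add.assoc
        by (rule linear_map_compose[OF B.linear_map_bilift_right B.linear_map_bilift_right]) fact+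
      fix zs assume "zs \<in> words E f"
      then show "cmul (d + e) f (cmul d e (word xs) (word ys)) (word zs) =
          cmul d (e + f) (word xs) (cmul e f (word ys) (word zs))"
        using xs ys by (simp add: B.bilift_word)
    qed
  qed
qed

lemma words_0: "[] \<in> words E 0"
  by (simp add: words_def)

lemma cmul_one_left:
  assumes "v \<in> carrier (P e)"
  shows "cmul 0 e (word []) v = v"
proof (rule S.linear_map_eq_on_words[where f = "cmul 0 e (word [])" and g = "\<lambda>v. v", OF S.C.module_axioms _ _ _ assms])
  show "linear_map K (P e) (P e) (cmul 0 e (word []))"
    using B.linear_map_bilift_right[OF S.word_closed[OF words_0], of e] by simp
  show "linear_map K (P e) (P e) (\<lambda>v. v)"
    by (rule linear_mapI) auto
  show "cmul 0 e (word []) (word xs) = word xs" if "xs \<in> words E e" for xs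
    using B.bilift_word[OF words_0 that] by simp
qed

lemma cmul_one_right:
  assumes "u \<in> carrier (P d)"
  shows "cmul d 0 u (word []) = u"
proof (rule S.linear_map_eq_on_words[where f = "\<lambda>u. cmul d 0 u (word [])" and g = "\<lambda>u. u", OF S.C.module_axioms _ _ _ assms])
  show "linear_map K (P d) (P d) (\<lambda>u. cmul d 0 u (word []))"
    using B.linear_map_bilift_left[OF S.word_closed[OF words_0], of d] by simp
  show "linear_map K (P d) (P d) (\<lambda>v. v)"
    by (rule linear_mapI) auto
  show "cmul d 0 (word xs) (word []) = word xs" if "xs \<in> words E d" for xs
    using B.bilift_word[OF that words_0] by simp
qed

lemma cmul_zero_left: "v \<in> carrier (P e) \<Longrightarrow> cmul d e \<zero>\<^bsub>P d\<^esub> v = \<zero>\<^bsub>P (d + e)\<^esub>"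
  by (rule linear_map_zero[OF S.C.module_axioms S.C.module_axioms B.linear_map_bilift_left])

lemma cmul_zero_right: "u \<in> carrier (P d) \<Longrightarrow> cmul d e u \<zero>\<^bsub>P e\<^esub> = \<zero>\<^bsub>P (d + e)\<^esub>"
  by (rule linear_map_zero[OF S.C.module_axioms S.C.module_axioms B.linear_map_bilift_right])

lemma carrier_alg:
  "a \<in> carrier alg \<longleftrightarrow> (\<forall>d. a d \<in> carrier (P d)) \<and> finite {d. a d \<noteq> \<zero>\<^bsub>P d\<^esub>}"
  by (simp add: chi_algebra_def Let_def)

lemma alg_closed: "a \<in> carrier alg \<Longrightarrow> a d \<in> carrier (P d)"
  by (simp add: carrier_alg)

lemma add_alg: "a \<oplus>\<^bsub>alg\<^esub> b = (\<lambda>d. a d \<oplus>\<^bsub>P d\<^esub> b d)"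
  unfolding chi_algebra_def Let_def by (simp only: ring.simps monoid.simps)

lemma zero_alg: "\<zero>\<^bsub>alg\<^esub> = (\<lambda>d. \<zero>\<^bsub>P d\<^esub>)"
  unfolding chi_algebra_def Let_def by (simp only: ring.simps monoid.simps)

lemma one_alg: "\<one>\<^bsub>alg\<^esub> = (\<lambda>d. if d = 0 then word [] else \<zero>\<^bsub>P d\<^esub>)"
  unfolding chi_algebra_def Let_def by (simp only: ring.simps monoid.simps)

lemma mult_alg: "(a \<otimes>\<^bsub>alg\<^esub> b) n = (\<Oplus>\<^bsub>P n\<^esub>d \<in> {0..n}. cmul d (n - d) (a d) (b (n - d)))"
  unfolding chi_algebra_def Let_def by (simp only: ring.simps monoid.simps)

lemma abelian_group_alg: "abelian_group alg"
proof (rule abelian_groupI)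
  fix a b assume ab: "a \<in> carrier alg" "b \<in> carrier alg"
  have "{d. a d \<oplus>\<^bsub>P d\<^esub> b d \<noteq> \<zero>\<^bsub>P d\<^esub>} \<subseteq> {d. a d \<noteq> \<zero>\<^bsub>P d\<^esub>} \<union> {d. b d \<noteq> \<zero>\<^bsub>P d\<^esub>}"
    by auto
  with ab show "a \<oplus>\<^bsub>alg\<^esub> b \<in> carrier alg"
    by (auto simp: carrier_alg add_alg intro: finite_subset)
next
  fix a assume a: "a \<in> carrier alg"
  then have "finite {d. a d \<noteq> \<zero>\<^bsub>P d\<^esub>}"
    unfolding carrier_alg by blast
  moreover have "\<ominus>\<^bsub>P d\<^esub> a d = \<zero>\<^bsub>P d\<^esub>" if "a d = \<zero>\<^bsub>P d\<^esub>" for d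
    using that by simp
  then have "{d. \<ominus>\<^bsub>P d\<^esub> a d \<noteq> \<zero>\<^bsub>P d\<^esub>} \<subseteq> {d. a d \<noteq> \<zero>\<^bsub>P d\<^esub>}"
    by blast
  ultimately have "finite {d. \<ominus>\<^bsub>P d\<^esub> a d \<noteq> \<zero>\<^bsub>P d\<^esub>}"
    by (rule finite_subset[rotated])
  then have "(\<lambda>d. \<ominus>\<^bsub>P d\<^esub> a d) \<in> carrier alg"
    unfolding carrier_alg using alg_closed[OF a] by blast
  moreover have "(\<lambda>d. \<ominus>\<^bsub>P d\<^esub> a d) \<oplus>\<^bsub>alg\<^esub> a = \<zero>\<^bsub>alg\<^esub>"
    unfolding add_alg zero_alg using alg_closed[OF a] S.C.M.l_neg by blast
  ultimately show "\<exists>b\<in>carrier alg. b \<oplus>\<^bsub>alg\<^esub> a = \<zero>\<^bsub>alg\<^esub>"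
    by blast
qed (auto simp: carrier_alg add_alg zero_alg S.C.M.a_ac)

lemma cmul_term_closed:
  assumes "a \<in> carrier alg" "b \<in> carrier alg" "d \<le> n"
  shows "cmul d (n - d) (a d) (b (n - d)) \<in> carrier (P n)"
  using cmul_closed[OF alg_closed[OF assms(1)] alg_closed[OF assms(2)], of d "n - d"] assms(3)
  by simp

lemma mult_alg_closed:
  assumes a: "a \<in> carrier alg" and b: "b \<in> carrier alg"
  shows "a \<otimes>\<^bsub>alg\<^esub> b \<in> carrier alg"
proof -
  note [simp] = alg_closed[OF a] alg_closed[OF b]
  have "finite {d. a d \<noteq> \<zero>\<^bsub>P d\<^esub>}" "finite {d. b d \<noteq> \<zero>\<^bsub>P d\<^esub>}"
    using a b by (auto simp: carrier_alg)
  then obtain m k where mk: "\<And>d. a d \<noteq> \<zero>\<^bsub>P d\<^esub> \<Longrightarrow> d \<le> m" "\<And>d. b d \<noteq> \<zero>\<^bsub>P d\<^esub> \<Longrightarrow> d \<le> k"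
    by (auto simp: finite_nat_set_iff_bounded_le)
  have "(a \<otimes>\<^bsub>alg\<^esub> b) n = \<zero>\<^bsub>P n\<^esub>" if n: "m + k < n" for n
    unfolding mult_alg
  proof (rule S.C.M.add.finprod_one_eqI)
    fix d assume d: "d \<in> {0..n}"
    consider "m < d" | "k < n - d" using n by linarith
    then show "cmul d (n - d) (a d) (b (n - d)) = \<zero>\<^bsub>P n\<^esub>"
    proof cases
      case 1
      then have "a d = \<zero>\<^bsub>P d\<^esub>" using mk(1) by force
      then show ?thesis using b d cmul_zero_left[of "b (n - d)" "n - d" d] by simp
    next
      case 2
      then have "b (n - d) = \<zero>\<^bsub>P (n - d)\<^esub>" using mk(2) by force
      then show ?thesis using a d cmul_zero_right[of "a d" d "n - d"] by simp
    qed
  qed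
  then have "{n. (a \<otimes>\<^bsub>alg\<^esub> b) n \<noteq> \<zero>\<^bsub>P n\<^esub>} \<subseteq> {..m + k}"
    by (auto simp: not_less[symmetric])
  moreover have "(a \<otimes>\<^bsub>alg\<^esub> b) n \<in> carrier (P n)" for n
    unfolding mult_alg using cmul_term_closed[OF a b] by (intro S.C.M.finsum_closed) auto
  ultimately show ?thesis
    by (auto simp: carrier_alg intro: finite_subset)
qed

lemma one_alg_closed: "\<one>\<^bsub>alg\<^esub> \<in> carrier alg"
proof -
  have "{d. \<one>\<^bsub>alg\<^esub> d \<noteq> \<zero>\<^bsub>P d\<^esub>} \<subseteq> {0}"
    by (auto simp: one_alg)
  then show ?thesis
    using S.word_closed[OF words_0] by (auto simp: carrier_alg one_alg intro: finite_subset)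
qed

lemma mult_alg_assoc:
  assumes a: "a \<in> carrier alg" and b: "b \<in> carrier alg" and c: "c \<in> carrier alg"
  shows "a \<otimes>\<^bsub>alg\<^esub> b \<otimes>\<^bsub>alg\<^esub> c = a \<otimes>\<^bsub>alg\<^esub> (b \<otimes>\<^bsub>alg\<^esub> c)"
proof
  note [simp] = alg_closed[OF a] alg_closed[OF b] alg_closed[OF c]
  fix n
  \<comment> \<open>The summand of the product bracketed to the right. By \<open>cmul_assoc\<close>
    the product bracketed to the left sums the same terms by diagonals.\<close>
  define g where "g i j = cmul i (n - i) (a i) (cmul j (n - i - j) (b j) (c (n - i - j)))" for i j
  have g: "g i j \<in> carrier (P n)" if "i + j \<le> n" for i j
  proof -
    have "cmul j (n - i - j) (b j) (c (n - i - j)) \<in> carrier (P (n - i))"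
      using that by (intro cmul_term_closed b c) simp
    then show ?thesis
      using that a cmul_closed[of "a i" i _ "n - i"] by (simp add: g_def)
  qed
  have "(a \<otimes>\<^bsub>alg\<^esub> b \<otimes>\<^bsub>alg\<^esub> c) n = (\<Oplus>\<^bsub>P n\<^esub>d \<in> {0..n}. \<Oplus>\<^bsub>P n\<^esub>i \<in> {0..d}. g i (d - i))"
    unfolding mult_alg[of "a \<otimes>\<^bsub>alg\<^esub> b"]
  proof (rule S.C.M.finsum_cong'[OF refl])
    fix d assume d: "d \<in> {0..n}"
    have "linear_map K (P d) (P n) (\<lambda>u. cmul d (n - d) u (c (n - d)))"
      using B.linear_map_bilift_left[of "c (n - d)" "n - d" d] c d by simp
    then have "cmul d (n - d) ((a \<otimes>\<^bsub>alg\<^esub> b) d) (c (n - d)) =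
        (\<Oplus>\<^bsub>P n\<^esub>i \<in> {0..d}. cmul d (n - d) (cmul i (d - i) (a i) (b (d - i))) (c (n - d)))"
      unfolding mult_alg using cmul_term_closed[OF a b]
      by (intro linear_map_finsum[OF S.C.module_axioms S.C.module_axioms]) auto
    also have "\<dots> = (\<Oplus>\<^bsub>P n\<^esub>i \<in> {0..d}. g i (d - i))"
    proof (rule S.C.M.finsum_cong'[OF refl])
      fix i assume i: "i \<in> {0..d}"
      then have "n - i - (d - i) = n - d" "d - i + (n - d) = n - i" "i + (d - i) = d" using d by auto
      then show "cmul d (n - d) (cmul i (d - i) (a i) (b (d - i))) (c (n - d)) = g i (d - i)"
        using cmul_assoc[of "a i" i "b (d - i)" "d - i" "c (n - d)" "n - d"] a b c
        by (simp add: g_def)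
    qed (use g d in auto)
    finally show "cmul d (n - d) ((a \<otimes>\<^bsub>alg\<^esub> b) d) (c (n - d)) = (\<Oplus>\<^bsub>P n\<^esub>i \<in> {0..d}. g i (d - i))" .
  qed (use g in \<open>auto intro!: S.C.M.finsum_closed\<close>)
  also have "\<dots> = (\<Oplus>\<^bsub>P n\<^esub>i \<in> {0..n}. \<Oplus>\<^bsub>P n\<^esub>j \<in> {0..n - i}. g i j)"
    by (rule S.C.M.finsum_triangle) (rule g)
  also have "\<dots> = (a \<otimes>\<^bsub>alg\<^esub> (b \<otimes>\<^bsub>alg\<^esub> c)) n"
    unfolding mult_alg[of a]
  proof (rule S.C.M.finsum_cong'[OF refl])
    fix i assume i: "i \<in> {0..n}"
    have "linear_map K (P (n - i)) (P n) (cmul i (n - i) (a i))"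
      using B.linear_map_bilift_right[of "a i" i "n - i"] a i by simp
    then show "(\<Oplus>\<^bsub>P n\<^esub>j \<in> {0..n - i}. g i j) = cmul i (n - i) (a i) ((b \<otimes>\<^bsub>alg\<^esub> c) (n - i))"
      unfolding mult_alg g_def using cmul_term_closed[OF b c]
      by (intro linear_map_finsum[OF S.C.module_axioms S.C.module_axioms, symmetric]) (auto simp del: diff_diff_left)
  qed (use cmul_term_closed[OF a mult_alg_closed[OF b c]] in auto)
  finally show "(a \<otimes>\<^bsub>alg\<^esub> b \<otimes>\<^bsub>alg\<^esub> c) n = (a \<otimes>\<^bsub>alg\<^esub> (b \<otimes>\<^bsub>alg\<^esub> c)) n" .
qed

lemma one_alg_left:
  assumes a: "a \<in> carrier alg"
  shows "\<one>\<^bsub>alg\<^esub> \<otimes>\<^bsub>alg\<^esub> a = a"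
proof
  note [simp] = alg_closed[OF a]
  fix n
  have "(\<one>\<^bsub>alg\<^esub> \<otimes>\<^bsub>alg\<^esub> a) n = (\<Oplus>\<^bsub>P n\<^esub>d \<in> {0::nat}. a n)"
    unfolding mult_alg
  proof (rule S.C.M.add.finprod_mono_neutral_cong_right)
    fix d assume "d \<in> {0..n} - {0}"
    then show "cmul d (n - d) (\<one>\<^bsub>alg\<^esub> d) (a (n - d)) = \<zero>\<^bsub>P n\<^esub>"
      using a cmul_zero_left[of "a (n - d)" "n - d" d] by (simp add: one_alg)
  qed (use a cmul_term_closed[OF one_alg_closed a] in \<open>auto simp: one_alg cmul_one_left\<close>)
  then show "(\<one>\<^bsub>alg\<^esub> \<otimes>\<^bsub>alg\<^esub> a) n = a n"
    using a by (simp add: S.C.M.finsum_insert S.C.M.finsum_empty)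
qed

lemma one_alg_right:
  assumes a: "a \<in> carrier alg"
  shows "a \<otimes>\<^bsub>alg\<^esub> \<one>\<^bsub>alg\<^esub> = a"
proof
  note [simp] = alg_closed[OF a]
  fix n
  have "(a \<otimes>\<^bsub>alg\<^esub> \<one>\<^bsub>alg\<^esub>) n = (\<Oplus>\<^bsub>P n\<^esub>d \<in> {n}. a n)"
    unfolding mult_alg
  proof (rule S.C.M.add.finprod_mono_neutral_cong_right)
    fix d assume "d \<in> {0..n} - {n}"
    then show "cmul d (n - d) (a d) (\<one>\<^bsub>alg\<^esub> (n - d)) = \<zero>\<^bsub>P n\<^esub>"
      using a cmul_zero_right[of "a d" d "n - d"] by (simp add: one_alg)
  qed (use a cmul_term_closed[OF a one_alg_closed] in \<open>auto simp: one_alg cmul_one_right\<close>)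
  then show "(a \<otimes>\<^bsub>alg\<^esub> \<one>\<^bsub>alg\<^esub>) n = a n"
    using a by (simp add: S.C.M.finsum_insert S.C.M.finsum_empty)
qed

lemma alg_l_distr:
  assumes a: "a \<in> carrier alg" and b: "b \<in> carrier alg" and c: "c \<in> carrier alg"
  shows "(a \<oplus>\<^bsub>alg\<^esub> b) \<otimes>\<^bsub>alg\<^esub> c = a \<otimes>\<^bsub>alg\<^esub> c \<oplus>\<^bsub>alg\<^esub> b \<otimes>\<^bsub>alg\<^esub> c"
proof
  note [simp] = alg_closed[OF a] alg_closed[OF b] alg_closed[OF c]
  fix n
  have "((a \<oplus>\<^bsub>alg\<^esub> b) \<otimes>\<^bsub>alg\<^esub> c) n =
      (\<Oplus>\<^bsub>P n\<^esub>d \<in> {0..n}. cmul d (n - d) (a d) (c (n - d)) \<oplus>\<^bsub>P n\<^esub> cmul d (n - d) (b d) (c (n - d)))"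
    unfolding mult_alg
  proof (rule S.C.M.finsum_cong'[OF refl])
    fix d assume "d \<in> {0..n}"
    then show "cmul d (n - d) ((a \<oplus>\<^bsub>alg\<^esub> b) d) (c (n - d)) =
        cmul d (n - d) (a d) (c (n - d)) \<oplus>\<^bsub>P n\<^esub> cmul d (n - d) (b d) (c (n - d))"
      using linear_mapD(2)[OF B.linear_map_bilift_left[of "c (n - d)" "n - d" d], of "a d" "b d"] a b c
      by (simp add: add_alg)
  qed (use cmul_term_closed[OF a c] cmul_term_closed[OF b c] in auto)
  also have "\<dots> = (a \<otimes>\<^bsub>alg\<^esub> c \<oplus>\<^bsub>alg\<^esub> b \<otimes>\<^bsub>alg\<^esub> c) n"
    unfolding add_alg mult_alg using cmul_term_closed[OF a c] cmul_term_closed[OF b c]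
    by (intro S.C.M.finsum_addf) auto
  finally show "((a \<oplus>\<^bsub>alg\<^esub> b) \<otimes>\<^bsub>alg\<^esub> c) n = (a \<otimes>\<^bsub>alg\<^esub> c \<oplus>\<^bsub>alg\<^esub> b \<otimes>\<^bsub>alg\<^esub> c) n" .
qed

lemma alg_r_distr:
  assumes a: "a \<in> carrier alg" and b: "b \<in> carrier alg" and c: "c \<in> carrier alg"
  shows "c \<otimes>\<^bsub>alg\<^esub> (a \<oplus>\<^bsub>alg\<^esub> b) = c \<otimes>\<^bsub>alg\<^esub> a \<oplus>\<^bsub>alg\<^esub> c \<otimes>\<^bsub>alg\<^esub> b"
proof
  note [simp] = alg_closed[OF a] alg_closed[OF b] alg_closed[OF c]
  fix n
  have "(c \<otimes>\<^bsub>alg\<^esub> (a \<oplus>\<^bsub>alg\<^esub> b)) n =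
      (\<Oplus>\<^bsub>P n\<^esub>d \<in> {0..n}. cmul d (n - d) (c d) (a (n - d)) \<oplus>\<^bsub>P n\<^esub> cmul d (n - d) (c d) (b (n - d)))"
    unfolding mult_alg
  proof (rule S.C.M.finsum_cong'[OF refl])
    fix d assume "d \<in> {0..n}"
    then show "cmul d (n - d) (c d) ((a \<oplus>\<^bsub>alg\<^esub> b) (n - d)) =
        cmul d (n - d) (c d) (a (n - d)) \<oplus>\<^bsub>P n\<^esub> cmul d (n - d) (c d) (b (n - d))"
      using linear_mapD(2)[OF B.linear_map_bilift_right[of "c d" d "n - d"], of "a (n - d)" "b (n - d)"] a b c
      by (simp add: add_alg)
  qed (use cmul_term_closed[OF c a] cmul_term_closed[OF c b] in auto)
  also have "\<dots> = (c \<otimes>\<^bsub>alg\<^esub> a \<oplus>\<^bsub>alg\<^esub> c \<otimes>\<^bsub>alg\<^esub> b) n"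
    unfolding add_alg mult_alg using cmul_term_closed[OF c a] cmul_term_closed[OF c b]
    by (intro S.C.M.finsum_addf) auto
  finally show "(c \<otimes>\<^bsub>alg\<^esub> (a \<oplus>\<^bsub>alg\<^esub> b)) n = (c \<otimes>\<^bsub>alg\<^esub> a \<oplus>\<^bsub>alg\<^esub> c \<otimes>\<^bsub>alg\<^esub> b) n" .
qed

lemma ring_alg: "ring alg"
  by (intro ringI abelian_group_alg monoidI mult_alg_closed one_alg_closed mult_alg_assoc
      one_alg_left one_alg_right alg_l_distr alg_r_distr)

end

section \<open>Non-singularity of the pairing\<close>

lemma (in abelian_monoid) finsum_swap:
  assumes "finite A" "finite B" "\<And>i j. i \<in> A \<Longrightarrow> j \<in> B \<Longrightarrow> g i j \<in> carrier G"
  shows "(\<Oplus>i \<in> A. \<Oplus>j \<in> B. g i j) = (\<Oplus>j \<in> B. \<Oplus>i \<in> A. g i j)"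
  using assms(1,3)
proof (induction A)
  case empty
  then show ?case by (simp add: finsum_zero finsum_empty)
next
  case (insert i A)
  have "(\<Oplus>k \<in> insert i A. \<Oplus>j \<in> B. g k j) = (\<Oplus>j \<in> B. g i j) \<oplus> (\<Oplus>j \<in> B. \<Oplus>k \<in> A. g k j)"
    using insert by (subst finsum_insert) (auto intro!: finsum_closed)
  also have "\<dots> = (\<Oplus>j \<in> B. g i j \<oplus> (\<Oplus>k \<in> A. g k j))"
    using insert by (intro finsum_addf[symmetric]) (auto intro!: finsum_closed)
  also have "\<dots> = (\<Oplus>j \<in> B. \<Oplus>k \<in> insert i A. g k j)"
    using insert by (intro finsum_cong') (auto simp: Pi_iff finsum_insert intro!: finsum_closed)
  finally show ?case .
qed

definition index_words :: "'i set \<Rightarrow> nat \<Rightarrow> 'i list set" where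
  "index_words I n = {is. length is = n \<and> set is \<subseteq> I}"

lemma finite_index_words: "finite I \<Longrightarrow> finite (index_words I n)"
  using finite_lists_length_eq[of I n] by (simp add: index_words_def conj_commute)

lemma index_words_0: "index_words I 0 = {[]}"
  by (auto simp: index_words_def)

lemma index_words_Suc: "index_words I (Suc n) = (\<Union>i \<in> I. Cons i ` index_words I n)"
  by (auto simp: index_words_def length_Suc_conv)

lemma (in abelian_monoid) finsum_index_words_Suc:
  assumes "finite I" "\<And>is. is \<in> index_words I (Suc n) \<Longrightarrow> g is \<in> carrier G"
  shows "(\<Oplus>is \<in> index_words I (Suc n). g is) = (\<Oplus>i \<in> I. \<Oplus>is \<in> index_words I n. g (i # is))"
proof -
  have c: "g (i # is) \<in> carrier G" if "i \<in> I" "is \<in> index_words I n" for i "is"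
    using that by (intro assms(2)) (auto simp: index_words_Suc)
  have "(\<Oplus>is \<in> index_words I (Suc n). g is) = (\<Oplus>i \<in> I. finsum G g (Cons i ` index_words I n))"
    unfolding index_words_Suc
    by (rule add.finprod_UN_disjoint) (use assms(1) c in \<open>auto simp: finite_index_words pairwise_def disjnt_def\<close>)
  also have "\<dots> = (\<Oplus>i \<in> I. \<Oplus>is \<in> index_words I n. g (i # is))"
  proof (rule finsum_cong'[OF refl])
    fix i assume i: "i \<in> I"
    show "finsum G g (Cons i ` index_words I n) = (\<Oplus>is \<in> index_words I n. g (i # is))"
      by (rule finsum_reindex) (use c i in auto)
  qed (use c in \<open>auto intro!: finsum_closed\<close>)
  finally show ?thesis .
qed

lemma (in cring) finprod_insert_nat:
  assumes "\<And>t. t \<le> n \<Longrightarrow> f t \<in> carrier R"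
  shows "(\<Otimes>t \<in> {..<Suc n}. f t) = f 0 \<otimes> (\<Otimes>t \<in> {..<n}. f (Suc t))"
proof -
  have "(\<Otimes>t \<in> {..<Suc n}. f t) = (\<Otimes>t \<in> insert 0 (Suc ` {..<n}). f t)"
    by (intro arg_cong[where f = "finprod R f"]) (auto simp: lessThan_Suc_eq_insert_0)
  also have "\<dots> = f 0 \<otimes> (\<Otimes>t \<in> Suc ` {..<n}. f t)"
    using assms by (intro finprod_insert) auto
  also have "(\<Otimes>t \<in> Suc ` {..<n}. f t) = (\<Otimes>t \<in> {..<n}. f (Suc t))"
    using assms by (intro finprod_reindex) auto
  finally show ?thesis .
qed

text \<open>The averaging argument works with expansions alone, so a finite frame with coordinate
  functions stands in for a basis on either side.\<close>

locale coordinates = module K E for K (structure) and E :: "('k, 'e, 's) module_scheme" +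
  fixes I :: "'i set" and e :: "'i \<Rightarrow> 'e" and c :: "'i \<Rightarrow> 'e \<Rightarrow> 'k"
  assumes fin: "finite I"
    and e_closed: "i \<in> I \<Longrightarrow> e i \<in> carrier E"
    and c_closed: "i \<in> I \<Longrightarrow> x \<in> carrier E \<Longrightarrow> c i x \<in> carrier K"
    and expand: "x \<in> carrier E \<Longrightarrow> x = (\<Oplus>\<^bsub>E\<^esub>i \<in> I. c i x \<odot>\<^bsub>E\<^esub> e i)"
begin

lemma map_words: "is \<in> index_words I n \<Longrightarrow> map e is \<in> words E n"
  by (auto simp: index_words_def words_def e_closed)

lemma coeff_closed:
  assumes "is \<in> index_words I n" "xs \<in> words E n"
  shows "(\<Otimes>t \<in> {..<n}. c (is ! t) (xs ! t)) \<in> carrier K"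
proof (rule R.finprod_closed, rule)
  fix t assume "t \<in> {..<n}"
  then have "is ! t \<in> I" "xs ! t \<in> carrier E"
    using assms by (auto simp: index_words_def words_def subset_eq)
  then show "c (is ! t) (xs ! t) \<in> carrier K" by (rule c_closed)
qed

text \<open>The expansion proceeds letter by letter from the left, and the frame elements already
  chosen accumulate in the prefix \<open>us\<close>; the induction needs \<open>us\<close> and
  \<open>m\<close> general.\<close>

lemma multilinear_expand_suffix:
  assumes M: "module K M" and ml: "multilinear K E (m + n) M \<phi>"
    and us: "us \<in> words E m" and xs: "xs \<in> words E n"
  shows "\<phi> (us @ xs) = (\<Oplus>\<^bsub>M\<^esub>is \<in> index_words I n.
    (\<Otimes>t \<in> {..<n}. c (is ! t) (xs ! t)) \<odot>\<^bsub>M\<^esub> \<phi> (us @ map e is))"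
  using ml us xs
proof (induction n arbitrary: m us xs)
  case 0
  interpret M: module K M by fact
  have "\<phi> us \<in> carrier M" using 0 by (auto simp: multilinear_def)
  then show ?case
    using 0 by (simp add: index_words_0 words_def M.finsum_insert M.finsum_empty)
next
  case (Suc n)
  interpret M: module K M by fact
  from Suc.prems(3) obtain x ys where xs: "xs = x # ys" "x \<in> carrier E" "ys \<in> words E n"
    by (auto simp: words_def length_Suc_conv)
  let ?c = "\<lambda>n is xs. \<Otimes>t \<in> {..<n}. c (is ! t) (xs ! t)"
  have w: "us @ y # zs \<in> words E (m + Suc n)" if "y \<in> carrier E" "zs \<in> words E n" for y zs
    using that Suc.prems(2) by (auto simp: words_def)
  have \<phi>: "\<phi> zs \<in> carrier M" if "zs \<in> words E (m + Suc n)" for zs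
    using Suc.prems(1) that by (auto simp: multilinear_def)
  have "linear_map K E M (\<lambda>y. \<phi> ((us @ x # ys)[m := y]))"
    using Suc.prems(1) w[OF xs(2,3)] by (auto simp: multilinear_def)
  moreover have "(us @ x # ys)[m := y] = us @ y # ys" for y
    using list_update_length[of us x ys y] words_length[OF Suc.prems(2)] by simp
  ultimately have lin: "linear_map K E M (\<lambda>y. \<phi> (us @ y # ys))" by simp
  have IH: "\<phi> (us @ e i # ys) = (\<Oplus>\<^bsub>M\<^esub>is \<in> index_words I n.
      ?c n is ys \<odot>\<^bsub>M\<^esub> \<phi> (us @ e i # map e is))" if "i \<in> I" for i
    using Suc.IH[of "Suc m" "us @ [e i]" ys] Suc.prems(1,2) xs(3) e_closed[OF that]
    by (simp add: words_def)
  have t: "c i x \<odot>\<^bsub>M\<^esub> (?c n is ys \<odot>\<^bsub>M\<^esub> \<phi> (us @ e i # map e is)) =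
      ?c (Suc n) (i # is) xs \<odot>\<^bsub>M\<^esub> \<phi> (us @ map e (i # is))"
    if "i \<in> I" "is \<in> index_words I n" for i "is"
  proof -
    have "?c (Suc n) (i # is) xs = c i x \<otimes> ?c n is ys"
    proof (subst R.finprod_insert_nat)
      fix t assume "t \<le> n"
      then have "(i # is) ! t \<in> I" "xs ! t \<in> carrier E"
        using that xs by (auto simp: index_words_def words_def nth_Cons' subset_eq)
      then show "c ((i # is) ! t) (xs ! t) \<in> carrier K" by (rule c_closed)
    qed (simp add: xs)
    then show ?thesis
      using that c_closed[OF that(1) xs(2)] coeff_closed[OF that(2) xs(3)]
        \<phi>[OF w[OF e_closed[OF that(1)] map_words[OF that(2)]]]
      by (simp add: M.smult_assoc1)
  qed
  have tc: "c i x \<odot>\<^bsub>M\<^esub> (?c n is ys \<odot>\<^bsub>M\<^esub> \<phi> (us @ e i # map e is)) \<in> carrier M"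
      "?c n is ys \<odot>\<^bsub>M\<^esub> \<phi> (us @ e i # map e is) \<in> carrier M"
    if "i \<in> I" "is \<in> index_words I n" for i "is"
    using that c_closed[OF that(1) xs(2)] coeff_closed[OF that(2) xs(3)]
        \<phi>[OF w[OF e_closed[OF that(1)] map_words[OF that(2)]]] by auto
  have "\<phi> (us @ xs) = \<phi> (us @ (\<Oplus>\<^bsub>E\<^esub>i \<in> I. c i x \<odot>\<^bsub>E\<^esub> e i) # ys)"
    using expand[OF xs(2)] by (simp add: xs(1))
  also have "\<dots> = (\<Oplus>\<^bsub>M\<^esub>i \<in> I. \<phi> (us @ (c i x \<odot>\<^bsub>E\<^esub> e i) # ys))"
    using c_closed xs(2) e_closed
    by (intro linear_map_finsum[OF module_axioms M lin]) auto
  also have "\<dots> = (\<Oplus>\<^bsub>M\<^esub>i \<in> I. \<Oplus>\<^bsub>M\<^esub>is \<in> index_words I n.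
      c i x \<odot>\<^bsub>M\<^esub> (?c n is ys \<odot>\<^bsub>M\<^esub> \<phi> (us @ e i # map e is)))"
  proof (rule M.finsum_cong'[OF refl])
    fix i assume i: "i \<in> I"
    have "\<phi> (us @ (c i x \<odot>\<^bsub>E\<^esub> e i) # ys) = c i x \<odot>\<^bsub>M\<^esub> \<phi> (us @ e i # ys)"
      by (rule linear_mapD(3)[OF lin c_closed[OF i xs(2)] e_closed[OF i]])
    also have "\<dots> = (\<Oplus>\<^bsub>M\<^esub>is \<in> index_words I n.
      c i x \<odot>\<^bsub>M\<^esub> (?c n is ys \<odot>\<^bsub>M\<^esub> \<phi> (us @ e i # map e is)))"
      unfolding IH[OF i]
      using tc(2)[OF i] by (intro M.finsum_smult_ldistr finite_index_words fin c_closed i xs(2)) auto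
    finally show "\<phi> (us @ (c i x \<odot>\<^bsub>E\<^esub> e i) # ys) = (\<Oplus>\<^bsub>M\<^esub>is \<in> index_words I n.
      c i x \<odot>\<^bsub>M\<^esub> (?c n is ys \<odot>\<^bsub>M\<^esub> \<phi> (us @ e i # map e is)))" .
  qed (use tc(1) in \<open>auto intro!: M.finsum_closed\<close>)
  also have "\<dots> = (\<Oplus>\<^bsub>M\<^esub>i \<in> I. \<Oplus>\<^bsub>M\<^esub>is \<in> index_words I n.
      ?c (Suc n) (i # is) xs \<odot>\<^bsub>M\<^esub> \<phi> (us @ map e (i # is)))"
    using t tc(1) by (auto intro!: M.finsum_cong' M.finsum_closed)
  also have "\<dots> = (\<Oplus>\<^bsub>M\<^esub>is \<in> index_words I (Suc n). ?c (Suc n) is xs \<odot>\<^bsub>M\<^esub> \<phi> (us @ map e is))"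
  proof (rule M.finsum_index_words_Suc[symmetric, OF fin])
    fix "is" assume i: "is \<in> index_words I (Suc n)"
    have "us @ map e is \<in> words E (m + Suc n)"
      by (rule words_append[OF Suc.prems(2) map_words[OF i]])
    then show "?c (Suc n) is xs \<odot>\<^bsub>M\<^esub> \<phi> (us @ map e is) \<in> carrier M"
      using coeff_closed[OF i Suc.prems(3)] \<phi> by auto
  qed
  finally show ?case .
qed

lemma multilinear_expand:
  assumes "module K M" "multilinear K E n M \<phi>" "xs \<in> words E n"
  shows "\<phi> xs = (\<Oplus>\<^bsub>M\<^esub>is \<in> index_words I n.
    (\<Otimes>t \<in> {..<n}. c (is ! t) (xs ! t)) \<odot>\<^bsub>M\<^esub> \<phi> (map e is))"
  using multilinear_expand_suffix[of M 0 n \<phi> "[]" xs] assms by (simp add: words_def)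

end

lemma self_module_simps [simp]:
  "carrier (self_module K) = carrier K" "\<zero>\<^bsub>self_module K\<^esub> = \<zero>\<^bsub>K\<^esub>"
  "x \<oplus>\<^bsub>self_module K\<^esub> y = x \<oplus>\<^bsub>K\<^esub> y" "k \<odot>\<^bsub>self_module K\<^esub> x = k \<otimes>\<^bsub>K\<^esub> x"
  by (simp_all add: self_module_def)

lemma finsum_self_module [simp]: "finsum (self_module K) f A = finsum K f A"
  by (simp add: finsum_def finprod_def self_module_def)

lemma (in cring) module_self: "module R (self_module R)"
proof (rule moduleI)
  show "abelian_group (self_module R)"
    by (rule abelian_groupI) (auto simp: a_ac intro: exI l_neg)
qed (auto simp: l_distr r_distr m_assoc is_cring)

lemma (in module) linear_map_scalar:
  "x \<in> carrier M \<Longrightarrow> linear_map R (self_module R) M (\<lambda>k. k \<odot>\<^bsub>M\<^esub> x)"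
  by (rule linear_mapI) (simp_all add: smult_l_distr smult_assoc1)

lemma (in module) finsum_smult_rdistr:
  assumes "f \<in> A \<rightarrow> carrier R" "x \<in> carrier M"
  shows "(\<Oplus>i \<in> A. f i) \<odot>\<^bsub>M\<^esub> x = (\<Oplus>\<^bsub>M\<^esub>i \<in> A. f i \<odot>\<^bsub>M\<^esub> x)"
  using linear_map_finsum[OF R.module_self module_axioms linear_map_scalar[OF assms(2)], of f A] assms(1)
  by simp

lemma multilinear_sum:
  assumes "module K E" "module K M" "\<And>p. p \<in> A \<Longrightarrow> k p \<in> carrier K" "\<And>p. p \<in> A \<Longrightarrow> multilinear K E d M (\<phi> p)"
  shows "multilinear K E d M (\<lambda>xs. \<Oplus>\<^bsub>M\<^esub>p \<in> A. k p \<odot>\<^bsub>M\<^esub> \<phi> p xs)"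
  unfolding multilinear_def
proof (intro conjI ballI allI impI)
  interpret M: module K M by fact
  show "(\<lambda>xs. \<Oplus>\<^bsub>M\<^esub>p \<in> A. k p \<odot>\<^bsub>M\<^esub> \<phi> p xs) \<in> words E d \<rightarrow> carrier M"
    using assms(3,4) by (auto simp: multilinear_def Pi_iff intro!: M.finsum_closed)
  fix xs i assume "xs \<in> words E d" "i < d"
  then show "linear_map K E M (\<lambda>x. \<Oplus>\<^bsub>M\<^esub>p \<in> A. k p \<odot>\<^bsub>M\<^esub> \<phi> p (xs[i := x]))"
    using assms(3,4) by (intro linear_map_sum linear_map_smult assms(1,2)) (auto simp: multilinear_def)
qed

context character_sequence
begin

text \<open>The group and character in degree \<open>d\<close>, made trivial for \<open>d = 0\<close>, where \<^term>\<open>W 0\<close> and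
  \<^term>\<open>\<chi> 0\<close> are arbitrary.\<close>

definition grp :: "nat \<Rightarrow> (nat \<Rightarrow> nat) set" where
  "grp d = (if d = 0 then {id} else W d)"

definition chr :: "nat \<Rightarrow> (nat \<Rightarrow> nat) \<Rightarrow> 'k" where
  "chr d p = (if d = 0 then \<one> else \<chi> d p)"

lemma grp_permutes: "p \<in> grp d \<Longrightarrow> p permutes {1..d}"
  using W_permutes[of d p] by (cases "d = 0") (auto simp: grp_def permutes_id)

lemma grp_id: "id \<in> grp d"
  using W_id[of d] by (simp add: grp_def)

lemma grp_comp: "p \<in> grp d \<Longrightarrow> q \<in> grp d \<Longrightarrow> p \<circ> q \<in> grp d"
  using W_comp[of d p q] by (auto simp: grp_def split: if_splits)

lemma grp_inv: "p \<in> grp d \<Longrightarrow> Hilbert_Choice.inv p \<in> grp d"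
  using W_inv[of d p] by (auto simp: grp_def split: if_splits)

lemma finite_grp: "finite (grp d)"
  using finite_W[of d] by (simp add: grp_def)

lemma chr_Units: "p \<in> grp d \<Longrightarrow> chr d p \<in> Units K"
  using \<chi>_Units[of d p] by (simp add: grp_def chr_def split: if_splits)

lemma chr_closed: "p \<in> grp d \<Longrightarrow> chr d p \<in> carrier K"
  by (rule Units_closed[OF chr_Units])

lemma chr_comp: "p \<in> grp d \<Longrightarrow> q \<in> grp d \<Longrightarrow> chr d (p \<circ> q) = chr d p \<otimes> chr d q"
  using \<chi>_comp[of d p q] by (simp add: grp_def chr_def split: if_splits)

lemma chr_inv: "p \<in> grp d \<Longrightarrow> chr d (Hilbert_Choice.inv p) = inv (chr d p)"
  using \<chi>_inv[of d p] by (simp add: grp_def chr_def split: if_splits)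

lemma chi_multilinear_iff:
  assumes "module K M"
  shows "chi_multilinear K W \<chi> E d M \<phi> \<longleftrightarrow> multilinear K E d M \<phi> \<and>
    (\<forall>p \<in> grp d. \<forall>xs \<in> words E d. \<phi> (permute_word p xs) = inv (chr d p) \<odot>\<^bsub>M\<^esub> \<phi> xs)"
proof -
  interpret M: module K M by fact
  show ?thesis
    by (cases "d = 0") (auto simp: chi_multilinear_def grp_def chr_def multilinear_def Pi_iff)
qed

lemma grp_translate:
  assumes "q \<in> grp d"
  shows "(\<lambda>p. p \<circ> q) ` grp d = grp d" "inj_on (\<lambda>p. p \<circ> q) (grp d)"
proof -
  have *: "q \<circ> Hilbert_Choice.inv q = id" "Hilbert_Choice.inv q \<circ> q = id"
    using permutes_inv_o[OF grp_permutes[OF assms]] by auto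
  show "inj_on (\<lambda>p. p \<circ> q) (grp d)"
    by (rule inj_on_inverseI[where g = "\<lambda>p. p \<circ> Hilbert_Choice.inv q"]) (simp add: comp_assoc *)
  have "p \<in> (\<lambda>p. p \<circ> q) ` grp d" if "p \<in> grp d" for p
    using grp_comp[OF that grp_inv[OF assms]]
    by (rule rev_image_eqI) (simp add: comp_assoc *)
  then show "(\<lambda>p. p \<circ> q) ` grp d = grp d"
    using grp_comp[OF _ assms] by blast
qed

lemma grp_invert:
  "Hilbert_Choice.inv ` grp d = grp d" "inj_on Hilbert_Choice.inv (grp d)"
proof -
  have *: "Hilbert_Choice.inv (Hilbert_Choice.inv p) = p" if "p \<in> grp d" for p
    using permutes_inv_inv[OF grp_permutes[OF that]] .
  show "inj_on Hilbert_Choice.inv (grp d)"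
    by (rule inj_on_inverseI[where g = Hilbert_Choice.inv]) (rule *)
  show "Hilbert_Choice.inv ` grp d = grp d"
    using * grp_inv by (force intro: rev_image_eqI)
qed

end

lemma (in chi_space) chi_multilinear_cong:
  assumes M: "module K M" and \<phi>: "chi_multilinear K W \<chi> E d M \<phi>"
    and eq: "\<And>xs. xs \<in> words E d \<Longrightarrow> \<psi> xs = \<phi> xs"
  shows "chi_multilinear K W \<chi> E d M \<psi>"
proof -
  have "linear_map K E M (\<lambda>x. \<psi> (xs[i := x]))" if "xs \<in> words E d" "i < d" for xs i
  proof (rule linear_map_cong[OF module_axioms])
    show "linear_map K E M (\<lambda>x. \<phi> (xs[i := x]))"
      using \<phi> that by (simp add: chi_multilinear_def multilinear_def)
  qed (rule eq[OF words_update[OF that(1)]])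
  with \<phi> show ?thesis
    by (simp add: chi_multilinear_iff[OF M] multilinear_def Pi_iff eq
        permute_word_words[OF grp_permutes])
qed

text \<open>An abstract bilinear \<open>b\<close> replaces evaluation of functionals, so that
  \<open>E\<close> and \<open>E'\<close> can exchange roles and dual-side facts become left-side
  facts of the swapped pairing. The bidual never appears.\<close>

locale pairing = character_sequence K W \<chi> + left: module K E + right: module K E'
  for K :: "('k, 'r) ring_scheme" (structure) and W and \<chi>
    and E :: "('k, 'e, 's) module_scheme" and E' :: "('k, 'f, 't) module_scheme" +
  fixes b :: "'e \<Rightarrow> 'f \<Rightarrow> 'k"
  assumes b_left: "y \<in> carrier E' \<Longrightarrow> linear_map K E (self_module K) (\<lambda>x. b x y)"
    and b_right: "x \<in> carrier E \<Longrightarrow> linear_map K E' (self_module K) (b x)"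
begin

lemma b_closed: "x \<in> carrier E \<Longrightarrow> y \<in> carrier E' \<Longrightarrow> b x y \<in> carrier K"
  using linear_mapD(1)[OF b_right] by simp

lemma chr_inv_eq: "p \<in> grp d \<Longrightarrow> inv (chr d p) = chr d p"
  using \<chi>_square[of d p] chr_closed[of p d]
  by (intro comm_inv_char) (auto simp: grp_def chr_def split: if_splits)

definition ev where
  "ev d xs ys = (\<Otimes>t \<in> {..<d}. b (xs ! t) (ys ! t))"

text \<open>\<open>word_pairing\<close> in a form fit for substitution: the permutation acts on the
  word, positions count from 0, and \<open>grp\<close> covers degree 0.\<close>

definition pair where
  "pair d xs ys = (\<Oplus>p \<in> grp d. chr d p \<otimes> ev d (permute_word p xs) ys)"

lemma ev_closed: "xs \<in> words E d \<Longrightarrow> ys \<in> words E' d \<Longrightarrow> ev d xs ys \<in> carrier K"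
  unfolding ev_def by (intro finprod_closed) (auto intro!: b_closed words_nth)

lemma term_closed:
  "xs \<in> words E d \<Longrightarrow> ys \<in> words E' d \<Longrightarrow> p \<in> grp d \<Longrightarrow>
    chr d p \<otimes> ev d (permute_word p xs) ys \<in> carrier K"
  by (intro m_closed chr_closed ev_closed permute_word_words grp_permutes)

lemma multilinear_ev:
  assumes ys: "ys \<in> words E' d"
  shows "multilinear K E d (self_module K) (\<lambda>xs. ev d xs ys)"
  unfolding multilinear_def
proof (intro conjI ballI allI impI)
  show "(\<lambda>xs. ev d xs ys) \<in> words E d \<rightarrow> carrier (self_module K)"
    using ev_closed[OF _ ys] by simp
  fix xs i assume xs: "xs \<in> words E d" and i: "i < d"
  let ?r = "\<Otimes>t \<in> {..<d} - {i}. b (xs ! t) (ys ! t)"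
  have r: "(\<lambda>t. b (xs ! t) (ys ! t)) \<in> {..<d} - {i} \<rightarrow> carrier K"
    using xs ys by (auto intro!: b_closed words_nth)
  have yi: "ys ! i \<in> carrier E'" using ys i by (rule words_nth)
  have "linear_map K E (self_module K) (\<lambda>x. ?r \<odot>\<^bsub>self_module K\<^esub> b x (ys ! i))"
    using r by (intro linear_map_smult module_self b_left yi) simp
  then show "linear_map K E (self_module K) (\<lambda>x. ev d (xs[i := x]) ys)"
  proof (rule linear_map_cong[OF left.module_axioms])
    fix x assume x: "x \<in> carrier E"
    have "ev d (xs[i := x]) ys = (\<Otimes>t \<in> insert i ({..<d} - {i}). b (xs[i := x] ! t) (ys ! t))"
      using i by (simp add: ev_def insert_absorb)
    also have "\<dots> = b (xs[i := x] ! i) (ys ! i) \<otimes> (\<Otimes>t \<in> {..<d} - {i}. b (xs[i := x] ! t) (ys ! t))"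
      using words_update[OF xs x, of i] ys i by (intro finprod_insert) (auto intro!: b_closed words_nth)
    also have "(\<Otimes>t \<in> {..<d} - {i}. b (xs[i := x] ! t) (ys ! t)) = ?r"
      using r by (intro finprod_cong') auto
    also have "xs[i := x] ! i = x"
      using i words_length[OF xs] by simp
    finally show "ev d (xs[i := x]) ys = ?r \<odot>\<^bsub>self_module K\<^esub> b x (ys ! i)"
      using finprod_closed[OF r] b_closed[OF x yi] by (simp add: m_comm)
  qed
qed

text \<open>Take \<open>p \<circ> q\<close> as the new summation variable; \<open>chr d p\<close> is
  \<open>chr d (p \<circ> q)\<close> divided by \<open>chr d q\<close>.\<close>

lemma pair_permute:
  assumes q: "q \<in> grp d" and xs: "xs \<in> words E d" and ys: "ys \<in> words E' d"
  shows "pair d (permute_word q xs) ys = inv (chr d q) \<otimes> pair d xs ys"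
proof -
  let ?h = "\<lambda>p. inv (chr d q) \<otimes> (chr d p \<otimes> ev d (permute_word p xs) ys)"
  note tc = term_closed[OF xs ys]
  have iq: "inv (chr d q) \<in> carrier K" using chr_Units[OF q] by simp
  have "pair d (permute_word q xs) ys = (\<Oplus>p \<in> grp d. ?h (p \<circ> q))"
    unfolding pair_def
  proof (rule finsum_cong'[OF refl])
    fix p assume p: "p \<in> grp d"
    have "permute_word p (permute_word q xs) = permute_word (p \<circ> q) xs"
      by (rule permute_word_comp[OF grp_permutes[OF p] grp_permutes[OF q] words_length[OF xs]])
    moreover have "chr d p = inv (chr d q) \<otimes> chr d (p \<circ> q)"
      using chr_Units[OF q] chr_closed[OF p] chr_closed[OF q] iq
      by (simp add: chr_comp[OF p q] m_lcomm)
    ultimately show "chr d p \<otimes> ev d (permute_word p (permute_word q xs)) ys = ?h (p \<circ> q)"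
      using iq chr_closed[OF grp_comp[OF p q]] ev_closed[OF permute_word_words[OF grp_permutes[OF grp_comp[OF p q]] xs] ys]
      by (simp add: m_assoc)
  qed (rule funcsetI, rule m_closed[OF iq tc[OF grp_comp[OF _ q]]])
  also have "\<dots> = (\<Oplus>p \<in> (\<lambda>p. p \<circ> q) ` grp d. ?h p)"
    by (rule finsum_reindex[symmetric, OF _ grp_translate(2)[OF q]], unfold grp_translate(1)[OF q],
        rule funcsetI, rule m_closed[OF iq tc])
  also have "\<dots> = inv (chr d q) \<otimes> pair d xs ys"
    unfolding grp_translate(1)[OF q] pair_def
    using tc iq finite_grp by (intro finsum_rdistr[symmetric]) auto
  finally show ?thesis .
qed

lemma chi_multilinear_pair:
  assumes ys: "ys \<in> words E' d"
  shows "chi_multilinear K W \<chi> E d (self_module K) (\<lambda>xs. pair d xs ys)"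
  unfolding chi_multilinear_iff[OF module_self]
proof (intro conjI ballI)
  show "multilinear K E d (self_module K) (\<lambda>xs. pair d xs ys)"
    using multilinear_sum[OF left.module_axioms module_self, of "grp d" "chr d" d
        "\<lambda>p xs. ev d (permute_word p xs) ys"]
      multilinear_permute_word[OF multilinear_ev[OF ys] grp_permutes] chr_closed
    by (simp add: pair_def)
qed (simp add: pair_permute ys)

text \<open>Reindexing the product by \<open>p\<close> moves the permutation to the other argument;
  \<open>h\<close> is \<open>p\<close> on list indices, which start at 0.\<close>

lemma ev_adjoint:
  assumes p: "p permutes {1..d}" and xs: "xs \<in> words E d" and ys: "ys \<in> words E' d"
  shows "ev d (permute_word p xs) ys = ev d xs (permute_word (Hilbert_Choice.inv p) ys)"
proof -
  define h where "h s = p (Suc s) - 1" for s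
  have ps: "1 \<le> p (Suc s)" "p (Suc s) \<le> d" if "s < d" for s
    using permutes_in_image[OF p, of "Suc s"] that by auto
  have inj: "inj_on h {..<d}"
  proof (rule inj_onI)
    fix s t assume st: "s \<in> {..<d}" "t \<in> {..<d}" "h s = h t"
    then have "p (Suc s) = p (Suc t)" using ps[of s] ps[of t] by (auto simp: h_def)
    then show "s = t" using permutes_inj[OF p] by (auto dest: injD)
  qed
  moreover have "h ` {..<d} \<subseteq> {..<d}" using ps by (force simp: h_def)
  ultimately have h: "h ` {..<d} = {..<d}"
    by (intro card_subset_eq) (auto simp: card_image)
  let ?f = "\<lambda>t. b (permute_word p xs ! t) (ys ! t)"
  have fc: "?f \<in> {..<d} \<rightarrow> carrier K"
    using permute_word_words[OF p xs] ys by (auto intro!: b_closed words_nth)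
  have "ev d (permute_word p xs) ys = (\<Otimes>t \<in> h ` {..<d}. ?f t)"
    by (simp add: ev_def h)
  also have "\<dots> = (\<Otimes>s \<in> {..<d}. ?f (h s))"
    using fc inj by (intro finprod_reindex) (auto simp: h)
  also have "\<dots> = ev d xs (permute_word (Hilbert_Choice.inv p) ys)"
    unfolding ev_def
  proof (rule finprod_cong'[OF refl])
    fix s assume "s \<in> {..<d}"
    then have s: "s < d" by simp
    have "Hilbert_Choice.inv p (p (Suc s)) = Suc s" using permutes_inverses(2)[OF p] by simp
    then show "?f (h s) = b (xs ! s) (permute_word (Hilbert_Choice.inv p) ys ! s)"
      using ps[OF s] s words_length[OF xs] words_length[OF ys]
      by (simp add: nth_permute_word h_def permutes_inv_inv[OF p])
  qed (use permute_word_words[OF permutes_inv[OF p] ys] xs in \<open>auto intro!: b_closed words_nth\<close>)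
  finally show ?thesis .
qed

lemma pairing_swap: "pairing K W \<chi> E' E (\<lambda>y x. b x y)"
  using b_left b_right
  by (intro pairing.intro pairing_axioms.intro character_sequence_axioms left.module_axioms
      right.module_axioms) auto

text \<open>Moving \<open>p\<close> across produces its inverse, and \<open>chr_inv_eq\<close>, that
  is \<open>\<chi>\<^sup>2 = 1\<close>, lets the sum be rewritten over inverses with the same
  character. The swapped form then has the same shape as the original.\<close>

lemma pair_swap:
  assumes xs: "xs \<in> words E d" and ys: "ys \<in> words E' d"
  shows "pair d xs ys = pairing.pair K W \<chi> (\<lambda>y x. b x y) d ys xs"
proof -
  interpret sw: pairing K W \<chi> E' E "\<lambda>y x. b x y" by (rule pairing_swap)
  have "pair d xs ys = (\<Oplus>p \<in> grp d. chr d (Hilbert_Choice.inv p) \<otimes>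
      sw.ev d (permute_word (Hilbert_Choice.inv p) ys) xs)"
    unfolding pair_def
  proof (rule finsum_cong'[OF refl])
    fix p assume p: "p \<in> grp d"
    have "ev d xs zs = sw.ev d zs xs" for zs
      by (simp add: ev_def sw.ev_def)
    then show "chr d p \<otimes> ev d (permute_word p xs) ys =
      chr d (Hilbert_Choice.inv p) \<otimes> sw.ev d (permute_word (Hilbert_Choice.inv p) ys) xs"
      by (simp add: ev_adjoint[OF grp_permutes[OF p] xs ys] chr_inv[OF p] chr_inv_eq[OF p])
  qed (use sw.term_closed[OF ys xs grp_inv] in auto)
  also have "\<dots> = (\<Oplus>p \<in> Hilbert_Choice.inv ` grp d. chr d p \<otimes> sw.ev d (permute_word p ys) xs)"
    using sw.term_closed[OF ys xs] by (intro finsum_reindex[symmetric] grp_invert) (auto simp: grp_invert)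
  also have "\<dots> = sw.pair d ys xs"
    by (simp add: grp_invert sw.pair_def)
  finally show ?thesis .
qed

sublocale L: chi_module K W \<chi> E
  by (intro chi_module.intro character_sequence_axioms left.module_axioms)

sublocale R: chi_module K W \<chi> E'
  by (intro chi_module.intro character_sequence_axioms right.module_axioms)

text \<open>Agreement with \<open>pair\<close> is asked for on words only, so that
  \<open>word_pairing\<close> can be inserted as \<open>\<psi>\<close> unchanged.\<close>

lemma chi_bilinear_pair:
  assumes \<psi>: "\<And>xs ys. xs \<in> words E d \<Longrightarrow> ys \<in> words E' d \<Longrightarrow> \<psi> xs ys = pair d xs ys"
  shows "chi_bilinear K W \<chi> E d E' d (self_module K) \<psi>"
proof (intro chi_bilinear.intro chi_bilinear_axioms.intro L.S.chi_space_axioms R.S.chi_space_axioms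
    module_self)
  show "chi_multilinear K W \<chi> E d (self_module K) (\<lambda>xs. \<psi> xs ys)" if ys: "ys \<in> words E' d" for ys
    by (rule L.S.chi_multilinear_cong[OF module_self chi_multilinear_pair[OF ys]]) (rule \<psi>[OF _ ys])
  show "chi_multilinear K W \<chi> E' d (self_module K) (\<psi> xs)" if xs: "xs \<in> words E d" for xs
    by (rule R.S.chi_multilinear_cong[OF module_self
          pairing.chi_multilinear_pair[OF pairing_swap xs]]) (simp add: \<psi> xs pair_swap)
qed

end

text \<open>\<open>e\<close> and \<open>e'\<close> are dual frames: the coordinates on one side are
  the values of \<open>b\<close> at the frame of the other. The sum of ones is the order of the
  group as an element of \<open>K\<close>; its invertibility is the form in which the rationals
  enter.\<close>

locale dual_pairing = pairing K W \<chi> E E' b +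
    left_coord: coordinates K E I e "\<lambda>i x. b x (e' i)" +
    right_coord: coordinates K E' I e' "\<lambda>i y. b (e i) y"
  for K :: "('k, 'r) ring_scheme" (structure) and W and \<chi>
    and E :: "('k, 'e, 's) module_scheme" and E' :: "('k, 'f, 't) module_scheme"
    and b and I :: "'i set" and e and e' +
  fixes \<psi> :: "nat \<Rightarrow> 'e list \<Rightarrow> 'f list \<Rightarrow> 'k"
  assumes \<psi>_eq: "xs \<in> words E d \<Longrightarrow> ys \<in> words E' d \<Longrightarrow> \<psi> d xs ys = pair d xs ys"
    and card_Unit: "(\<Oplus>p \<in> grp d. \<one>) \<in> Units K"
begin

sublocale B: chi_bilinear K W \<chi> E d E' d "self_module K" "\<psi> d" for d
  by (rule chi_bilinear_pair) (rule \<psi>_eq)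

abbreviation "form \<equiv> \<lambda>d. chi_bilinear.bilift K (self_module K) (\<psi> d)"

abbreviation "card_grp d \<equiv> \<Oplus>p \<in> grp d. \<one>"

lemma form_closed: "u \<in> carrier (L.P d) \<Longrightarrow> v \<in> carrier (R.P d) \<Longrightarrow> form d u v \<in> carrier K"
  using linear_mapD(1)[OF B.linear_map_bilift_right] by simp

lemma dual_pairing_swap: "dual_pairing K W \<chi> E' E (\<lambda>y x. b x y) I e' e (\<lambda>d ys xs. \<psi> d xs ys)"
  by (intro dual_pairing.intro dual_pairing_axioms.intro pairing_swap
      left_coord.coordinates_axioms right_coord.coordinates_axioms card_Unit)
    (simp add: \<psi>_eq pair_swap)

text \<open>Expanding the permuted words in the basis and using equivariance of words, every summand
  \<open>p\<close> of the pairing contributes one copy of \<open>u\<close>.\<close>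

lemma average_left:
  assumes u: "u \<in> carrier (L.P d)"
  shows "card_grp d \<odot>\<^bsub>L.P d\<^esub> u =
    (\<Oplus>\<^bsub>L.P d\<^esub>is \<in> index_words I d. form d u (R.word (map e' is)) \<odot>\<^bsub>L.P d\<^esub> L.word (map e is))"
proof -
  note we = L.S.word_closed[OF left_coord.map_words] R.S.word_closed[OF right_coord.map_words]
  have card: "card_grp d \<in> carrier K" using card_Unit by simp
  show ?thesis
  proof (rule L.S.linear_map_eq_on_words[where f = "\<lambda>u. card_grp d \<odot>\<^bsub>L.P d\<^esub> u" and g = "\<lambda>u.
        \<Oplus>\<^bsub>L.P d\<^esub>is \<in> index_words I d. form d u (R.word (map e' is)) \<odot>\<^bsub>L.P d\<^esub> L.word (map e is)",
        OF L.S.C.module_axioms _ _ _ u])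
    show "linear_map K (L.P d) (L.P d) (\<lambda>u. card_grp d \<odot>\<^bsub>L.P d\<^esub> u)"
      using card by (intro linear_map_smult[OF L.S.C.module_axioms]) (auto intro: linear_mapI)
    show "linear_map K (L.P d) (L.P d) (\<lambda>u. \<Oplus>\<^bsub>L.P d\<^esub>is \<in> index_words I d.
        form d u (R.word (map e' is)) \<odot>\<^bsub>L.P d\<^esub> L.word (map e is))"
      by (intro linear_map_sum L.S.C.module_axioms linear_map_compose[OF B.linear_map_bilift_left]
          L.S.C.linear_map_scalar we)
    fix xs assume xs: "xs \<in> words E d"
    have pw: "permute_word p xs \<in> words E d" if "p \<in> grp d" for p
      by (rule permute_word_words[OF grp_permutes[OF that] xs])
    let ?t = "\<lambda>p is. chr d p \<odot>\<^bsub>L.P d\<^esub> (ev d (permute_word p xs) (map e' is) \<odot>\<^bsub>L.P d\<^esub> L.word (map e is))"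
    have tc: "ev d (permute_word p xs) (map e' is) \<odot>\<^bsub>L.P d\<^esub> L.word (map e is) \<in> carrier (L.P d)"
      if "p \<in> grp d" "is \<in> index_words I d" for p "is"
      using that by (intro L.S.C.smult_closed ev_closed pw right_coord.map_words we)
    have ttc: "?t p is \<in> carrier (L.P d)" if "p \<in> grp d" "is \<in> index_words I d" for p "is"
      using that by (intro L.S.C.smult_closed chr_closed tc)
    have "(\<Oplus>\<^bsub>L.P d\<^esub>is \<in> index_words I d. form d (L.word xs) (R.word (map e' is)) \<odot>\<^bsub>L.P d\<^esub> L.word (map e is))
      = (\<Oplus>\<^bsub>L.P d\<^esub>is \<in> index_words I d. \<Oplus>\<^bsub>L.P d\<^esub>p \<in> grp d. ?t p is)"
    proof (rule L.S.C.finsum_cong'[OF refl])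
      fix "is" assume i: "is \<in> index_words I d"
      have "form d (L.word xs) (R.word (map e' is)) =
          (\<Oplus>p \<in> grp d. chr d p \<otimes> ev d (permute_word p xs) (map e' is))"
        using xs right_coord.map_words[OF i] by (simp add: B.bilift_word \<psi>_eq pair_def)
      then have "form d (L.word xs) (R.word (map e' is)) \<odot>\<^bsub>L.P d\<^esub> L.word (map e is) =
          (\<Oplus>p \<in> grp d. chr d p \<otimes> ev d (permute_word p xs) (map e' is)) \<odot>\<^bsub>L.P d\<^esub> L.word (map e is)"
        by (rule arg_cong)
      also have "\<dots> = (\<Oplus>\<^bsub>L.P d\<^esub>p \<in> grp d.
          (chr d p \<otimes> ev d (permute_word p xs) (map e' is)) \<odot>\<^bsub>L.P d\<^esub> L.word (map e is))"
        by (rule L.S.C.finsum_smult_rdistr[OF funcsetI we(1)[OF i]])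
          (rule term_closed[OF xs right_coord.map_words[OF i]])
      also have "\<dots> = (\<Oplus>\<^bsub>L.P d\<^esub>p \<in> grp d. ?t p is)"
      proof (rule L.S.C.finsum_cong'[OF refl])
        fix p assume "p \<in> grp d"
        then show "(chr d p \<otimes> ev d (permute_word p xs) (map e' is)) \<odot>\<^bsub>L.P d\<^esub> L.word (map e is) = ?t p is"
          by (intro L.S.C.smult_assoc1 chr_closed ev_closed pw right_coord.map_words we i)
      qed (rule funcsetI, rule ttc[OF _ i])
      finally show "form d (L.word xs) (R.word (map e' is)) \<odot>\<^bsub>L.P d\<^esub> L.word (map e is) =
          (\<Oplus>\<^bsub>L.P d\<^esub>p \<in> grp d. ?t p is)" .
    qed (rule funcsetI, rule L.S.C.finsum_closed, rule funcsetI, rule ttc)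
    also have "\<dots> = (\<Oplus>\<^bsub>L.P d\<^esub>p \<in> grp d. \<Oplus>\<^bsub>L.P d\<^esub>is \<in> index_words I d. ?t p is)"
      by (rule L.S.C.finsum_swap[OF finite_index_words[OF left_coord.fin] finite_grp]) (rule ttc)
    also have "\<dots> = (\<Oplus>\<^bsub>L.P d\<^esub>p \<in> grp d. \<one> \<odot>\<^bsub>L.P d\<^esub> L.word xs)"
    proof (rule L.S.C.finsum_cong'[OF refl])
      fix p assume p: "p \<in> grp d"
      have "(\<Oplus>\<^bsub>L.P d\<^esub>is \<in> index_words I d. ?t p is) = chr d p \<odot>\<^bsub>L.P d\<^esub> (\<Oplus>\<^bsub>L.P d\<^esub>is \<in> index_words I d.
          ev d (permute_word p xs) (map e' is) \<odot>\<^bsub>L.P d\<^esub> L.word (map e is))"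
        by (rule L.S.C.finsum_smult_ldistr[symmetric, OF finite_index_words[OF left_coord.fin] chr_closed[OF p]])
          (rule funcsetI, rule tc[OF p])
      also have "(\<Oplus>\<^bsub>L.P d\<^esub>is \<in> index_words I d.
          ev d (permute_word p xs) (map e' is) \<odot>\<^bsub>L.P d\<^esub> L.word (map e is)) =
          (\<Oplus>\<^bsub>L.P d\<^esub>is \<in> index_words I d.
          (\<Otimes>t \<in> {..<d}. b (permute_word p xs ! t) (e' (is ! t))) \<odot>\<^bsub>L.P d\<^esub> L.word (map e is))"
      proof (rule L.S.C.finsum_cong'[OF refl])
        fix "is" assume i: "is \<in> index_words I d"
        have "ev d (permute_word p xs) (map e' is) = (\<Otimes>t \<in> {..<d}. b (permute_word p xs ! t) (e' (is ! t)))"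
          unfolding ev_def using i pw[OF p]
          by (intro finprod_cong') (auto simp: index_words_def intro!: b_closed words_nth right_coord.e_closed)
        then show "ev d (permute_word p xs) (map e' is) \<odot>\<^bsub>L.P d\<^esub> L.word (map e is) =
          (\<Otimes>t \<in> {..<d}. b (permute_word p xs ! t) (e' (is ! t))) \<odot>\<^bsub>L.P d\<^esub> L.word (map e is)"
          by simp
      qed (rule funcsetI, rule L.S.C.smult_closed[OF left_coord.coeff_closed[OF _ pw[OF p]] we(1)])
      also have "\<dots> = L.word (permute_word p xs)"
        using L.S.chi_multilinear_word[of d]
        by (intro left_coord.multilinear_expand[symmetric, OF L.S.C.module_axioms _ pw[OF p]])
          (simp add: chi_multilinear_def)
      also have "\<dots> = inv (chr d p) \<odot>\<^bsub>L.P d\<^esub> L.word xs"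
        using L.S.chi_multilinear_word[of d] p xs by (simp add: chi_multilinear_iff[OF L.S.C.module_axioms])
      also have "chr d p \<odot>\<^bsub>L.P d\<^esub> \<dots> = \<one> \<odot>\<^bsub>L.P d\<^esub> L.word xs"
        using chr_Units[OF p] L.S.word_closed[OF xs]
        by (simp add: L.S.C.smult_assoc1[symmetric] Units_closed)
      finally show "(\<Oplus>\<^bsub>L.P d\<^esub>is \<in> index_words I d. ?t p is) = \<one> \<odot>\<^bsub>L.P d\<^esub> L.word xs" .
    qed (rule funcsetI, rule L.S.C.smult_closed[OF one_closed L.S.word_closed[OF xs]])
    also have "\<dots> = card_grp d \<odot>\<^bsub>L.P d\<^esub> L.word xs"
      by (rule L.S.C.finsum_smult_rdistr[symmetric, OF funcsetI L.S.word_closed[OF xs]]) simp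
    finally show "card_grp d \<odot>\<^bsub>L.P d\<^esub> L.word xs = (\<Oplus>\<^bsub>L.P d\<^esub>is \<in> index_words I d.
      form d (L.word xs) (R.word (map e' is)) \<odot>\<^bsub>L.P d\<^esub> L.word (map e is))"
      by simp
  qed
qed

text \<open>The two sides lift their arguments in opposite orders; both are bilinear and agree on
  pairs of words.\<close>

lemma form_swap:
  assumes u: "u \<in> carrier (L.P d)" and v: "v \<in> carrier (R.P d)"
  shows "form d u v = chi_bilinear.bilift K (self_module K) (\<lambda>ys xs. \<psi> d xs ys) v u"
proof -
  interpret sw: dual_pairing K W \<chi> E' E "\<lambda>y x. b x y" I e' e "\<lambda>d ys xs. \<psi> d xs ys"
    by (rule dual_pairing_swap)
  show ?thesis
  proof (rule L.S.linear_map_eq_on_words[OF module_self B.linear_map_bilift_left[OF v]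
        sw.B.linear_map_bilift_right[OF v] _ u])
    fix xs assume xs: "xs \<in> words E d"
    note w = L.S.word_closed[OF xs]
    show "form d (L.word xs) v = sw.form d v (L.word xs)"
      by (rule R.S.linear_map_eq_on_words[OF module_self B.linear_map_bilift_right[OF w]
            sw.B.linear_map_bilift_left[OF w] _ v])
        (simp add: B.bilift_word sw.B.bilift_word xs)
  qed
qed

lemma average_right:
  assumes v: "v \<in> carrier (R.P d)"
  shows "card_grp d \<odot>\<^bsub>R.P d\<^esub> v =
    (\<Oplus>\<^bsub>R.P d\<^esub>is \<in> index_words I d. form d (L.word (map e is)) v \<odot>\<^bsub>R.P d\<^esub> R.word (map e' is))"
proof -
  interpret sw: dual_pairing K W \<chi> E' E "\<lambda>y x. b x y" I e' e "\<lambda>d ys xs. \<psi> d xs ys"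
    by (rule dual_pairing_swap)
  note we = L.S.word_closed[OF left_coord.map_words] R.S.word_closed[OF right_coord.map_words]
  have "card_grp d \<odot>\<^bsub>R.P d\<^esub> v =
    (\<Oplus>\<^bsub>R.P d\<^esub>is \<in> index_words I d. sw.form d v (L.word (map e is)) \<odot>\<^bsub>R.P d\<^esub> R.word (map e' is))"
    by (rule sw.average_left[OF v])
  also have "\<dots> = (\<Oplus>\<^bsub>R.P d\<^esub>is \<in> index_words I d. form d (L.word (map e is)) v \<odot>\<^bsub>R.P d\<^esub> R.word (map e' is))"
    by (intro R.S.C.finsum_cong'[OF refl] funcsetI R.S.C.smult_closed form_closed we v)
      (simp_all add: form_swap we v)
  finally show ?thesis .
qed

text \<open>\<open>average_left\<close> recovers \<open>u\<close>, up to the invertible group order,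
  from its pairings with the words in the \<open>e'\<close>.\<close>

lemma form_nondegenerate:
  assumes u: "u \<in> carrier (L.P d)" and z: "\<And>v. v \<in> carrier (R.P d) \<Longrightarrow> form d u v = \<zero>"
  shows "u = \<zero>\<^bsub>L.P d\<^esub>"
proof -
  note we = L.S.word_closed[OF left_coord.map_words] R.S.word_closed[OF right_coord.map_words]
  have "card_grp d \<odot>\<^bsub>L.P d\<^esub> u = \<zero>\<^bsub>L.P d\<^esub>"
    unfolding average_left[OF u] by (rule L.S.C.M.add.finprod_one_eqI) (simp add: z we)
  then have "inv (card_grp d) \<odot>\<^bsub>L.P d\<^esub> (card_grp d \<odot>\<^bsub>L.P d\<^esub> u) = \<zero>\<^bsub>L.P d\<^esub>"
    using card_Unit by simp
  then show ?thesis
    using card_Unit[of d] u by (simp add: L.S.C.smult_assoc1[symmetric] Units_closed)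
qed

text \<open>\<open>average_left\<close> dictates the candidate: put \<open>h\<close> in place of
  \<open>form d u\<close> and divide by the group order. It represents \<open>h\<close> because
  applying \<open>h\<close> to \<open>average_right\<close> gives the same sum.\<close>

lemma form_represents:
  assumes lam: "linear_map K (R.P d) (self_module K) h"
  obtains u where "u \<in> carrier (L.P d)" "\<And>v. v \<in> carrier (R.P d) \<Longrightarrow> form d u v = h v"
proof
  note we = L.S.word_closed[OF left_coord.map_words] R.S.word_closed[OF right_coord.map_words]
  let ?s = "\<Oplus>\<^bsub>L.P d\<^esub>is \<in> index_words I d. h (R.word (map e' is)) \<odot>\<^bsub>L.P d\<^esub> L.word (map e is)"
  have lc: "h v \<in> carrier K" if "v \<in> carrier (R.P d)" for v
    using linear_mapD(1)[OF lam that] by simp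
  have sc: "h (R.word (map e' is)) \<odot>\<^bsub>L.P d\<^esub> L.word (map e is) \<in> carrier (L.P d)"
    if "is \<in> index_words I d" for "is"
    using that by (intro L.S.C.smult_closed lc we)
  have s: "?s \<in> carrier (L.P d)"
    by (rule L.S.C.finsum_closed) (rule funcsetI, rule sc)
  have ic: "inv (card_grp d) \<in> carrier K" using card_Unit by simp
  show "inv (card_grp d) \<odot>\<^bsub>L.P d\<^esub> ?s \<in> carrier (L.P d)"
    using ic s by simp
  fix v assume v: "v \<in> carrier (R.P d)"
  note lin = B.linear_map_bilift_left[OF v]
  have fc: "form d (L.word (map e is)) v \<in> carrier K" if "is \<in> index_words I d" for "is"
    using that by (intro form_closed we v)
  have "form d ?s v = (\<Oplus>is \<in> index_words I d. form d (h (R.word (map e' is)) \<odot>\<^bsub>L.P d\<^esub> L.word (map e is)) v)"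
    using linear_map_finsum[OF L.S.C.module_axioms module_self lin, OF funcsetI[OF sc]] by simp
  also have "\<dots> = (\<Oplus>is \<in> index_words I d. h (form d (L.word (map e is)) v \<odot>\<^bsub>R.P d\<^esub> R.word (map e' is)))"
  proof (rule finsum_cong'[OF refl])
    fix "is" assume i: "is \<in> index_words I d"
    show "form d (h (R.word (map e' is)) \<odot>\<^bsub>L.P d\<^esub> L.word (map e is)) v =
        h (form d (L.word (map e is)) v \<odot>\<^bsub>R.P d\<^esub> R.word (map e' is))"
      using linear_mapD(3)[OF lin lc[OF we(2)[OF i]] we(1)[OF i]]
        linear_mapD(3)[OF lam fc[OF i] we(2)[OF i]] lc[OF we(2)[OF i]] fc[OF i]
      by (simp add: m_comm)
  qed (intro funcsetI lc R.S.C.smult_closed fc we)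
  also have "\<dots> = h (\<Oplus>\<^bsub>R.P d\<^esub>is \<in> index_words I d.
      form d (L.word (map e is)) v \<odot>\<^bsub>R.P d\<^esub> R.word (map e' is))"
    using linear_map_finsum[OF R.S.C.module_axioms module_self lam,
        of "\<lambda>is. form d (L.word (map e is)) v \<odot>\<^bsub>R.P d\<^esub> R.word (map e' is)" "index_words I d"]
      fc we(2) by simp
  also have "\<dots> = card_grp d \<otimes> h v"
    unfolding average_right[OF v, symmetric] using linear_mapD(3)[OF lam _ v] card_Unit by simp
  finally have "form d ?s v = card_grp d \<otimes> h v" .
  then show "form d (inv (card_grp d) \<odot>\<^bsub>L.P d\<^esub> ?s) v = h v"
    using linear_mapD(3)[OF lin ic s] card_Unit[of d] ic lc[OF v]
    by (simp add: m_assoc[symmetric] Units_closed)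
qed

end

section \<open>The right inner product\<close>

context dual_pairing
begin

text \<open>Summed over the same index set as \<open>chi_pairing\<close>, so that the two coincide
  literally; \<open>graded_form_eq\<close> trades the support for larger sets.\<close>

definition graded_form where
  "graded_form a x = (\<Oplus>d \<in> {d. a d \<noteq> \<zero>\<^bsub>L.P d\<^esub>}. form d (a d) (x d))"

lemma form_zero_left: "v \<in> carrier (R.P d) \<Longrightarrow> form d \<zero>\<^bsub>L.P d\<^esub> v = \<zero>"
  using linear_map_zero[OF L.S.C.module_axioms module_self B.linear_map_bilift_left] by simp

lemma form_zero_right: "u \<in> carrier (L.P d) \<Longrightarrow> form d u \<zero>\<^bsub>R.P d\<^esub> = \<zero>"
  using linear_map_zero[OF R.S.C.module_axioms module_self B.linear_map_bilift_right] by simp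

lemma graded_form_eq:
  assumes a: "a \<in> carrier L.alg" and x: "x \<in> carrier R.alg"
    and D: "finite D" "{d. a d \<noteq> \<zero>\<^bsub>L.P d\<^esub>} \<subseteq> D"
  shows "graded_form a x = (\<Oplus>d \<in> D. form d (a d) (x d))"
  unfolding graded_form_def
proof (rule add.finprod_mono_neutral_cong_left[OF D])
  fix d assume "d \<in> D - {d. a d \<noteq> \<zero>\<^bsub>L.P d\<^esub>}"
  then have "a d = \<zero>\<^bsub>L.P d\<^esub>" by simp
  then show "form d (a d) (x d) = \<zero>" using form_zero_left R.alg_closed[OF x] by simp
qed (use form_closed[OF L.alg_closed[OF a] R.alg_closed[OF x]] in auto)

lemma support_bounded:
  assumes "a \<in> carrier L.alg"
  obtains m where "{d. a d \<noteq> \<zero>\<^bsub>L.P d\<^esub>} \<subseteq> {0..m}"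
proof -
  have "finite {d. a d \<noteq> \<zero>\<^bsub>L.P d\<^esub>}"
    using assms unfolding L.carrier_alg by blast
  then obtain m where "\<forall>d \<in> {d. a d \<noteq> \<zero>\<^bsub>L.P d\<^esub>}. d \<le> m"
    unfolding finite_nat_set_iff_bounded_le by blast
  then show thesis by (intro that[of m]) auto
qed

lemma graded_form_add_left:
  assumes a: "a \<in> carrier L.alg" and c: "c \<in> carrier L.alg" and x: "x \<in> carrier R.alg"
  shows "graded_form (a \<oplus>\<^bsub>L.alg\<^esub> c) x = graded_form a x \<oplus> graded_form c x"
proof -
  obtain m where m: "{d. a d \<noteq> \<zero>\<^bsub>L.P d\<^esub>} \<subseteq> {0..m}" using support_bounded[OF a] .
  obtain n where n: "{d. c d \<noteq> \<zero>\<^bsub>L.P d\<^esub>} \<subseteq> {0..n}" using support_bounded[OF c] .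
  note ac = L.alg_closed[OF a] and bc = L.alg_closed[OF c] and xc = R.alg_closed[OF x]
  have ab: "a \<oplus>\<^bsub>L.alg\<^esub> c \<in> carrier L.alg"
    by (rule ring.ring_simprules(1)[OF L.ring_alg a c])
  have sub: "{d. (a \<oplus>\<^bsub>L.alg\<^esub> c) d \<noteq> \<zero>\<^bsub>L.P d\<^esub>} \<subseteq> {0..m + n}"
  proof (rule subsetI, rule ccontr)
    fix d assume d: "d \<in> {d. (a \<oplus>\<^bsub>L.alg\<^esub> c) d \<noteq> \<zero>\<^bsub>L.P d\<^esub>}" "d \<notin> {0..m + n}"
    then have "a d = \<zero>\<^bsub>L.P d\<^esub>" "c d = \<zero>\<^bsub>L.P d\<^esub>" using m n by force+
    then show False using d(1) by (simp add: L.add_alg)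
  qed
  have "graded_form (a \<oplus>\<^bsub>L.alg\<^esub> c) x = (\<Oplus>d \<in> {0..m + n}. form d ((a \<oplus>\<^bsub>L.alg\<^esub> c) d) (x d))"
    by (rule graded_form_eq[OF ab x _ sub]) simp
  also have "\<dots> = (\<Oplus>d \<in> {0..m + n}. form d (a d) (x d) \<oplus> form d (c d) (x d))"
    by (intro finsum_cong'[OF refl] funcsetI a_closed form_closed ac bc xc)
      (use linear_mapD(2)[OF B.linear_map_bilift_left[OF xc] ac bc] in \<open>simp add: L.add_alg\<close>)
  also have "\<dots> = (\<Oplus>d \<in> {0..m + n}. form d (a d) (x d)) \<oplus> (\<Oplus>d \<in> {0..m + n}. form d (c d) (x d))"
    by (intro finsum_addf funcsetI form_closed ac bc xc)
  also have "(\<Oplus>d \<in> {0..m + n}. form d (a d) (x d)) = graded_form a x"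
    by (rule graded_form_eq[OF a x, symmetric]) (use m in auto)
  also have "(\<Oplus>d \<in> {0..m + n}. form d (c d) (x d)) = graded_form c x"
    by (rule graded_form_eq[OF c x, symmetric]) (use n in auto)
  finally show ?thesis .
qed

lemma graded_form_add_right:
  assumes a: "a \<in> carrier L.alg" and x: "x \<in> carrier R.alg" and y: "y \<in> carrier R.alg"
  shows "graded_form a (x \<oplus>\<^bsub>R.alg\<^esub> y) = graded_form a x \<oplus> graded_form a y"
proof -
  note ac = L.alg_closed[OF a] and xc = R.alg_closed[OF x] and yc = R.alg_closed[OF y]
  have "graded_form a (x \<oplus>\<^bsub>R.alg\<^esub> y) =
      (\<Oplus>d \<in> {d. a d \<noteq> \<zero>\<^bsub>L.P d\<^esub>}. form d (a d) (x d) \<oplus> form d (a d) (y d))"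
    unfolding graded_form_def
    by (intro finsum_cong'[OF refl] funcsetI a_closed form_closed ac xc yc)
      (use linear_mapD(2)[OF B.linear_map_bilift_right[OF ac] xc yc] in \<open>simp add: R.add_alg\<close>)
  also have "\<dots> = graded_form a x \<oplus> graded_form a y"
    unfolding graded_form_def by (intro finsum_addf funcsetI form_closed ac xc yc)
  finally show ?thesis .
qed

text \<open>Test elements that isolate one degree of the form.\<close>

definition homogeneous where
  "homogeneous d v = (\<lambda>n. if n = d then v else \<zero>\<^bsub>R.P n\<^esub>)"

lemma homogeneous_closed:
  assumes "v \<in> carrier (R.P d)"
  shows "homogeneous d v \<in> carrier R.alg"
proof -
  have "{n. homogeneous d v n \<noteq> \<zero>\<^bsub>R.P n\<^esub>} \<subseteq> {d}"
    by (auto simp: homogeneous_def)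
  then have "finite {n. homogeneous d v n \<noteq> \<zero>\<^bsub>R.P n\<^esub>}"
    by (rule finite_subset) simp
  moreover have "homogeneous d v n \<in> carrier (R.P n)" for n
    using assms by (simp add: homogeneous_def)
  ultimately show ?thesis unfolding R.carrier_alg by blast
qed

lemma graded_form_homogeneous:
  assumes a: "a \<in> carrier L.alg" and v: "v \<in> carrier (R.P d)"
  shows "graded_form a (homogeneous d v) = form d (a d) v"
proof -
  note ac = L.alg_closed[OF a] and hc = homogeneous_closed[OF v]
  have fin: "finite (insert d {d. a d \<noteq> \<zero>\<^bsub>L.P d\<^esub>})"
    using a unfolding L.carrier_alg by blast
  have "graded_form a (homogeneous d v) =
      (\<Oplus>n \<in> insert d {d. a d \<noteq> \<zero>\<^bsub>L.P d\<^esub>}. form n (a n) (homogeneous d v n))"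
    by (rule graded_form_eq[OF a hc fin]) blast
  also have "\<dots> = (\<Oplus>n \<in> {d}. form d (a d) v)"
  proof (rule add.finprod_mono_neutral_cong_right[OF fin])
    fix n assume "n \<in> insert d {d. a d \<noteq> \<zero>\<^bsub>L.P d\<^esub>} - {d}"
    then have "homogeneous d v n = \<zero>\<^bsub>R.P n\<^esub>" by (simp add: homogeneous_def)
    then show "form n (a n) (homogeneous d v n) = \<zero>" using form_zero_right[OF ac] by simp
  qed (use form_closed[OF ac R.alg_closed[OF hc]] form_closed[OF ac v] in \<open>auto simp: homogeneous_def\<close>)
  also have "\<dots> = form d (a d) v"
    using form_closed[OF ac v] by (simp add: finsum_insert finsum_empty)
  finally show ?thesis .
qed

text \<open>Homogeneous test elements reduce uniqueness to non-degeneracy in each degree.\<close>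

lemma graded_form_eqD:
  assumes a: "a \<in> carrier L.alg" and c: "c \<in> carrier L.alg"
    and eq: "\<And>x. x \<in> carrier R.alg \<Longrightarrow> graded_form a x = graded_form c x"
  shows "a = c"
proof
  fix d
  note ac = L.alg_closed[OF a] and bc = L.alg_closed[OF c]
  have "a d \<ominus>\<^bsub>L.P d\<^esub> c d = \<zero>\<^bsub>L.P d\<^esub>"
  proof (rule form_nondegenerate)
    show "a d \<ominus>\<^bsub>L.P d\<^esub> c d \<in> carrier (L.P d)"
      by (rule L.S.C.M.minus_closed[OF ac bc])
    fix v assume v: "v \<in> carrier (R.P d)"
    have "form d (a d) v = form d (c d) v"
      using eq[OF homogeneous_closed[OF v]] by (simp add: graded_form_homogeneous a c v)
    moreover have "form d (a d \<ominus>\<^bsub>L.P d\<^esub> c d) v = form d (a d) v \<ominus>\<^bsub>self_module K\<^esub> form d (c d) v"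
      by (rule linear_map_minus[OF L.S.C.module_axioms module_self B.linear_map_bilift_left[OF v] ac bc])
    moreover have "k \<ominus>\<^bsub>self_module K\<^esub> k = \<zero>" if "k \<in> carrier K" for k
      using abelian_group.r_neg[OF module.axioms(2)[OF module_self], of k] that by (simp add: a_minus_def)
    ultimately show "form d (a d \<ominus>\<^bsub>L.P d\<^esub> c d) v = \<zero>"
      using form_closed[OF bc v] by simp
  qed
  then have "a d \<oplus>\<^bsub>L.P d\<^esub> \<ominus>\<^bsub>L.P d\<^esub> c d = \<zero>\<^bsub>L.P d\<^esub>"
    by (simp only: a_minus_def)
  from L.S.C.M.minus_equality[OF this L.S.C.M.a_inv_closed[OF bc] ac] show "a d = c d"
    by (simp add: L.S.C.M.minus_minus[OF bc])
qed

text \<open>As \<open>r\<close> may have several components, the functional in degree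
  \<open>d\<close> collects contributions from the components of \<open>a\<close> in all degrees
  from \<open>d\<close> on. Its representative \<open>c d\<close> vanishes beyond the top degree of
  \<open>a\<close>, which puts \<open>c\<close> into the coproduct.\<close>

lemma graded_form_transpose_exists:
  assumes a: "a \<in> carrier L.alg" and r: "r \<in> carrier R.alg"
  shows "\<exists>c \<in> carrier L.alg. \<forall>x \<in> carrier R.alg.
    graded_form c x = graded_form a (r \<otimes>\<^bsub>R.alg\<^esub> x)"
proof -
  note ac = L.alg_closed[OF a] and rc = R.alg_closed[OF r]
  obtain m where m: "{d. a d \<noteq> \<zero>\<^bsub>L.P d\<^esub>} \<subseteq> {0..m}" using support_bounded[OF a] .
  \<comment> \<open>The contribution of \<open>a n\<close> in degree \<open>d\<close>: only the
    component of \<open>r\<close> of degree \<open>n - d\<close> can raise \<open>v\<close> to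
    degree \<open>n\<close>.\<close>
  define g where "g d n v = (if d \<le> n then form n (a n) (R.cmul (n - d) d (r (n - d)) v) else \<zero>)" for d n v
  have gl: "linear_map K (R.P d) (self_module K) (g d n)" for d n
  proof (cases "d \<le> n")
    case True
    then have "linear_map K (R.P d) (R.P n) (R.cmul (n - d) d (r (n - d)))"
      using R.B.linear_map_bilift_right[OF rc[of "n - d"], of d] by simp
    from linear_map_compose[OF this B.linear_map_bilift_right[OF ac[of n]]] show ?thesis
      using True by (simp add: g_def[abs_def])
  next
    case False
    then show ?thesis using linear_map_const_zero[OF module_self] by (simp add: g_def[abs_def])
  qed
  have gc: "g d n v \<in> carrier K" if "v \<in> carrier (R.P d)" for d n v
    using linear_mapD(1)[OF gl that] by simp
  have "linear_map K (R.P d) (self_module K) (\<lambda>v. \<Oplus>n \<in> {0..m}. g d n v)" for d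
    using linear_map_sum[OF R.S.C.module_axioms module_self gl] by simp
  then have "\<exists>u. u \<in> carrier (L.P d) \<and> (\<forall>v \<in> carrier (R.P d). form d u v = (\<Oplus>n \<in> {0..m}. g d n v))" for d
    using form_represents by metis
  then obtain c where bc: "\<And>d. c d \<in> carrier (L.P d)"
    and c: "\<And>d v. v \<in> carrier (R.P d) \<Longrightarrow> form d (c d) v = (\<Oplus>n \<in> {0..m}. g d n v)"
    by metis
  have "c d = \<zero>\<^bsub>L.P d\<^esub>" if "m < d" for d
  proof (rule form_nondegenerate[OF bc])
    show "form d (c d) v = \<zero>" if "v \<in> carrier (R.P d)" for v
      unfolding c[OF that] using \<open>m < d\<close> by (intro add.finprod_one_eqI) (simp add: g_def)
  qed
  then have sub: "{d. c d \<noteq> \<zero>\<^bsub>L.P d\<^esub>} \<subseteq> {0..m}"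
    by (auto simp: not_less[symmetric])
  then have b_alg: "c \<in> carrier L.alg"
    unfolding L.carrier_alg using bc finite_subset[OF sub] by blast
  have "graded_form c x = graded_form a (r \<otimes>\<^bsub>R.alg\<^esub> x)" if x: "x \<in> carrier R.alg" for x
  proof -
    note xc = R.alg_closed[OF x]
    have rx: "r \<otimes>\<^bsub>R.alg\<^esub> x \<in> carrier R.alg"
      by (rule R.mult_alg_closed[OF r x])
    have inner: "(\<Oplus>d \<in> {0..m}. g d n (x d)) = form n (a n) ((r \<otimes>\<^bsub>R.alg\<^esub> x) n)" if n: "n \<in> {0..m}" for n
    proof -
      have "(\<Oplus>d \<in> {0..m}. g d n (x d)) = (\<Oplus>d \<in> {0..n}. g d n (x d))"
        using n gc[OF xc] by (intro add.finprod_mono_neutral_cong_right) (auto simp: g_def)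
      \<comment> \<open>The sum so far runs over the degree of \<open>x\<close>, the one in
        \<open>mult_alg\<close> over that of \<open>r\<close>; \<open>n - k\<close> passes between
        them.\<close>
      also have "{0..n} = (\<lambda>k. n - k) ` {0..n}"
      proof -
        have "k \<in> (\<lambda>k. n - k) ` {0..n}" if "k \<le> n" for k
          by (rule rev_image_eqI[of "n - k"]) (use that in auto)
        then show ?thesis by auto
      qed
      also have "(\<Oplus>d \<in> (\<lambda>k. n - k) ` {0..n}. g d n (x d)) = (\<Oplus>k \<in> {0..n}. g (n - k) n (x (n - k)))"
        using gc[OF xc] by (intro finsum_reindex) (auto intro!: inj_onI)
      also have "\<dots> = (\<Oplus>k \<in> {0..n}. form n (a n) (R.cmul k (n - k) (r k) (x (n - k))))"
        by (intro finsum_cong'[OF refl] funcsetI form_closed ac R.cmul_term_closed r x)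
          (auto simp: g_def)
      also have "\<dots> = form n (a n) ((r \<otimes>\<^bsub>R.alg\<^esub> x) n)"
        unfolding R.mult_alg
        using linear_map_finsum[OF R.S.C.module_axioms module_self B.linear_map_bilift_right[OF ac[of n]],
            of "\<lambda>k. R.cmul k (n - k) (r k) (x (n - k))" "{0..n}"] R.cmul_term_closed[OF r x]
        by simp
      finally show ?thesis .
    qed
    have "graded_form c x = (\<Oplus>d \<in> {0..m}. form d (c d) (x d))"
      by (rule graded_form_eq[OF b_alg x _ sub]) simp
    also have "\<dots> = (\<Oplus>d \<in> {0..m}. \<Oplus>n \<in> {0..m}. g d n (x d))"
      by (intro finsum_cong'[OF refl] funcsetI finsum_closed gc xc c)
    also have "\<dots> = (\<Oplus>n \<in> {0..m}. \<Oplus>d \<in> {0..m}. g d n (x d))"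
      by (intro finsum_swap gc xc) simp_all
    also have "\<dots> = (\<Oplus>n \<in> {0..m}. form n (a n) ((r \<otimes>\<^bsub>R.alg\<^esub> x) n))"
      by (intro finsum_cong'[OF refl] funcsetI form_closed ac R.alg_closed[OF rx] inner)
    also have "\<dots> = graded_form a (r \<otimes>\<^bsub>R.alg\<^esub> x)"
      by (rule graded_form_eq[OF a rx _ m, symmetric]) simp
    finally show ?thesis .
  qed
  with b_alg show ?thesis by blast
qed

definition act where
  "act a r = (THE c. c \<in> carrier L.alg \<and>
    (\<forall>x \<in> carrier R.alg. graded_form c x = graded_form a (r \<otimes>\<^bsub>R.alg\<^esub> x)))"

lemma act:
  assumes a: "a \<in> carrier L.alg" and r: "r \<in> carrier R.alg"
  shows "act a r \<in> carrier L.alg"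
    and "x \<in> carrier R.alg \<Longrightarrow> graded_form (act a r) x = graded_form a (r \<otimes>\<^bsub>R.alg\<^esub> x)"
proof -
  have "\<exists>!c. c \<in> carrier L.alg \<and>
    (\<forall>x \<in> carrier R.alg. graded_form c x = graded_form a (r \<otimes>\<^bsub>R.alg\<^esub> x))"
    using graded_form_transpose_exists[OF a r] graded_form_eqD by (metis (no_types, lifting))
  from theI'[OF this] show "act a r \<in> carrier L.alg"
    "x \<in> carrier R.alg \<Longrightarrow> graded_form (act a r) x = graded_form a (r \<otimes>\<^bsub>R.alg\<^esub> x)"
    unfolding act_def by blast+
qed

text \<open>Each axiom is tested against all \<open>x\<close>. Pairing
  \<open>act (act a r) s\<close> with \<open>x\<close> first moves \<open>s\<close> in front of
  \<open>x\<close>, then \<open>r\<close> in front of both, so the action is a right one.\<close>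

lemma right_unital_module_act: "right_unital_module R.alg L.alg act"
proof -
  interpret A: ring L.alg by (rule L.ring_alg)
  interpret A': ring R.alg by (rule R.ring_alg)
  show ?thesis
  proof (intro right_unital_module.intro right_unital_module_axioms.intro L.abelian_group_alg R.ring_alg)
    fix a c r s assume a: "a \<in> carrier L.alg" and c: "c \<in> carrier L.alg"
      and r: "r \<in> carrier R.alg" and s: "s \<in> carrier R.alg"
    note ar = act[OF a r] and br = act[OF c r] and as = act[OF a s]
    show "act (a \<oplus>\<^bsub>L.alg\<^esub> c) r = act a r \<oplus>\<^bsub>L.alg\<^esub> act c r"
      by (rule graded_form_eqD)
        (simp_all add: act a c r graded_form_add_left)
  next
    fix a r s assume a: "a \<in> carrier L.alg" and r: "r \<in> carrier R.alg" and s: "s \<in> carrier R.alg"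
    show "act a (r \<oplus>\<^bsub>R.alg\<^esub> s) = act a r \<oplus>\<^bsub>L.alg\<^esub> act a s"
      by (rule graded_form_eqD)
        (simp_all add: act a r s graded_form_add_left graded_form_add_right A'.l_distr)
    show "act a (r \<otimes>\<^bsub>R.alg\<^esub> s) = act (act a r) s"
      by (rule graded_form_eqD) (simp_all add: act a r s A'.m_assoc)
  next
    fix a assume a: "a \<in> carrier L.alg"
    show "act a \<one>\<^bsub>R.alg\<^esub> = a"
      by (rule graded_form_eqD) (simp_all add: act a)
  qed (rule act)
qed

end

section \<open>The dual module\<close>

lemma dual_simps:
  "\<zero>\<^bsub>dual_module K E\<^esub> = (\<lambda>x \<in> carrier E. \<zero>\<^bsub>K\<^esub>)"
  "f \<oplus>\<^bsub>dual_module K E\<^esub> g = (\<lambda>x \<in> carrier E. f x \<oplus>\<^bsub>K\<^esub> g x)"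
  "k \<odot>\<^bsub>dual_module K E\<^esub> f = (\<lambda>x \<in> carrier E. k \<otimes>\<^bsub>K\<^esub> f x)"
  by (simp_all add: dual_module_def)

lemma carrier_dual:
  "f \<in> carrier (dual_module K E) \<longleftrightarrow> f \<in> extensional (carrier E) \<and> linear_map K E (self_module K) f"
  by (auto simp: dual_module_def linear_map_def PiE_def)

lemma linear_map_restrict:
  "module K E \<Longrightarrow> linear_map K E M f \<Longrightarrow> linear_map K E M (\<lambda>x \<in> carrier E. f x)"
  by (rule linear_map_cong) simp_all

lemma module_dual:
  fixes K :: "('k, 'r) ring_scheme" and E :: "('k, 'e, 's) module_scheme"
  assumes "module K E"
  shows "module K (dual_module K E)"
proof -
  interpret E: module K E by fact
  have ext: "f = g" if "f \<in> extensional (carrier E)" "g \<in> extensional (carrier E)"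
    "\<And>x. x \<in> carrier E \<Longrightarrow> f x = g x" for f g :: "'e \<Rightarrow> 'k"
    using that by (rule extensionalityI)
  have val: "f x \<in> carrier K" if "linear_map K E (self_module K) f" "x \<in> carrier E" for f x
    using linear_mapD(1)[OF that] by simp
  note rl = linear_map_restrict[OF assms]
  note lin = linear_map_const_zero[OF E.R.module_self, simplified] linear_map_add[OF E.R.module_self, simplified]
    linear_map_smult[OF E.R.module_self, simplified]
  show ?thesis
  proof (rule moduleI)
    show "abelian_group (dual_module K E)"
    proof (rule abelian_groupI)
      fix f assume f: "f \<in> carrier (dual_module K E)"
      \<comment> \<open>The negative as a scalar multiple, so that closure under scalars
        applies.\<close>
      let ?g = "\<lambda>x \<in> carrier E. (\<ominus>\<^bsub>K\<^esub> \<one>\<^bsub>K\<^esub>) \<otimes>\<^bsub>K\<^esub> f x"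
      have "?g \<in> carrier (dual_module K E)"
        using f lin(3)[of E f "\<ominus>\<^bsub>K\<^esub> \<one>\<^bsub>K\<^esub>"] by (simp add: carrier_dual rl)
      moreover have "?g \<oplus>\<^bsub>dual_module K E\<^esub> f = \<zero>\<^bsub>dual_module K E\<^esub>"
        using f by (intro ext) (auto simp: dual_simps carrier_dual val E.R.l_minus E.R.l_neg)
      ultimately show "\<exists>g\<in>carrier (dual_module K E). g \<oplus>\<^bsub>dual_module K E\<^esub> f = \<zero>\<^bsub>dual_module K E\<^esub>"
        by blast
    qed (auto simp: carrier_dual dual_simps val E.R.a_ac intro!: rl lin ext)
  qed (auto simp: carrier_dual dual_simps val E.R.l_distr E.R.r_distr E.R.m_assoc E.R.is_cring
      intro!: rl lin ext)
qed

lemma linear_map_evaluation: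
  assumes "module K E" "x \<in> carrier E"
  shows "linear_map K (dual_module K E) (self_module K) (\<lambda>f. f x)"
  using assms(2) by (intro linear_mapI) (auto simp: carrier_dual dual_simps linear_map_def)

text \<open>Uniqueness of coordinates makes them linear in \<open>x\<close>; restricted to the
  carrier they form the dual basis \<open>e'\<close>, and a functional has its values on
  \<open>B\<close> as coordinates.\<close>

lemma finite_basis_dual:
  assumes "module K E" "finite_basis K E B"
  obtains e' where "coordinates K E B (\<lambda>b. b) (\<lambda>b x. e' b x)"
    and "coordinates K (dual_module K E) B e' (\<lambda>b f. f b)"
proof -
  interpret E: module K E by fact
  interpret D: module K "dual_module K E" by (rule module_dual[OF assms(1)])
  have B: "finite B" "B \<subseteq> carrier E"
    and uniq: "\<And>x. x \<in> carrier E \<Longrightarrow> \<exists>!c. c \<in> B \<rightarrow>\<^sub>E carrier K \<and> x = (\<Oplus>\<^bsub>E\<^esub>b \<in> B. c b \<odot>\<^bsub>E\<^esub> b)"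
    using assms(2) by (auto simp: finite_basis_def)
  define c where "c x = (THE c. c \<in> B \<rightarrow>\<^sub>E carrier K \<and> x = (\<Oplus>\<^bsub>E\<^esub>b \<in> B. c b \<odot>\<^bsub>E\<^esub> b))" for x
  have c: "c x \<in> B \<rightarrow>\<^sub>E carrier K" "x = (\<Oplus>\<^bsub>E\<^esub>b \<in> B. c x b \<odot>\<^bsub>E\<^esub> b)" if "x \<in> carrier E" for x
    using theI'[OF uniq[OF that]] unfolding c_def by blast+
  have cc: "c x b \<in> carrier K" if "x \<in> carrier E" "b \<in> B" for x b
    using c(1)[OF that(1)] that(2) by auto
  \<comment> \<open>Uniqueness holds among families that are \<open>undefined\<close> outside
    \<open>B\<close>, so \<open>k\<close> is restricted before it is compared with
    \<open>c x\<close>.\<close>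
  have c_eq: "c x b = k b" if "x \<in> carrier E" "\<And>b. b \<in> B \<Longrightarrow> k b \<in> carrier K"
    "x = (\<Oplus>\<^bsub>E\<^esub>b \<in> B. k b \<odot>\<^bsub>E\<^esub> b)" "b \<in> B" for x k b
  proof -
    have "(\<Oplus>\<^bsub>E\<^esub>b \<in> B. k b \<odot>\<^bsub>E\<^esub> b) = (\<Oplus>\<^bsub>E\<^esub>b \<in> B. restrict k B b \<odot>\<^bsub>E\<^esub> b)"
      using that(2) B by (intro E.finsum_cong') auto
    then have "restrict k B \<in> B \<rightarrow>\<^sub>E carrier K \<and> x = (\<Oplus>\<^bsub>E\<^esub>b \<in> B. restrict k B b \<odot>\<^bsub>E\<^esub> b)"
      using that(2,3) by simp
    then have "c x = restrict k B"
      unfolding c_def by (rule the1_equality[OF uniq[OF that(1)]])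
    then show ?thesis using that(4) by simp
  qed
  have lin: "linear_map K E (self_module K) (\<lambda>x. c x b)" if b: "b \<in> B" for b
  proof (rule linear_mapI)
    fix x y assume x: "x \<in> carrier E" and y: "y \<in> carrier E"
    have "x \<oplus>\<^bsub>E\<^esub> y = (\<Oplus>\<^bsub>E\<^esub>b \<in> B. c x b \<odot>\<^bsub>E\<^esub> b) \<oplus>\<^bsub>E\<^esub> (\<Oplus>\<^bsub>E\<^esub>b \<in> B. c y b \<odot>\<^bsub>E\<^esub> b)"
      using c(2)[OF x] c(2)[OF y] by simp
    also have "\<dots> = (\<Oplus>\<^bsub>E\<^esub>b \<in> B. c x b \<odot>\<^bsub>E\<^esub> b \<oplus>\<^bsub>E\<^esub> c y b \<odot>\<^bsub>E\<^esub> b)"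
      using cc[OF x] cc[OF y] B by (intro E.finsum_addf[symmetric]) auto
    also have "\<dots> = (\<Oplus>\<^bsub>E\<^esub>b \<in> B. (c x b \<oplus>\<^bsub>K\<^esub> c y b) \<odot>\<^bsub>E\<^esub> b)"
      using cc[OF x] cc[OF y] B by (intro E.finsum_cong') (auto simp: E.smult_l_distr)
    finally have "x \<oplus>\<^bsub>E\<^esub> y = (\<Oplus>\<^bsub>E\<^esub>b \<in> B. (c x b \<oplus>\<^bsub>K\<^esub> c y b) \<odot>\<^bsub>E\<^esub> b)" .
    from c_eq[OF _ _ this b] show "c (x \<oplus>\<^bsub>E\<^esub> y) b = c x b \<oplus>\<^bsub>self_module K\<^esub> c y b"
      using cc x y by simp
  next
    fix k x assume k: "k \<in> carrier K" and x: "x \<in> carrier E"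
    have "k \<odot>\<^bsub>E\<^esub> x = k \<odot>\<^bsub>E\<^esub> (\<Oplus>\<^bsub>E\<^esub>b \<in> B. c x b \<odot>\<^bsub>E\<^esub> b)"
      using c(2)[OF x] by simp
    also have "\<dots> = (\<Oplus>\<^bsub>E\<^esub>b \<in> B. k \<odot>\<^bsub>E\<^esub> (c x b \<odot>\<^bsub>E\<^esub> b))"
      using cc[OF x] B k by (intro E.finsum_smult_ldistr) auto
    also have "\<dots> = (\<Oplus>\<^bsub>E\<^esub>b \<in> B. (k \<otimes>\<^bsub>K\<^esub> c x b) \<odot>\<^bsub>E\<^esub> b)"
      using cc[OF x] B k by (intro E.finsum_cong') (auto simp: E.smult_assoc1)
    finally have "k \<odot>\<^bsub>E\<^esub> x = (\<Oplus>\<^bsub>E\<^esub>b \<in> B. (k \<otimes>\<^bsub>K\<^esub> c x b) \<odot>\<^bsub>E\<^esub> b)" .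
    from c_eq[OF _ _ this b] show "c (k \<odot>\<^bsub>E\<^esub> x) b = k \<odot>\<^bsub>self_module K\<^esub> c x b"
      using cc k x by simp
  qed (use cc b in simp)
  define e' where "e' b = (\<lambda>x \<in> carrier E. c x b)" for b
  have e': "e' b \<in> carrier (dual_module K E)" if "b \<in> B" for b
    using linear_map_restrict[OF assms(1) lin[OF that]] by (simp add: carrier_dual e'_def)
  show thesis
  proof
    show "coordinates K E B (\<lambda>b. b) (\<lambda>b x. e' b x)"
    proof (intro coordinates.intro coordinates_axioms.intro assms(1) B(1))
      fix x assume x: "x \<in> carrier E"
      show "x = (\<Oplus>\<^bsub>E\<^esub>b \<in> B. e' b x \<odot>\<^bsub>E\<^esub> b)"
        using c(2)[OF x] x by (simp add: e'_def)
    qed (use B cc in \<open>auto simp: e'_def\<close>)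
    show "coordinates K (dual_module K E) B e' (\<lambda>b f. f b)"
    proof (intro coordinates.intro coordinates_axioms.intro D.module_axioms B(1) e')
      fix f assume f: "f \<in> carrier (dual_module K E)"
      then have fl: "linear_map K E (self_module K) f" by (simp add: carrier_dual)
      have fb: "f b \<in> carrier K" if "b \<in> B" for b
        using linear_mapD(1)[OF fl, of b] that B by auto
      then show "\<And>b. b \<in> B \<Longrightarrow> f b \<in> carrier K" .
      have t: "f b \<odot>\<^bsub>dual_module K E\<^esub> e' b \<in> carrier (dual_module K E)" if "b \<in> B" for b
        using that by (intro D.smult_closed fb e')
      show "f = (\<Oplus>\<^bsub>dual_module K E\<^esub>b \<in> B. f b \<odot>\<^bsub>dual_module K E\<^esub> e' b)" (is "f = ?s")
      proof (rule extensionalityI)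
        have "?s \<in> carrier (dual_module K E)"
          using t by (intro D.finsum_closed) auto
        then show "?s \<in> extensional (carrier E)" by (simp add: carrier_dual)
        show "f \<in> extensional (carrier E)" using f by (simp add: carrier_dual)
        fix x assume x: "x \<in> carrier E"
        have "f x = f (\<Oplus>\<^bsub>E\<^esub>b \<in> B. c x b \<odot>\<^bsub>E\<^esub> b)" using c(2)[OF x] by simp
        also have "\<dots> = (\<Oplus>\<^bsub>K\<^esub>b \<in> B. f (c x b \<odot>\<^bsub>E\<^esub> b))"
          using linear_map_finsum[OF assms(1) E.R.module_self fl, of "\<lambda>b. c x b \<odot>\<^bsub>E\<^esub> b" B] cc[OF x] B
          by auto
        also have "\<dots> = (\<Oplus>\<^bsub>K\<^esub>b \<in> B. (f b \<odot>\<^bsub>dual_module K E\<^esub> e' b) x)"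
        proof (rule E.R.finsum_cong'[OF refl])
          fix b assume b: "b \<in> B"
          then have "b \<in> carrier E" using B by auto
          then show "f (c x b \<odot>\<^bsub>E\<^esub> b) = (f b \<odot>\<^bsub>dual_module K E\<^esub> e' b) x"
            using linear_mapD(3)[OF fl cc[OF x b]] x cc[OF x b] fb[OF b]
            by (simp add: dual_simps e'_def E.R.m_comm)
        qed (use x cc fb in \<open>auto simp: dual_simps e'_def\<close>)
        also have "\<dots> = ?s x"
          using linear_map_finsum[OF D.module_axioms E.R.module_self linear_map_evaluation[OF assms(1) x],
              of "\<lambda>b. f b \<odot>\<^bsub>dual_module K E\<^esub> e' b" B] t by auto
        finally show "f x = ?s x" .
      qed
    qed
  qed
qed

text \<open>The sum is the image of the nonzero rational \<open>card A\<close>, and the image of its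
  reciprocal is an inverse in \<open>R\<close>.\<close>

lemma (in cring) card_Unit_of_rationals:
  fixes A :: "'i set"
  assumes "contains_rationals R" "finite A" "A \<noteq> {}"
  shows "(\<Oplus>i \<in> A. \<one>) \<in> Units R"
proof -
  obtain h where h: "h \<in> ring_hom (ring_of_type_algebra :: rat ring) R"
    using assms(1) by (auto simp: contains_rationals_def)
  have hc: "h q \<in> carrier R" and h_add: "h (q + q') = h q \<oplus> h q'" and h_mult: "h (q * q') = h q \<otimes> h q'"
    and h_one: "h 1 = \<one>" for q q'
    using h by (auto simp: ring_hom_def ring_of_type_algebra_def)
  have h_zero: "h 0 = \<zero>"
    using h_add[of 0 0] hc[of 0] by (simp add: add.l_cancel_one)
  have card: "(\<Oplus>i \<in> C. \<one>) = h (of_nat (card C))" if "finite C" for C :: "'i set"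
    using that
  proof (induction C)
    case empty
    then show ?case by (simp add: finsum_empty h_zero)
  next
    case (insert i C)
    then show ?case by (simp add: finsum_insert h_add h_one)
  qed
  have "of_nat (card A) \<noteq> (0 :: rat)" using assms(2,3) by simp
  then have "h (of_nat (card A)) \<otimes> h (inverse (of_nat (card A))) = \<one>"
    "h (inverse (of_nat (card A))) \<otimes> h (of_nat (card A)) = \<one>"
    by (simp_all add: h_mult[symmetric] h_one)
  then show ?thesis
    unfolding card[OF assms(2)] Units_def using hc by blast
qed

theorem proposition28:
  fixes K :: "('k, 'r) ring_scheme"
    and W :: "nat \<Rightarrow> (nat \<Rightarrow> nat) set"
    and \<chi> :: "nat \<Rightarrow> (nat \<Rightarrow> nat) \<Rightarrow> 'k"
    and E :: "('k, 'e, 's) module_scheme"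
  assumes "domain K" and "contains_rationals K"
    and "omega_invariant K W \<chi>"
    and "module K E" and "\<exists>B. finite_basis K E B"
  shows "right_unital_module (chi_algebra K W \<chi> (dual_module K E)) (chi_algebra K W \<chi> E)
           (right_inner K W \<chi> E)"
proof -
  interpret K: cring K using assms(4) by (rule module.axioms(1))
  interpret character_sequence K W \<chi>
    by (intro character_sequence.intro character_sequence_axioms.intro K.is_cring assms(3))
  obtain B where "finite_basis K E B" using assms(5) by blast
  then obtain e' where coords: "coordinates K E B (\<lambda>b. b) (\<lambda>b x. e' b x)"
    "coordinates K (dual_module K E) B e' (\<lambda>b f. f b)"
    using finite_basis_dual[OF assms(4)] by blast
  interpret pairing K W \<chi> E "dual_module K E" "\<lambda>x f. f x"
    by (intro pairing.intro pairing_axioms.intro character_sequence_axioms assms(4)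
        module_dual linear_map_evaluation) (auto simp: carrier_dual)
  \<comment> \<open>The basis indexes itself, and \<open>word_pairing\<close> is taken as
    \<open>\<psi>\<close> so that \<open>form\<close> unfolds to the expression in
    \<open>chi_pairing\<close>.\<close>
  interpret dual_pairing K W \<chi> E "dual_module K E" "\<lambda>x f. f x" B "\<lambda>b. b" e' "word_pairing K W \<chi>"
  proof (intro dual_pairing.intro dual_pairing_axioms.intro pairing_axioms coords)
    show "(\<Oplus>\<^bsub>K\<^esub>p \<in> grp d. \<one>\<^bsub>K\<^esub>) \<in> Units K" for d
      using grp_id[of d] by (intro K.card_Unit_of_rationals assms(2) finite_grp) auto
    fix xs fs d assume xs: "xs \<in> words E d" and fs: "fs \<in> words (dual_module K E) d"
    have ev: "(\<Otimes>\<^bsub>K\<^esub>t \<in> {1..d}. (fs ! (t - 1)) (xs ! (Hilbert_Choice.inv p t - 1))) =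
        ev d (permute_word p xs) fs" if p: "p \<in> grp d" for p
    proof -
      have eq: "(fs ! t) (permute_word p xs ! t) = (fs ! t) (xs ! (Hilbert_Choice.inv p (Suc t) - 1))"
        if "t < d" for t
        using that words_length[OF xs] by (simp add: nth_permute_word)
      have cl: "(fs ! t) (permute_word p xs ! t) \<in> carrier K" if "t < d" for t
        by (rule b_closed[OF words_nth[OF permute_word_words[OF grp_permutes[OF p] xs] that]
              words_nth[OF fs that]])
      have "{1..d} = Suc ` {..<d}"
        by (simp add: image_Suc_lessThan)
      then have "(\<Otimes>\<^bsub>K\<^esub>t \<in> {1..d}. (fs ! (t - 1)) (xs ! (Hilbert_Choice.inv p t - 1))) =
          (\<Otimes>\<^bsub>K\<^esub>t \<in> Suc ` {..<d}. (fs ! (t - 1)) (xs ! (Hilbert_Choice.inv p t - 1)))"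
        by (rule arg_cong)
      also have "\<dots> = (\<Otimes>\<^bsub>K\<^esub>t \<in> {..<d}. (fs ! (Suc t - 1)) (xs ! (Hilbert_Choice.inv p (Suc t) - 1)))"
        using cl eq by (intro K.finprod_reindex) auto
      also have "\<dots> = ev d (permute_word p xs) fs"
        unfolding ev_def using cl eq by (intro K.finprod_cong') auto
      finally show ?thesis .
    qed
    show "word_pairing K W \<chi> d xs fs = pair d xs fs"
    proof (cases "d = 0")
      \<comment> \<open>In degree 0 \<open>word_pairing\<close> is 1 by definition; on the other
        side \<open>grp 0\<close> holds only the identity and the product is empty.\<close>
      case True
      then show ?thesis
        by (simp add: word_pairing_def pair_def grp_def chr_def ev_def K.finsum_insert K.finsum_empty)
    next
      case False
      have "(\<Oplus>\<^bsub>K\<^esub>p \<in> grp d. chr d p \<otimes>\<^bsub>K\<^esub>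
          (\<Otimes>\<^bsub>K\<^esub>t \<in> {1..d}. (fs ! (t - 1)) (xs ! (Hilbert_Choice.inv p t - 1)))) = pair d xs fs"
        unfolding pair_def
        by (intro K.finsum_cong'[OF refl] funcsetI term_closed xs fs) (simp_all only: ev)
      with False show ?thesis
        by (simp add: word_pairing_def grp_def chr_def)
    qed
  qed
  \<comment> \<open>An equality for all arguments, on and off the carriers: both sides unfold to the
    same term. Hence the \<open>THE\<close> of \<open>right_inner\<close> is that of
    \<open>act\<close>.\<close>
  have "chi_pairing K W \<chi> E = graded_form"
    by (intro ext) (simp add: chi_pairing_def graded_form_def B.bilift_def)
  then have "right_inner K W \<chi> E = act"
    by (intro ext) (simp add: right_inner_def act_def Let_def)
  then show ?thesis
    using right_unital_module_act by simp
qed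

end
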